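(* Let $n\ge 1$ and $k\ge 0$ be integers. The eigenspace of the Laplacian on the prism space $S^3/D^*_n$ with wave number $k$ (i.e. $\nabla^2\Psi=-k(k+2)\Psi$), where $D_n^*$ is the binary dihedral group of order $4n$, has an orthonormal basis which, when lifted to $D_n^*$-invariant eigenmodes of $S^3$, consists of exactly the following functions. In items 2–6, $\ell$ ranges over positive integers; in items 7–10, $\{\ell,m\}$ ranges over unordered pairs of distinct positive integers (each pair being used once, in either order). A function is listed only when the $\Psi_{k,\cdot,\cdot}$ occurring in it exist (recall that $\Psi_{k\ell m}$ exists if and only if $|\ell|+|m|\le k$ and $\ell+m\equiv k\pmod 2$). 1. $\Psi_{k,0,0}$, if $k\equiv 0\pmod 4$. 2. $\sqrt{\tfrac12}(\Psi_{k,\ell,0}+\Psi_{k,0,\ell})$ and $\sqrt{\tfrac12}(\Psi_{k,-\ell,0}-\Psi_{k,0,-\ell})$, if $\ell\equiv 0\pmod{2n}$ and $d=\frac{k-\ell}{2}$ is even. 3. $\sqrt{\tfrac12}(\Psi_{k,\ell,0}-\Psi_{k,0,\ell})$ and $\sqrt{\tfrac12}(\Psi_{k,-\ell,0}+\Psi_{k,0,-\ell})$, if $\ell\equiv 0\pmod{2n}$ and $d=\frac{k-\ell}{2}$ is odd. 4. $\sqrt{\tfrac12}(\Psi_{k,\ell,\ell}+\Psi_{k,-\ell,-\ell})$ and $\sqrt{\tfrac12}(\Psi_{k,-\ell,\ell}-\Psi_{k,\ell,-\ell})$, if $k\equiv 0\pmod 4$. 5. $\sqrt{\tfrac12}(\Psi_{k,\ell,\ell}-\Psi_{k,-\ell,-\ell})$,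 if $2\ell\equiv 0\pmod{2n}$ and $k\equiv 0\pmod 4$. 6. $\sqrt{\tfrac12}(\Psi_{k,-\ell,\ell}+\Psi_{k,\ell,-\ell})$, if $2\ell\equiv 0\pmod{2n}$ and $k\equiv 2\pmod 4$. 7. $\tfrac12\big((\Psi_{k,+\ell,+m}+\Psi_{k,-\ell,-m})+(\Psi_{k,+m,+\ell}+\Psi_{k,-m,-\ell})\big)$ and $\tfrac12\big((\Psi_{k,+\ell,-m}-\Psi_{k,-\ell,+m})-(\Psi_{k,-m,+\ell}-\Psi_{k,+m,-\ell})\big)$, if $\ell\equiv m\pmod{2n}$ and $\sigma_{k\ell m}>0$. 8. $\tfrac12\big((\Psi_{k,+\ell,+m}+\Psi_{k,-\ell,-m})-(\Psi_{k,+m,+\ell}+\Psi_{k,-m,-\ell})\big)$ and $\tfrac12\big((\Psi_{k,+\ell,-m}-\Psi_{k,-\ell,+m})+(\Psi_{k,-m,+\ell}-\Psi_{k,+m,-\ell})\big)$, if $\ell\equiv m\pmod{2n}$ and $\sigma_{k\ell m}<0$. 9. $\tfrac12\big((\Psi_{k,+\ell,+m}-\Psi_{k,-\ell,-m})+(\Psi_{k,+m,+\ell}-\Psi_{k,-m,-\ell})\big)$ and $\tfrac12\big((\Psi_{k,+\ell,-m}+\Psi_{k,-\ell,+m})-(\Psi_{k,-m,+\ell}+\Psi_{k,+m,-\ell})\big)$, if $\ell\equiv -m\pmod{2n}$ and $\sigma_{k\ell m}>0$. 10. $\tfrac12\big((\Psi_{k,+\ell,+m}-\Psi_{k,-\ell,-m})-(\Psi_{k,+m,+\ell}-\Psi_{k,-m,-\ell})\big)$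 and $\tfrac12\big((\Psi_{k,+\ell,-m}+\Psi_{k,-\ell,+m})+(\Psi_{k,-m,+\ell}+\Psi_{k,+m,-\ell})\big)$, if $\ell\equiv -m\pmod{2n}$ and $\sigma_{k\ell m}<0$.
   Context: $S^3=\{(x,y,z,w)\in\mathbb{R}^4 : x^2+y^2+z^2+w^2=1\}$ carries its standard round metric, with volume form $dV$ and Laplacian $\nabla^2$ (divergence of the gradient). Functions are smooth and real-valued. Toroidal coordinates $(\chi,\theta,\varphi)$ on $S^3$, with $0\le\chi\le\pi/2$, $0\le\theta\le 2\pi$, $0\le\varphi\le 2\pi$ (angles $\theta,\varphi$ taken mod $2\pi$), are defined by $$x=\cos\chi\cos\theta,\quad y=\cos\chi\sin\theta,\quad z=\sin\chi\cos\varphi,\quad w=\sin\chi\sin\varphi .$$ For an integer $k\ge 0$ (the wave number) and integers $\ell,m$ with $|\ell|+|m|\le k$ and $\ell+m\equiv k\pmod 2$ (exactly then we say $\Psi_{k\ell m}$ exists), put $d=\frac{k-(|\ell|+|m|)}{2}$ and $$X_{k\ell m}(\chi)=\cos^{|\ell|}\chi\,\sin^{|m|}\chi\;P_d^{(|m|,|\ell|)}(\cos 2\chi),$$ where $P_d^{(|m|,|\ell|)}$ is the Jacobi polynomial $$P_d^{(|m|,|\ell|)}(u)=\frac{1}{2^d}\sum_{i=0}^d\binom{|m|+d}{i}\binom{|\ell|+d}{d-i}(u+1)^i(u-1)^{d-i}.$$ Let $\Theta_\ell(\theta)=\cos(|\ell|\theta)$ if $\ell\ge 0$ and $\Theta_\ell(\theta)=\sin(|\ell|\theta)$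 if $\ell<0$; let $\Phi_m(\varphi)=\cos(|m|\varphi)$ if $m\ge 0$ and $\Phi_m(\varphi)=\sin(|m|\varphi)$ if $m<0$. Set $\widetilde\Psi_{k\ell m}(\chi,\theta,\varphi)=X_{k\ell m}(\chi)\,\Theta_\ell(\theta)\,\Phi_m(\varphi)$, regarded as a function on $S^3$ (with the convention $0^0=1$), and $$\Psi_{k\ell m}=\frac{\widetilde\Psi_{k\ell m}}{\sqrt{2^{\hat\ell+\hat m}}\;\pi\;\sqrt{\frac{(|\ell|+d)!\,(|m|+d)!}{2(k+1)\,d!\,(|\ell|+|m|+d)!}}},$$ where $\hat\ell=1$ if $\ell=0$ and $\hat\ell=0$ otherwise, and $\hat m=1$ if $m=0$ and $\hat m=0$ otherwise. The sign $\sigma_{k\ell m}\in\{+1,-1\}$ is the product of four signs: the first is $+$ if and only if $d=\frac{k-(|\ell|+|m|)}{2}$ is even; the second is $+$ if and only if $\ell\ge 0$; the third is $+$ if and only if $m\ge 0$; the fourth is $+$ if and only if $m$ is even. The binary dihedral group $D_n^*$ (of order $4n$) is the group of isometries of $S^3$ generated by $$(\chi,\theta,\varphi)\mapsto\left(\chi,\ \theta+\tfrac{2\pi}{2n},\ \varphi+\tfrac{2\pi}{2n}\right)\quad\text{and}\quad(\chi,\theta,\varphi)\mapsto\left(\tfrac{\pi}{2}-\chi,\ -\varphi,\ \pi-\theta\right),$$ and the prism space is the quotient $S^3/D_n^*$ with the induced metric. Functions on $S^3/D_n^*$ are identified with their lifts, the $D_n^*$-invariant functions on $S^3$; orthonormality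 is with respect to the inner product $\langle f,g\rangle=\int_{S^3}fg\,dV$ of the lifts. *)

theory Defs
  imports
    "HOL-Analysis.Analysis"
    "HOL-Algebra.Bij"
    "HOL-Algebra.Generated_Groups"
    "HOL-Number_Theory.Cong"
begin

section \<open>The round 3-sphere\<close>

text \<open>
  Functions on the 3-sphere are represented by functions on \<^typ>\<open>real^4\<close> of which only the
  values on \<^term>\<open>S3\<close> matter: every notion below depends on these values alone.
\<close>

abbreviation S3 :: "(real^4) set" where
  "S3 \<equiv> sphere 0 1"

fun Ck_on :: "nat \<Rightarrow> 'a::real_normed_vector set \<Rightarrow> ('a \<Rightarrow> real) \<Rightarrow> bool" where
  "Ck_on 0 U f \<longleftrightarrow> continuous_on U f"
| "Ck_on (Suc r) U f \<longleftrightarrow>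
     (\<exists>f'. (\<forall>p\<in>U. (f has_derivative f' p) (at p)) \<and> (\<forall>v. Ck_on r U (\<lambda>p. f' p v)))"

definition smooth_on_S3 :: "(real^4 \<Rightarrow> real) \<Rightarrow> bool" where
  "smooth_on_S3 f \<longleftrightarrow>
     (\<forall>p\<in>S3. \<exists>U F. open U \<and> p \<in> U \<and> (\<forall>r. Ck_on r U F) \<and> (\<forall>q\<in>U \<inter> S3. F q = f q))"

text \<open>
  Derivatives are taken within \<^term>\<open>S3\<close>, which determines them on the tangent space
  \<open>{v. v \<bullet> p = 0}\<close> only. The gradient is the tangent vector representing the differential.
  For the divergence, the differential of a tangent vector field is extended by 0 to the normal
  line spanned by \<open>p\<close>, so that its trace over \<^typ>\<open>real^4\<close> is the sum of \<open>D e \<bullet> e\<close> over an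
  orthonormal basis of the tangent space. This is the trace of the Levi-Civita derivative, which
  is the tangential part of \<open>D\<close>.
\<close>

definition grad_S3 :: "(real^4 \<Rightarrow> real) \<Rightarrow> real^4 \<Rightarrow> real^4" where
  "grad_S3 f p = (THE v. v \<bullet> p = 0 \<and> (f has_derivative (\<lambda>h. v \<bullet> h)) (at p within S3))"

definition div_S3 :: "(real^4 \<Rightarrow> real^4) \<Rightarrow> real^4 \<Rightarrow> real" where
  "div_S3 V p = trace (matrix (THE D. (V has_derivative D) (at p within S3) \<and> D p = 0))"

definition laplacian_S3 :: "(real^4 \<Rightarrow> real) \<Rightarrow> real^4 \<Rightarrow> real" where
  "laplacian_S3 f = div_S3 (grad_S3 f)"


section \<open>Toroidal coordinates\<close>

text \<open>The coordinate called chi is written \<open>\<xi>\<close>, since \<open>\<chi>\<close> is the binder for vectors.\<close>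

definition toroidal :: "real \<Rightarrow> real \<Rightarrow> real \<Rightarrow> real^4" where
  "toroidal \<xi> \<theta> \<phi> = vector [cos \<xi> * cos \<theta>, cos \<xi> * sin \<theta>, sin \<xi> * cos \<phi>, sin \<xi> * sin \<phi>]"

definition toroidal_box :: "(real \<times> real \<times> real) set" where
  "toroidal_box = {0..pi/2} \<times> {0..2*pi} \<times> {0..2*pi}"

text \<open>
  Reading a function of toroidal coordinates as a function on \<^term>\<open>S3\<close>, by choosing coordinates
  of each point. It is used only where the result does not depend on the choice; see the lemmas
  \<open>mode_toroidal\<close>, \<open>screw_toroidal\<close> and \<open>flip_toroidal\<close> below.
\<close>

definition on_S3 :: "(real \<Rightarrow> real \<Rightarrow> real \<Rightarrow> 'a) \<Rightarrow> real^4 \<Rightarrow> 'a" where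
  "on_S3 F p = (case (SOME c. c \<in> toroidal_box \<and> (case c of (\<xi>, \<theta>, \<phi>) \<Rightarrow> toroidal \<xi> \<theta> \<phi> = p))
                of (\<xi>, \<theta>, \<phi>) \<Rightarrow> F \<xi> \<theta> \<phi>)"

text \<open>
  The volume form of the induced metric is \<open>sqrt (det g) d\<xi> d\<theta> d\<phi>\<close>, with \<open>g\<close> the Gram matrix of the
  coordinate vector fields; toroidal coordinates are injective off a null set of the box.
\<close>

definition toroidal_frame :: "real \<Rightarrow> real \<Rightarrow> real \<Rightarrow> (real^4)^3" where
  "toroidal_frame \<xi> \<theta> \<phi> = vector
     [vector_derivative (\<lambda>t. toroidal t \<theta> \<phi>) (at \<xi>),
      vector_derivative (\<lambda>t. toroidal \<xi> t \<phi>) (at \<theta>),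
      vector_derivative (\<lambda>t. toroidal \<xi> \<theta> t) (at \<phi>)]"

definition volume_density :: "real \<Rightarrow> real \<Rightarrow> real \<Rightarrow> real" where
  "volume_density \<xi> \<theta> \<phi> =
     sqrt (det (\<chi> i j. (toroidal_frame \<xi> \<theta> \<phi> $ i) \<bullet> (toroidal_frame \<xi> \<theta> \<phi> $ j)))"

definition integral_S3 :: "(real^4 \<Rightarrow> real) \<Rightarrow> real" where
  "integral_S3 f = set_lebesgue_integral lborel toroidal_box
     (\<lambda>(\<xi>, \<theta>, \<phi>). f (toroidal \<xi> \<theta> \<phi>) * volume_density \<xi> \<theta> \<phi>)"

definition inner_S3 :: "(real^4 \<Rightarrow> real) \<Rightarrow> (real^4 \<Rightarrow> real) \<Rightarrow> real" where
  "inner_S3 f g = integral_S3 (\<lambda>p. f p * g p)"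

definition is_orthonormal_basis_S3 ::
    "(real^4 \<Rightarrow> real) set \<Rightarrow> (real^4 \<Rightarrow> real) set \<Rightarrow> bool" where
  "is_orthonormal_basis_S3 B E \<longleftrightarrow>
     finite B \<and> B \<subseteq> E \<and>
     (\<forall>f\<in>B. \<forall>g\<in>B. inner_S3 f g = (if f = g then 1 else 0)) \<and>
     (\<forall>f\<in>E. \<exists>c. \<forall>p\<in>S3. f p = (\<Sum>b\<in>B. c b * b p))"


section \<open>Toroidal eigenmodes\<close>

definition mode_exists :: "nat \<Rightarrow> int \<Rightarrow> int \<Rightarrow> bool" where
  "mode_exists k l m \<longleftrightarrow> \<bar>l\<bar> + \<bar>m\<bar> \<le> int k \<and> [l + m = int k] (mod 2)"

text \<open>By \<open>mode_exists_sym\<close>, one existence condition covers all modes occurring in a listed function.\<close>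

lemma mode_exists_sym:
  "mode_exists k (- l) m \<longleftrightarrow> mode_exists k l m"
  "mode_exists k l (- m) \<longleftrightarrow> mode_exists k l m"
  "mode_exists k l m \<longleftrightarrow> mode_exists k m l"
  by (auto simp: mode_exists_def cong_iff_dvd_diff)

definition mode_degree :: "nat \<Rightarrow> int \<Rightarrow> int \<Rightarrow> nat" where
  "mode_degree k l m = nat ((int k - (\<bar>l\<bar> + \<bar>m\<bar>)) div 2)"

definition jacobi_poly :: "nat \<Rightarrow> nat \<Rightarrow> nat \<Rightarrow> real \<Rightarrow> real" where
  "jacobi_poly \<alpha> \<beta> d u = 1 / 2^d *
     (\<Sum>i=0..d. real ((\<alpha> + d) choose i) * real ((\<beta> + d) choose (d - i)) * (u + 1)^i * (u - 1)^(d - i))"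

definition mode_radial :: "nat \<Rightarrow> int \<Rightarrow> int \<Rightarrow> real \<Rightarrow> real" where
  "mode_radial k l m \<xi> = cos \<xi> ^ nat \<bar>l\<bar> * sin \<xi> ^ nat \<bar>m\<bar> *
     jacobi_poly (nat \<bar>m\<bar>) (nat \<bar>l\<bar>) (mode_degree k l m) (cos (2 * \<xi>))"

definition mode_angular :: "int \<Rightarrow> real \<Rightarrow> real" where
  "mode_angular l \<theta> = (if l \<ge> 0 then cos (real_of_int \<bar>l\<bar> * \<theta>) else sin (real_of_int \<bar>l\<bar> * \<theta>))"

definition mode_raw :: "nat \<Rightarrow> int \<Rightarrow> int \<Rightarrow> real \<Rightarrow> real \<Rightarrow> real \<Rightarrow> real" where
  "mode_raw k l m \<xi> \<theta> \<phi> = mode_radial k l m \<xi> * mode_angular l \<theta> * mode_angular m \<phi>"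

definition mode_norm :: "nat \<Rightarrow> int \<Rightarrow> int \<Rightarrow> real" where
  "mode_norm k l m =
     (let a = nat \<bar>l\<bar>; b = nat \<bar>m\<bar>; d = mode_degree k l m;
          l' = (if l = 0 then 1 else 0); m' = (if m = 0 then 1 else 0)
      in sqrt (2 ^ (l' + m')) * pi *
         sqrt (fact (a + d) * fact (b + d) / (2 * (real k + 1) * fact d * fact (a + b + d))))"

definition mode :: "nat \<Rightarrow> int \<Rightarrow> int \<Rightarrow> real^4 \<Rightarrow> real"  ("\<Psi>") where
  "\<Psi> k l m p = on_S3 (mode_raw k l m) p / mode_norm k l m"

definition mode_sign :: "nat \<Rightarrow> int \<Rightarrow> int \<Rightarrow> int"  ("\<sigma>") where
  "\<sigma> k l m = (if even (mode_degree k l m) then 1 else - 1) * (if l \<ge> 0 then 1 else - 1)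
              * (if m \<ge> 0 then 1 else - 1) * (if even m then 1 else - 1)"


section \<open>Binary dihedral groups and the eigenspaces of prism spaces\<close>

definition screw :: "nat \<Rightarrow> real^4 \<Rightarrow> real^4" where
  "screw n = on_S3 (\<lambda>\<xi> \<theta> \<phi>. toroidal \<xi> (\<theta> + 2*pi / (2 * real n)) (\<phi> + 2*pi / (2 * real n)))"

definition flip :: "real^4 \<Rightarrow> real^4" where
  "flip = on_S3 (\<lambda>\<xi> \<theta> \<phi>. toroidal (pi/2 - \<xi>) (- \<phi>) (pi - \<theta>))"

definition binary_dihedral :: "nat \<Rightarrow> (real^4 \<Rightarrow> real^4) set" where
  "binary_dihedral n = generate (BijGroup S3) {restrict (screw n) S3, restrict flip S3}"

definition prism_eigenspace :: "nat \<Rightarrow> nat \<Rightarrow> (real^4 \<Rightarrow> real) set" where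
  "prism_eigenspace n k =
     {f. smooth_on_S3 f \<and>
         (\<forall>g\<in>binary_dihedral n. \<forall>p\<in>S3. f (g p) = f p) \<and>
         (\<forall>p\<in>S3. laplacian_S3 f p = - (real k * (real k + 2)) * f p)}"

text \<open>A choice of one of the two orders for each unordered pair of distinct positive integers.\<close>

definition pair_choice :: "(int \<times> int) set \<Rightarrow> bool" where
  "pair_choice R \<longleftrightarrow>
     (\<forall>(l, m)\<in>R. 0 < l \<and> 0 < m \<and> l \<noteq> m) \<and>
     (\<forall>l m. 0 < l \<and> 0 < m \<and> l \<noteq> m \<longrightarrow> ((l, m) \<in> R \<longleftrightarrow> (m, l) \<notin> R))"

inductive_set prism_modes :: "nat \<Rightarrow> nat \<Rightarrow> (int \<times> int) set \<Rightarrow> (real^4 \<Rightarrow> real) set"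
  for n k :: nat and R :: "(int \<times> int) set" where
  m1:
    "\<lbrakk>mode_exists k 0 0; [k = 0] (mod 4)\<rbrakk> \<Longrightarrow>
       \<Psi> k 0 0 \<in> prism_modes n k R"
| m2a:
    "\<lbrakk>0 < l; mode_exists k l 0; [l = 0] (mod 2 * int n); even (mode_degree k l 0)\<rbrakk> \<Longrightarrow>
       (\<lambda>p. sqrt (1/2) * (\<Psi> k l 0 p + \<Psi> k 0 l p)) \<in> prism_modes n k R"
| m2b:
    "\<lbrakk>0 < l; mode_exists k l 0; [l = 0] (mod 2 * int n); even (mode_degree k l 0)\<rbrakk> \<Longrightarrow>
       (\<lambda>p. sqrt (1/2) * (\<Psi> k (-l) 0 p - \<Psi> k 0 (-l) p)) \<in> prism_modes n k R"
| m3a: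
    "\<lbrakk>0 < l; mode_exists k l 0; [l = 0] (mod 2 * int n); odd (mode_degree k l 0)\<rbrakk> \<Longrightarrow>
       (\<lambda>p. sqrt (1/2) * (\<Psi> k l 0 p - \<Psi> k 0 l p)) \<in> prism_modes n k R"
| m3b:
    "\<lbrakk>0 < l; mode_exists k l 0; [l = 0] (mod 2 * int n); odd (mode_degree k l 0)\<rbrakk> \<Longrightarrow>
       (\<lambda>p. sqrt (1/2) * (\<Psi> k (-l) 0 p + \<Psi> k 0 (-l) p)) \<in> prism_modes n k R"
| m4a:
    "\<lbrakk>0 < l; mode_exists k l l; [k = 0] (mod 4)\<rbrakk> \<Longrightarrow>
       (\<lambda>p. sqrt (1/2) * (\<Psi> k l l p + \<Psi> k (-l) (-l) p)) \<in> prism_modes n k R"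
| m4b:
    "\<lbrakk>0 < l; mode_exists k l l; [k = 0] (mod 4)\<rbrakk> \<Longrightarrow>
       (\<lambda>p. sqrt (1/2) * (\<Psi> k (-l) l p - \<Psi> k l (-l) p)) \<in> prism_modes n k R"
| m5:
    "\<lbrakk>0 < l; mode_exists k l l; [2 * l = 0] (mod 2 * int n); [k = 0] (mod 4)\<rbrakk> \<Longrightarrow>
       (\<lambda>p. sqrt (1/2) * (\<Psi> k l l p - \<Psi> k (-l) (-l) p)) \<in> prism_modes n k R"
| m6:
    "\<lbrakk>0 < l; mode_exists k l l; [2 * l = 0] (mod 2 * int n); [k = 2] (mod 4)\<rbrakk> \<Longrightarrow>
       (\<lambda>p. sqrt (1/2) * (\<Psi> k (-l) l p + \<Psi> k l (-l) p)) \<in> prism_modes n k R"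
| m7a:
    "\<lbrakk>(l, m) \<in> R; mode_exists k l m; [l = m] (mod 2 * int n); \<sigma> k l m > 0\<rbrakk> \<Longrightarrow>
       (\<lambda>p. 1/2 * ((\<Psi> k l m p + \<Psi> k (-l) (-m) p) + (\<Psi> k m l p + \<Psi> k (-m) (-l) p)))
         \<in> prism_modes n k R"
| m7b:
    "\<lbrakk>(l, m) \<in> R; mode_exists k l m; [l = m] (mod 2 * int n); \<sigma> k l m > 0\<rbrakk> \<Longrightarrow>
       (\<lambda>p. 1/2 * ((\<Psi> k l (-m) p - \<Psi> k (-l) m p) - (\<Psi> k (-m) l p - \<Psi> k m (-l) p)))
         \<in> prism_modes n k R"
| m8a:
    "\<lbrakk>(l, m) \<in> R; mode_exists k l m; [l = m] (mod 2 * int n); \<sigma> k l m < 0\<rbrakk> \<Longrightarrow>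
       (\<lambda>p. 1/2 * ((\<Psi> k l m p + \<Psi> k (-l) (-m) p) - (\<Psi> k m l p + \<Psi> k (-m) (-l) p)))
         \<in> prism_modes n k R"
| m8b:
    "\<lbrakk>(l, m) \<in> R; mode_exists k l m; [l = m] (mod 2 * int n); \<sigma> k l m < 0\<rbrakk> \<Longrightarrow>
       (\<lambda>p. 1/2 * ((\<Psi> k l (-m) p - \<Psi> k (-l) m p) + (\<Psi> k (-m) l p - \<Psi> k m (-l) p)))
         \<in> prism_modes n k R"
| m9a:
    "\<lbrakk>(l, m) \<in> R; mode_exists k l m; [l = - m] (mod 2 * int n); \<sigma> k l m > 0\<rbrakk> \<Longrightarrow>
       (\<lambda>p. 1/2 * ((\<Psi> k l m p - \<Psi> k (-l) (-m) p) + (\<Psi> k m l p - \<Psi> k (-m) (-l) p)))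
         \<in> prism_modes n k R"
| m9b:
    "\<lbrakk>(l, m) \<in> R; mode_exists k l m; [l = - m] (mod 2 * int n); \<sigma> k l m > 0\<rbrakk> \<Longrightarrow>
       (\<lambda>p. 1/2 * ((\<Psi> k l (-m) p + \<Psi> k (-l) m p) - (\<Psi> k (-m) l p + \<Psi> k m (-l) p)))
         \<in> prism_modes n k R"
| m10a:
    "\<lbrakk>(l, m) \<in> R; mode_exists k l m; [l = - m] (mod 2 * int n); \<sigma> k l m < 0\<rbrakk> \<Longrightarrow>
       (\<lambda>p. 1/2 * ((\<Psi> k l m p - \<Psi> k (-l) (-m) p) - (\<Psi> k m l p - \<Psi> k (-m) (-l) p)))
         \<in> prism_modes n k R"
| m10b:
    "\<lbrakk>(l, m) \<in> R; mode_exists k l m; [l = - m] (mod 2 * int n); \<sigma> k l m < 0\<rbrakk> \<Longrightarrow>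
       (\<lambda>p. 1/2 * ((\<Psi> k l (-m) p + \<Psi> k (-l) m p) + (\<Psi> k (-m) l p + \<Psi> k m (-l) p)))
         \<in> prism_modes n k R"


section \<open>Independence of the choice of coordinates\<close>

lemma vector_4:
  "(vector [a, b, c, d] :: real^4) $ 1 = a"
  "(vector [a, b, c, d] :: real^4) $ 2 = b"
  "(vector [a, b, c, d] :: real^4) $ 3 = c"
  "(vector [a, b, c, d] :: real^4) $ 4 = d"
  unfolding vector_def by simp_all

lemma toroidal_eq_iff:
  "toroidal \<xi> \<theta> \<phi> = toroidal \<xi>' \<theta>' \<phi>' \<longleftrightarrow>
     cos \<xi> * cos \<theta> = cos \<xi>' * cos \<theta>' \<and> cos \<xi> * sin \<theta> = cos \<xi>' * sin \<theta>' \<and>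
     sin \<xi> * cos \<phi> = sin \<xi>' * cos \<phi>' \<and> sin \<xi> * sin \<phi> = sin \<xi>' * sin \<phi>'"
  by (simp add: toroidal_def vec_eq_iff forall_4 vector_4)

lemma toroidal_in_S3: "toroidal \<xi> \<theta> \<phi> \<in> S3"
proof -
  have "(cos \<xi> * cos \<theta>)\<^sup>2 + (cos \<xi> * sin \<theta>)\<^sup>2 + (sin \<xi> * cos \<phi>)\<^sup>2 + (sin \<xi> * sin \<phi>)\<^sup>2
      = (cos \<xi>)\<^sup>2 * ((cos \<theta>)\<^sup>2 + (sin \<theta>)\<^sup>2) + (sin \<xi>)\<^sup>2 * ((cos \<phi>)\<^sup>2 + (sin \<phi>)\<^sup>2)"
    by (simp only: power_mult_distrib distrib_left add.assoc)
  also have "\<dots> = 1"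
    by simp
  finally show ?thesis
    by (simp add: norm_eq_1 inner_vec_def sum_4 toroidal_def vector_4 power2_eq_square)
qed

lemma S3_toroidal:
  assumes "p \<in> S3"
  shows "\<exists>\<xi> \<theta> \<phi>. (\<xi>, \<theta>, \<phi>) \<in> toroidal_box \<and> toroidal \<xi> \<theta> \<phi> = p"
proof -
  have polar: "\<exists>t\<in>{0..2*pi}. a = r * cos t \<and> b = r * sin t" if "a\<^sup>2 + b\<^sup>2 = r\<^sup>2" "r \<ge> 0" for a b r :: real
  proof (cases "r = 0")
    case True
    then have "a = 0" "b = 0" using that by auto
    then show ?thesis using True by (intro bexI[of _ 0]) auto
  next
    case False
    then have "(a/r)\<^sup>2 + (b/r)\<^sup>2 = 1"
      using that by (simp add: power_divide flip: add_divide_distrib)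
    from sincos_total_2pi[OF this] obtain t where "0 \<le> t" "t < 2*pi" "a/r = cos t" "b/r = sin t"
      by auto
    then show ?thesis using False by (intro bexI[of _ t]) (auto simp: field_simps)
  qed
  have n: "(p$1)\<^sup>2 + (p$2)\<^sup>2 + (p$3)\<^sup>2 + (p$4)\<^sup>2 = 1"
    using assms by (simp add: norm_eq_1 inner_vec_def sum_4 power2_eq_square)
  define r s where "r = sqrt ((p$1)\<^sup>2 + (p$2)\<^sup>2)" and "s = sqrt ((p$3)\<^sup>2 + (p$4)\<^sup>2)"
  have rs: "r \<ge> 0" "s \<ge> 0" "r\<^sup>2 = (p$1)\<^sup>2 + (p$2)\<^sup>2" "s\<^sup>2 = (p$3)\<^sup>2 + (p$4)\<^sup>2"
    by (auto simp: r_def s_def)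
  then have "r\<^sup>2 + s\<^sup>2 = 1" using n by simp
  from sincos_total_pi_half[OF rs(1) rs(2) this] obtain \<xi>
    where x: "0 \<le> \<xi>" "\<xi> \<le> pi/2" "r = cos \<xi>" "s = sin \<xi>" by auto
  obtain \<theta> where t: "\<theta> \<in> {0..2*pi}" "p$1 = r * cos \<theta>" "p$2 = r * sin \<theta>"
    using polar[OF rs(3)[symmetric] rs(1)] by auto
  obtain \<phi> where f: "\<phi> \<in> {0..2*pi}" "p$3 = s * cos \<phi>" "p$4 = s * sin \<phi>"
    using polar[OF rs(4)[symmetric] rs(2)] by auto
  show ?thesis
    using x t f
    by (intro exI[of _ \<xi>] exI[of _ \<theta>] exI[of _ \<phi>])
       (simp add: toroidal_box_def toroidal_def vec_eq_iff forall_4 vector_4)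
qed

lemma toroidal_inj:
  assumes "toroidal \<xi> \<theta> \<phi> = toroidal \<xi>' \<theta>' \<phi>'" "\<xi> \<in> {0..pi/2}" "\<xi>' \<in> {0..pi/2}"
  shows "\<xi> = \<xi>'" "cos \<xi> \<noteq> 0 \<Longrightarrow> cos \<theta> = cos \<theta>' \<and> sin \<theta> = sin \<theta>'"
    "sin \<xi> \<noteq> 0 \<Longrightarrow> cos \<phi> = cos \<phi>' \<and> sin \<phi> = sin \<phi>'"
proof -
  note eq = assms(1)[unfolded toroidal_eq_iff]
  have sq: "(cos a * cos b)\<^sup>2 + (cos a * sin b)\<^sup>2 = (cos a)\<^sup>2" for a b :: real
  proof -
    have "(cos a * cos b)\<^sup>2 + (cos a * sin b)\<^sup>2 = (cos a)\<^sup>2 * ((cos b)\<^sup>2 + (sin b)\<^sup>2)"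
      by (simp only: power_mult_distrib distrib_left)
    then show ?thesis by simp
  qed
  have "(cos \<xi> * cos \<theta>)\<^sup>2 + (cos \<xi> * sin \<theta>)\<^sup>2 = (cos \<xi>' * cos \<theta>')\<^sup>2 + (cos \<xi>' * sin \<theta>')\<^sup>2"
    by (simp only: eq)
  then have "(cos \<xi>)\<^sup>2 = (cos \<xi>')\<^sup>2"
    by (simp only: sq)
  moreover have "cos \<xi> \<ge> 0" "cos \<xi>' \<ge> 0"
    using assms(2,3) by (auto intro: cos_ge_zero)
  ultimately have c: "cos \<xi> = cos \<xi>'"
    by (rule power2_eq_imp_eq)
  have "0 \<le> \<xi>" "\<xi> \<le> pi" "0 \<le> \<xi>'" "\<xi>' \<le> pi"
    using assms(2,3) by auto
  then show x: "\<xi> = \<xi>'"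
    using c by (rule cos_inj_pi)
  show "cos \<theta> = cos \<theta>' \<and> sin \<theta> = sin \<theta>'" if "cos \<xi> \<noteq> 0"
    using eq that by (simp only: x mult_cancel_left) blast
  show "cos \<phi> = cos \<phi>' \<and> sin \<phi> = sin \<phi>'" if "sin \<xi> \<noteq> 0"
    using eq that by (simp only: x mult_cancel_left) blast
qed

lemma on_S3_toroidal:
  assumes "\<xi> \<in> {0..pi/2}"
    and "\<And>\<xi>' \<theta>' \<phi>'. \<xi>' \<in> {0..pi/2} \<Longrightarrow> toroidal \<xi>' \<theta>' \<phi>' = toroidal \<xi> \<theta> \<phi> \<Longrightarrow> F \<xi>' \<theta>' \<phi>' = F \<xi> \<theta> \<phi>"
  shows "on_S3 F (toroidal \<xi> \<theta> \<phi>) = F \<xi> \<theta> \<phi>"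
proof -
  let ?P = "\<lambda>c. c \<in> toroidal_box \<and> (case c of (a, b, c) \<Rightarrow> toroidal a b c = toroidal \<xi> \<theta> \<phi>)"
  obtain a b c where abc: "Eps ?P = (a, b, c)" by (cases "Eps ?P")
  have "\<exists>c. ?P c" using S3_toroidal[OF toroidal_in_S3, of \<xi> \<theta> \<phi>] by auto
  then have "?P (Eps ?P)" by (rule someI_ex)
  then have "?P (a, b, c)" unfolding abc .
  then have "a \<in> {0..pi/2}" "toroidal a b c = toroidal \<xi> \<theta> \<phi>"
    by (auto simp: toroidal_box_def)
  then have "F a b c = F \<xi> \<theta> \<phi>" by (rule assms(2))
  then show ?thesis by (simp add: on_S3_def abc)
qed

lemma mode_angular_cong:
  assumes "cos t = cos t'" "sin t = sin t'"
  shows "mode_angular l t = mode_angular l t'"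
proof -
  obtain N :: int where "t = t' + 2 * pi * N"
    using assms sin_cos_eq_iff by metis
  then have "of_int \<bar>l\<bar> * t = of_int \<bar>l\<bar> * t' + 2 * pi * of_int (\<bar>l\<bar> * N)"
    by (simp add: algebra_simps)
  then have "sin (of_int \<bar>l\<bar> * t) = sin (of_int \<bar>l\<bar> * t') \<and> cos (of_int \<bar>l\<bar> * t) = cos (of_int \<bar>l\<bar> * t')"
    using sin_cos_eq_iff by blast
  then show ?thesis unfolding mode_angular_def by (elim conjE) (simp only:)
qed

lemma mode_toroidal:
  assumes "\<xi> \<in> {0..pi/2}"
  shows "\<Psi> k l m (toroidal \<xi> \<theta> \<phi>) = mode_raw k l m \<xi> \<theta> \<phi> / mode_norm k l m"
proof -
  have "mode_raw k l m \<xi>' \<theta>' \<phi>' = mode_raw k l m \<xi> \<theta> \<phi>"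
    if \<xi>': "\<xi>' \<in> {0..pi/2}" and eq: "toroidal \<xi>' \<theta>' \<phi>' = toroidal \<xi> \<theta> \<phi>" for \<xi>' \<theta>' \<phi>'
  proof -
    note inj = toroidal_inj[OF eq \<xi>' assms]
    have 1: "cos \<xi> ^ nat \<bar>l\<bar> * mode_angular l \<theta>' = cos \<xi> ^ nat \<bar>l\<bar> * mode_angular l \<theta>"
    proof (cases "l = 0 \<or> cos \<xi> = 0")
      case True then show ?thesis by (auto simp: mode_angular_def)
    next
      case False then show ?thesis using inj mode_angular_cong[of \<theta>' \<theta> l] by simp
    qed
    have 2: "sin \<xi> ^ nat \<bar>m\<bar> * mode_angular m \<phi>' = sin \<xi> ^ nat \<bar>m\<bar> * mode_angular m \<phi>"
    proof (cases "m = 0 \<or> sin \<xi> = 0")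
      case True then show ?thesis by (auto simp: mode_angular_def)
    next
      case False then show ?thesis using inj mode_angular_cong[of \<phi>' \<phi> m] by simp
    qed
    have split: "mode_raw k l m \<xi> t f =
        (cos \<xi> ^ nat \<bar>l\<bar> * mode_angular l t) * (sin \<xi> ^ nat \<bar>m\<bar> * mode_angular m f) *
        jacobi_poly (nat \<bar>m\<bar>) (nat \<bar>l\<bar>) (mode_degree k l m) (cos (2 * \<xi>))" for t f
      by (simp add: mode_raw_def mode_radial_def)
    show ?thesis
      unfolding inj(1) split 1 2 ..
  qed
  then show ?thesis
    unfolding mode_def by (subst on_S3_toroidal[OF assms]) auto
qed

lemma screw_toroidal:
  assumes "\<xi> \<in> {0..pi/2}"
  shows "screw n (toroidal \<xi> \<theta> \<phi>) = toroidal \<xi> (\<theta> + 2*pi / (2 * real n)) (\<phi> + 2*pi / (2 * real n))"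
  unfolding screw_def
proof (rule on_S3_toroidal[OF assms])
  fix \<xi>' \<theta>' \<phi>' assume \<xi>': "\<xi>' \<in> {0..pi/2}" and eq: "toroidal \<xi>' \<theta>' \<phi>' = toroidal \<xi> \<theta> \<phi>"
  note inj = toroidal_inj[OF eq \<xi>' assms]
  show "toroidal \<xi>' (\<theta>' + 2*pi / (2 * real n)) (\<phi>' + 2*pi / (2 * real n))
      = toroidal \<xi> (\<theta> + 2*pi / (2 * real n)) (\<phi> + 2*pi / (2 * real n))"
    using inj by (cases "cos \<xi> = 0"; cases "sin \<xi> = 0")
      (auto simp: toroidal_eq_iff cos_add sin_add)
qed

lemma flip_toroidal:
  assumes "\<xi> \<in> {0..pi/2}"
  shows "flip (toroidal \<xi> \<theta> \<phi>) = toroidal (pi/2 - \<xi>) (- \<phi>) (pi - \<theta>)"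
  unfolding flip_def
proof (rule on_S3_toroidal[OF assms])
  fix \<xi>' \<theta>' \<phi>' assume \<xi>': "\<xi>' \<in> {0..pi/2}" and eq: "toroidal \<xi>' \<theta>' \<phi>' = toroidal \<xi> \<theta> \<phi>"
  note inj = toroidal_inj[OF eq \<xi>' assms]
  show "toroidal (pi/2 - \<xi>') (- \<phi>') (pi - \<theta>') = toroidal (pi/2 - \<xi>) (- \<phi>) (pi - \<theta>)"
    using inj by (cases "cos \<xi> = 0"; cases "sin \<xi> = 0")
      (auto simp: toroidal_eq_iff cos_diff sin_diff)
qed

lemma generators_in_BijGroup:
  shows "restrict (screw n) S3 \<in> carrier (BijGroup S3)" "restrict flip S3 \<in> carrier (BijGroup S3)"
proof -
  have bij: "restrict f S3 \<in> carrier (BijGroup S3)"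
    if surj: "\<And>p. p \<in> S3 \<Longrightarrow> f p \<in> S3 \<and> g p \<in> S3 \<and> f (g p) = p \<and> g (f p) = p"
    for f g :: "real^4 \<Rightarrow> real^4"
  proof -
    have "bij_betw f S3 S3"
      by (rule bij_betwI[where g = g]) (use surj in auto)
    then show ?thesis
      by (simp add: BijGroup_def Bij_def bij_betw_restrict_eq)
  qed
  define c where "c = 2*pi / (2 * real n)"
  define g where "g = on_S3 (\<lambda>\<xi> \<theta> \<phi>. toroidal \<xi> (\<theta> - c) (\<phi> - c))"
  have g: "g (toroidal \<xi> \<theta> \<phi>) = toroidal \<xi> (\<theta> - c) (\<phi> - c)" if x: "\<xi> \<in> {0..pi/2}" for \<xi> \<theta> \<phi>
    unfolding g_def
  proof (rule on_S3_toroidal[OF x])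
    fix \<xi>' \<theta>' \<phi>' assume \<xi>': "\<xi>' \<in> {0..pi/2}" and eq: "toroidal \<xi>' \<theta>' \<phi>' = toroidal \<xi> \<theta> \<phi>"
    show "toroidal \<xi>' (\<theta>' - c) (\<phi>' - c) = toroidal \<xi> (\<theta> - c) (\<phi> - c)"
      using toroidal_inj[OF eq \<xi>' x] by (cases "cos \<xi> = 0"; cases "sin \<xi> = 0")
        (auto simp: toroidal_eq_iff cos_diff sin_diff)
  qed
  show "restrict (screw n) S3 \<in> carrier (BijGroup S3)"
  proof (rule bij[where g = g])
    fix p assume "p \<in> S3"
    then obtain \<xi> \<theta> \<phi> where p: "p = toroidal \<xi> \<theta> \<phi>" "\<xi> \<in> {0..pi/2}"
      using S3_toroidal[of p] by (auto simp: toroidal_box_def)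
    show "screw n p \<in> S3 \<and> g p \<in> S3 \<and> screw n (g p) = p \<and> g (screw n p) = p"
      unfolding p(1) by (simp only: screw_toroidal[OF p(2)] g[OF p(2)] toroidal_in_S3 flip: c_def) simp
  qed
  show "restrict flip S3 \<in> carrier (BijGroup S3)"
  proof (rule bij[where g = "\<lambda>p. flip (flip (flip p))"])
    fix p assume "p \<in> S3"
    then obtain \<xi> \<theta> \<phi> where p: "p = toroidal \<xi> \<theta> \<phi>" "\<xi> \<in> {0..pi/2}"
      using S3_toroidal[of p] by (auto simp: toroidal_box_def)
    have p': "pi/2 - \<xi> \<in> {0..pi/2}" using p(2) by auto
    have 2: "flip (flip p) = toroidal \<xi> (\<theta> - pi) (pi + \<phi>)"
      unfolding p(1) by (simp add: flip_toroidal[OF p(2)] flip_toroidal[OF p'])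
    have 3: "flip (flip (flip p)) = toroidal (pi/2 - \<xi>) (- (pi + \<phi>)) (pi - (\<theta> - pi))"
      unfolding 2 by (rule flip_toroidal[OF p(2)])
    have "flip (toroidal (pi/2 - \<xi>) (- (pi + \<phi>)) (pi - (\<theta> - pi))) = toroidal \<xi> \<theta> \<phi>"
      unfolding flip_toroidal[OF p']
      by (simp add: toroidal_eq_iff)
         (simp add: cos_diff sin_diff cos_add sin_add)
    then have "flip (flip (flip (flip p))) = p"
      using 3 p(1) by simp
    moreover have "flip p \<in> S3"
      unfolding p(1) flip_toroidal[OF p(2)] by (rule toroidal_in_S3)
    moreover have "flip (flip (flip p)) \<in> S3"
      unfolding 3 by (rule toroidal_in_S3)
    ultimately show "flip p \<in> S3 \<and> flip (flip (flip p)) \<in> S3 \<and>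
        flip (flip (flip (flip p))) = p \<and> flip (flip (flip (flip p))) = p"
      by blast
  qed
qed

end

theory Submission
  imports Defs
begin

text \<open>
  Each mode is the restriction of a homogeneous harmonic polynomial of degree \<open>k\<close>, hence an
  eigenfunction. In toroidal coordinates the divergence of a tangent field is, up to the density
  \<open>cos \<xi> sin \<xi>\<close>, a sum of three coordinate derivatives that are smooth on the whole coordinate
  box, so its integral vanishes; thus eigenfunctions for different eigenvalues are orthogonal. The
  modes of all wave numbers span the polynomials, which are dense by Stone--Weierstrass, so an
  eigenfunction orthogonal to all modes of its own wave number is 0.

  For an invariant eigenfunction, \<open>flip\<close> relates the coefficients at \<open>(l, m)\<close> and \<open>(m, l)\<close> by the
  sign \<open>\<sigma>\<close>, and \<open>screw\<close> rotates the pairs of coefficients belonging to the angles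
  \<open>l \<theta> - m \<phi>\<close> and \<open>l \<theta> + m \<phi>\<close> by \<open>(l - m) \<pi> / n\<close> and \<open>(l + m) \<pi> / n\<close>, so these vanish unless
  \<open>l \<equiv> m\<close> or \<open>l \<equiv> - m\<close> modulo \<open>2 n\<close>. What remains is exactly what the listed functions detect.
\<close>

section \<open>Harmonic polynomials on \<open>\<real>\<^sup>4\<close>\<close>

text \<open>No dimension count of the eigenspace enters: the projection onto the list is subtracted
  from an invariant eigenfunction, and all mode coefficients of the remainder are shown to be 0.
  Coefficients are compared by changing variables in the integral, so invariance of the integral
  under the two generators is the key fact. Two obstacles shape the rest. A derivative within
  \<open>S3\<close> is determined only on tangent vectors, so gradient and Hessian are normalised
  and then computed from local extensions to \<open>\<real>^4\<close>. Toroidal coordinates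
  degenerate at \<open>\<xi> = 0\<close> and \<open>\<xi> = pi/2\<close>, where one of the
  coordinate circles shrinks to a point; the frame is therefore kept at unit length and the
  vanishing lengths go into the density. The normalising constant is the norm of a Jacobi
  polynomial. It is found from moments against powers of \<open>sin^2\<close>, which reduce to Beta
  integrals and finite differences of binomial coefficients.\<close>

lemma trace_matrix: "trace (matrix D) = (\<Sum>i\<in>UNIV. D (axis i 1) $ i)"
  for D :: "real^'n \<Rightarrow> real^'n"
  by (simp add: trace_def matrix_def)

lemma sum_inner_axis: "(\<Sum>i\<in>UNIV. (a \<bullet> axis i 1) * b $ i) = a \<bullet> b" for a b :: "real^'n"
  by (simp add: inner_axis) (simp add: inner_vec_def)

text \<open>The first derivatives stay explicit because the Laplacian of a product contains
  \<open>2 * (G p \<bullet> G' p)\<close>; of the second derivative only the trace matters, so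
  \<open>D\<close> is quantified away. Laplacians of polynomials then follow by composing sum and
  product rules.\<close>

definition has_grad_lap ::
    "(real^'n \<Rightarrow> real) \<Rightarrow> (real^'n \<Rightarrow> real^'n) \<Rightarrow> (real^'n \<Rightarrow> real) \<Rightarrow> bool" where
  "has_grad_lap F G L \<longleftrightarrow>
     (\<exists>D. \<forall>p. (F has_derivative (\<lambda>h. G p \<bullet> h)) (at p) \<and> (G has_derivative D p) (at p) \<and>
              trace (matrix (D p)) = L p)"

lemma has_grad_lap_const: "has_grad_lap (\<lambda>_. c) (\<lambda>_. 0) (\<lambda>_. 0)"
proof -
  have "(\<bullet>) 0 = (\<lambda>_::real^'a. 0 :: real)"
    by (simp add: fun_eq_iff)
  then show ?thesis
    unfolding has_grad_lap_def by (intro exI[of _ "\<lambda>_ _. 0"]) (simp add: trace_matrix)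
qed

lemma has_grad_lap_nth: "has_grad_lap (\<lambda>p. p $ i) (\<lambda>_. axis i 1) (\<lambda>_. 0)"
proof -
  have "(\<bullet>) (axis i 1) = (\<lambda>h::real^'a. h $ i)"
    by (simp add: fun_eq_iff inner_axis')
  then show ?thesis
    unfolding has_grad_lap_def
    by (intro exI[of _ "\<lambda>_ _. 0"])
       (auto simp: trace_matrix intro!: bounded_linear_imp_has_derivative bounded_linear_vec_nth)
qed

lemma has_grad_lap_add:
  assumes "has_grad_lap F G L" "has_grad_lap F' G' L'"
  shows "has_grad_lap (\<lambda>p. F p + F' p) (\<lambda>p. G p + G' p) (\<lambda>p. L p + L' p)"
proof -
  from assms obtain D D' where
    D: "\<And>p. (F has_derivative (\<lambda>h. G p \<bullet> h)) (at p)" "\<And>p. (G has_derivative D p) (at p)"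
       "\<And>p. trace (matrix (D p)) = L p" and
    D': "\<And>p. (F' has_derivative (\<lambda>h. G' p \<bullet> h)) (at p)" "\<And>p. (G' has_derivative D' p) (at p)"
       "\<And>p. trace (matrix (D' p)) = L' p"
    unfolding has_grad_lap_def by metis
  show ?thesis
    unfolding has_grad_lap_def
  proof (intro exI[of _ "\<lambda>p h. D p h + D' p h"] allI conjI)
    fix p
    show "((\<lambda>p. F p + F' p) has_derivative (\<lambda>h. (G p + G' p) \<bullet> h)) (at p)"
      unfolding inner_add_left by (intro has_derivative_add D D')
    show "((\<lambda>p. G p + G' p) has_derivative (\<lambda>h. D p h + D' p h)) (at p)"
      by (intro has_derivative_add D D')
    show "trace (matrix (\<lambda>h. D p h + D' p h)) = L p + L' p"
      using D(3)[of p] D'(3)[of p] by (simp add: trace_matrix sum.distrib)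
  qed
qed

text \<open>The mixed terms of the second derivative are the rank-one map
  \<open>h \<mapsto> (G p \<bullet> h) *\<^sub>R G' p\<close> and its mirror image, each of trace
  \<open>G p \<bullet> G' p\<close>.\<close>

lemma has_grad_lap_mult:
  assumes "has_grad_lap F G L" "has_grad_lap F' G' L'"
  shows "has_grad_lap (\<lambda>p. F p * F' p) (\<lambda>p. F p *\<^sub>R G' p + F' p *\<^sub>R G p)
           (\<lambda>p. F p * L' p + F' p * L p + 2 * (G p \<bullet> G' p))"
proof -
  from assms obtain D D' where
    D: "\<And>p. (F has_derivative (\<lambda>h. G p \<bullet> h)) (at p)" "\<And>p. (G has_derivative D p) (at p)"
       "\<And>p. trace (matrix (D p)) = L p" and
    D': "\<And>p. (F' has_derivative (\<lambda>h. G' p \<bullet> h)) (at p)" "\<And>p. (G' has_derivative D' p) (at p)"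
       "\<And>p. trace (matrix (D' p)) = L' p"
    unfolding has_grad_lap_def by metis
  show ?thesis
    unfolding has_grad_lap_def
  proof (intro exI[of _ "\<lambda>p h. (F p *\<^sub>R D' p h + (G p \<bullet> h) *\<^sub>R G' p)
      + (F' p *\<^sub>R D p h + (G' p \<bullet> h) *\<^sub>R G p)"] allI conjI)
    fix p
    show "((\<lambda>p. F p * F' p) has_derivative (\<lambda>h. (F p *\<^sub>R G' p + F' p *\<^sub>R G p) \<bullet> h)) (at p)"
      by (rule derivative_eq_intros D D' refl)+ (simp add: fun_eq_iff inner_add_left algebra_simps)
    show "((\<lambda>p. F p *\<^sub>R G' p + F' p *\<^sub>R G p) has_derivative
      (\<lambda>h. (F p *\<^sub>R D' p h + (G p \<bullet> h) *\<^sub>R G' p) + (F' p *\<^sub>R D p h + (G' p \<bullet> h) *\<^sub>R G p))) (at p)"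
      by (intro has_derivative_add has_derivative_scaleR D D')
    have "trace (matrix (\<lambda>h. (F p *\<^sub>R D' p h + (G p \<bullet> h) *\<^sub>R G' p) + (F' p *\<^sub>R D p h + (G' p \<bullet> h) *\<^sub>R G p)))
        = F p * trace (matrix (D' p)) + (\<Sum>i\<in>UNIV. (G p \<bullet> axis i 1) * G' p $ i)
        + (F' p * trace (matrix (D p)) + (\<Sum>i\<in>UNIV. (G' p \<bullet> axis i 1) * G p $ i))"
      by (simp add: trace_matrix sum.distrib sum_distrib_left)
    then show "trace (matrix (\<lambda>h. (F p *\<^sub>R D' p h + (G p \<bullet> h) *\<^sub>R G' p) + (F' p *\<^sub>R D p h + (G' p \<bullet> h) *\<^sub>R G p)))
        = F p * L' p + F' p * L p + 2 * (G p \<bullet> G' p)"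
      unfolding sum_inner_axis D(3) D'(3) by (simp add: inner_commute)
  qed
qed

lemma has_grad_lap_eq:
  assumes "has_grad_lap F G L" "\<And>p. F' p = F p" "\<And>p. G' p = G p" "\<And>p. L' p = L p"
  shows "has_grad_lap F' G' L'"
proof -
  have "F' = F" "G' = G" "L' = L" using assms by auto
  with assms(1) show ?thesis by simp
qed

lemma has_grad_lap_cmult:
  assumes "has_grad_lap F G L"
  shows "has_grad_lap (\<lambda>p. c * F p) (\<lambda>p. c *\<^sub>R G p) (\<lambda>p. c * L p)"
  by (rule has_grad_lap_eq[OF has_grad_lap_mult[OF has_grad_lap_const[of c] assms]]) simp_all

lemma has_grad_lap_sum:
  assumes "finite I" "\<And>i. i \<in> I \<Longrightarrow> has_grad_lap (F i) (G i) (L i)"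
  shows "has_grad_lap (\<lambda>p. \<Sum>i\<in>I. F i p) (\<lambda>p. \<Sum>i\<in>I. G i p) (\<lambda>p. \<Sum>i\<in>I. L i p)"
  using assms by (induction I rule: finite_induct) (simp_all add: has_grad_lap_const has_grad_lap_add)

text \<open>\<open>plane_power True\<close> is \<open>Re\<close> and \<open>plane_power False\<close> is \<open>Im\<close> of \<open>(p $ a + \<i> p $ b) ^ l\<close>.\<close>

fun plane_power :: "bool \<Rightarrow> 'n \<Rightarrow> 'n \<Rightarrow> nat \<Rightarrow> real^'n \<Rightarrow> real" where
  "plane_power s a b 0 p = (if s then 1 else 0)"
| "plane_power True a b (Suc l) p =
     p $ a * plane_power True a b l p - p $ b * plane_power False a b l p"
| "plane_power False a b (Suc l) p =
     p $ a * plane_power False a b l p + p $ b * plane_power True a b l p"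

lemma plane_power_polar:
  assumes "p $ a = r * cos t" "p $ b = r * sin t"
  shows "plane_power s a b l p = r ^ l * (if s then cos (real l * t) else sin (real l * t))"
proof (induction l arbitrary: s)
  case 0
  then show ?case by auto
next
  case (Suc l)
  have "real (Suc l) * t = t + real l * t" by (simp add: algebra_simps)
  then show ?case
    by (cases s) (simp_all only: plane_power.simps Suc assms cos_add sin_add, simp_all add: algebra_simps)
qed

text \<open>Both cases come from \<open>d(z ^ l) = l z ^ (l - 1) dz\<close> with
  \<open>z = p $ a + \<i> p $ b\<close>: the partial derivative along \<open>b\<close> is
  \<open>\<i>\<close> times the one along \<open>a\<close>. For \<open>l = 0\<close> the factor
  \<open>l\<close> annihilates the term with the truncated exponent.\<close>

definition plane_power_grad :: "bool \<Rightarrow> 'n \<Rightarrow> 'n \<Rightarrow> nat \<Rightarrow> real^'n \<Rightarrow> real^'n" where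
  "plane_power_grad s a b l p =
    (if s then axis a (l * plane_power True a b (l - 1) p) - axis b (l * plane_power False a b (l - 1) p)
     else axis a (l * plane_power False a b (l - 1) p) + axis b (l * plane_power True a b (l - 1) p))"

text \<open>Real and imaginary parts of a holomorphic function are harmonic. Both go through one
  induction because \<open>z ^ Suc l = z * z ^ l\<close> mixes them; the cross terms of the product
  rule cancel by the Cauchy-Riemann equations.\<close>

lemma has_grad_lap_plane_power:
  assumes "a \<noteq> b"
  shows "has_grad_lap (plane_power s a b l) (plane_power_grad s a b l) (\<lambda>_. 0)"
proof (induction l arbitrary: s)
  case 0
  show ?case
    by (rule has_grad_lap_eq[OF has_grad_lap_const[of "if s then 1 else 0"]])
       (auto simp: plane_power_grad_def axis_def vec_eq_iff)
next
  case (Suc l)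
  have l: "l = 0 \<or> (\<exists>k. l = Suc k)" by (cases l) auto
  have neg: "has_grad_lap (\<lambda>p. - 1 * (p $ b * plane_power False a b l p))
     (\<lambda>p. - 1 *\<^sub>R (p $ b *\<^sub>R plane_power_grad False a b l p + plane_power False a b l p *\<^sub>R axis b 1))
     (\<lambda>p. - 1 * (p $ b * 0 + plane_power False a b l p * 0 + 2 * (axis b 1 \<bullet> plane_power_grad False a b l p)))"
    by (intro has_grad_lap_cmult has_grad_lap_mult has_grad_lap_nth Suc)
  note re = has_grad_lap_add[OF has_grad_lap_mult[OF has_grad_lap_nth[of a] Suc[of True]] neg]
  note im = has_grad_lap_add[OF has_grad_lap_mult[OF has_grad_lap_nth[of a] Suc[of False]]
      has_grad_lap_mult[OF has_grad_lap_nth[of b] Suc[of True]]]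
  have "has_grad_lap (plane_power True a b (Suc l)) (plane_power_grad True a b (Suc l)) (\<lambda>_. 0)"
  proof (rule has_grad_lap_eq[OF re], goal_cases)
    case (2 p)
    show ?case
      using l by (auto simp: plane_power_grad_def vec_eq_iff axis_def algebra_simps)
  next
    case (3 p)
    show ?case
      using assms by (simp add: plane_power_grad_def inner_simps inner_axis_axis)
  qed simp
  moreover have "has_grad_lap (plane_power False a b (Suc l)) (plane_power_grad False a b (Suc l)) (\<lambda>_. 0)"
  proof (rule has_grad_lap_eq[OF im], goal_cases)
    case (2 p)
    show ?case
      using l by (auto simp: plane_power_grad_def vec_eq_iff axis_def algebra_simps)
  next
    case (3 p)
    show ?case
      using assms by (simp add: plane_power_grad_def inner_simps inner_axis_axis)
  qed simp
  ultimately show ?case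
    by (cases s) (simp_all del: plane_power.simps)
qed

text \<open>Euler's identity for homogeneous functions of degree \<open>l\<close>; the vector on the
  right of the inner product is the projection of \<open>p\<close> to the plane.\<close>

lemma plane_power_grad_inner:
  assumes "a \<noteq> b"
  shows "plane_power_grad s a b l p \<bullet> (axis a (p $ a) + axis b (p $ b)) = l * plane_power s a b l p"
  using assms
  by (cases l; cases s) (auto simp: plane_power_grad_def inner_simps inner_axis_axis algebra_simps)

definition plane_sq :: "'n \<Rightarrow> 'n \<Rightarrow> real^'n \<Rightarrow> real" where
  "plane_sq a b p = (p $ a)\<^sup>2 + (p $ b)\<^sup>2"

lemma has_grad_lap_plane_sq:
  "has_grad_lap (plane_sq a b) (\<lambda>p. 2 *\<^sub>R (axis a (p $ a) + axis b (p $ b))) (\<lambda>_. 4)"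
proof (rule has_grad_lap_eq[OF has_grad_lap_add[OF
          has_grad_lap_mult[OF has_grad_lap_nth[of a] has_grad_lap_nth[of a]]
          has_grad_lap_mult[OF has_grad_lap_nth[of b] has_grad_lap_nth[of b]]]], goal_cases)
  case (2 p)
  show ?case by (simp add: vec_eq_iff axis_def)
qed (simp_all add: plane_sq_def power2_eq_square inner_axis_axis)

lemma inner_plane_axis:
  assumes "a \<noteq> b"
  shows "(axis a (p $ a) + axis b (p $ b)) \<bullet> (axis a (p $ a) + axis b (p $ b)) = plane_sq a b p"
  using assms by (simp add: inner_simps inner_axis_axis plane_sq_def power2_eq_square)

lemma has_grad_lap_plane_sq_power:
  assumes "a \<noteq> b"
  shows "has_grad_lap (\<lambda>p. plane_sq a b p ^ i)
           (\<lambda>p. (2 * real i * plane_sq a b p ^ (i - 1)) *\<^sub>R (axis a (p $ a) + axis b (p $ b)))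
           (\<lambda>p. 4 * (real i)\<^sup>2 * plane_sq a b p ^ (i - 1))"
proof (induction i)
  case 0
  show ?case by (rule has_grad_lap_eq[OF has_grad_lap_const[of 1]]) auto
next
  case (Suc i)
  have i: "i = 0 \<or> (\<exists>k. i = Suc k)" by (cases i) auto
  show ?case
  proof (rule has_grad_lap_eq[OF has_grad_lap_mult[OF has_grad_lap_plane_sq[of a b] Suc]], goal_cases)
    case (2 p)
    have "plane_sq a b p * (2 * real i * plane_sq a b p ^ (i - 1)) + plane_sq a b p ^ i * 2
        = 2 * real (Suc i) * plane_sq a b p ^ i"
      using i by (auto simp: algebra_simps)
    then show ?case
      by (simp only: scaleR_scaleR scaleR_add_left[symmetric] diff_Suc_1)
  next
    case (3 p)
    show ?case
      unfolding inner_scaleR_left inner_scaleR_right inner_plane_axis[OF assms]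
      using i by (auto simp: algebra_simps power2_eq_square)
  qed simp
qed

definition plane_term :: "bool \<Rightarrow> 'n \<Rightarrow> 'n \<Rightarrow> nat \<Rightarrow> nat \<Rightarrow> real^'n \<Rightarrow> real" where
  "plane_term s a b l i p = plane_power s a b l p * plane_sq a b p ^ i"

definition plane_term_grad :: "bool \<Rightarrow> 'n \<Rightarrow> 'n \<Rightarrow> nat \<Rightarrow> nat \<Rightarrow> real^'n \<Rightarrow> real^'n" where
  "plane_term_grad s a b l i p =
     plane_power s a b l p *\<^sub>R ((2 * real i * plane_sq a b p ^ (i - 1)) *\<^sub>R (axis a (p $ a) + axis b (p $ b)))
     + plane_sq a b p ^ i *\<^sub>R plane_power_grad s a b l p"

text \<open>The part \<open>4 i^2\<close> comes from the radial power, the part \<open>4 i l\<close>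
  from twice the inner product of the two gradients, evaluated by Euler's identity. The harmonic
  factor itself contributes nothing.\<close>

lemma has_grad_lap_plane_term:
  assumes "a \<noteq> b"
  shows "has_grad_lap (plane_term s a b l i) (plane_term_grad s a b l i)
           (\<lambda>p. 4 * real i * (real i + real l) * plane_term s a b l (i - 1) p)"
proof (rule has_grad_lap_eq[OF has_grad_lap_mult[OF has_grad_lap_plane_power[OF assms, of s l]
        has_grad_lap_plane_sq_power[OF assms, of i]]], goal_cases)
  case (3 p)
  show ?case
    unfolding inner_scaleR_right plane_power_grad_inner[OF assms]
    by (simp add: plane_term_def power2_eq_square algebra_simps)
qed (auto simp: plane_term_def plane_term_grad_def)

text \<open>The gradients lie in complementary coordinate planes, so the cross term in the Laplacian
  of a product over both planes vanishes.\<close>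

lemma plane_term_grad_orthogonal:
  assumes "a \<noteq> c" "a \<noteq> e" "b \<noteq> c" "b \<noteq> e"
  shows "plane_term_grad s a b l i p \<bullet> plane_term_grad s' c e m j p = 0"
  using assms by (simp add: plane_term_grad_def plane_power_grad_def inner_simps inner_axis_axis)

text \<open>The coefficient of \<open>(cos^2)^i (sin^2)^(d-i)\<close> in the Jacobi polynomial with
  parameters \<open>(m, l)\<close> at \<open>cos (2 * \<xi>)\<close>: there
  \<open>u + 1 = 2 cos^2\<close> and \<open>u - 1 = - 2 sin^2\<close>, and the powers of 2 cancel
  \<open>2 ^ d\<close>.\<close>

definition mode_coeff :: "nat \<Rightarrow> nat \<Rightarrow> nat \<Rightarrow> nat \<Rightarrow> real" where
  "mode_coeff l m d i = real ((m + d) choose i) * real ((l + d) choose (d - i)) * (- 1) ^ (d - i)"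

text \<open>The unnormalised mode with \<open>cos^2\<close> and \<open>sin^2\<close> replaced by the
  squared radii of the two planes, which makes every term homogeneous of degree
  \<open>l + m + 2 * d\<close>.\<close>

definition mode_poly :: "bool \<Rightarrow> bool \<Rightarrow> nat \<Rightarrow> nat \<Rightarrow> nat \<Rightarrow> real^4 \<Rightarrow> real" where
  "mode_poly s s' l m d p =
     (\<Sum>i\<le>d. mode_coeff l m d i * (plane_term s 1 2 l i p * plane_term s' 3 4 m (d - i) p))"

text \<open>This recurrence is what cancels neighbouring terms in the Laplacian of
  \<open>mode_poly\<close>. It is the absorption identity for each of the two binomial coefficients;
  the sign comes from \<open>(- 1) ^ (d - i)\<close>.\<close>

lemma mode_coeff_Suc:
  assumes "i < d"
  shows "mode_coeff l m d (Suc i) * (real (Suc i) * (real (Suc i) + real l)) =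
         - (mode_coeff l m d i * (real (d - i) * (real (d - i) + real m)))"
proof -
  obtain j where d: "d = Suc (i + j)" using assms less_iff_Suc_add by auto
  have 1: "real ((m + d) choose Suc i) * real (Suc i) = real ((m + d) choose i) * (real m + real (Suc j))"
    using binomial_absorb_comp[of "m + d" i] binomial_absorption[of i "m + d"]
    by (simp add: d flip: of_nat_mult of_nat_add of_nat_Suc) (simp add: mult.commute)
  have 2: "real ((l + d) choose Suc j) * real (Suc j) = real ((l + d) choose j) * (real l + real (Suc i))"
    using binomial_absorb_comp[of "l + d" j] binomial_absorption[of j "l + d"]
    by (simp add: d flip: of_nat_mult of_nat_add of_nat_Suc) (simp add: mult.commute add.commute add.left_commute)
  have e: "d - i = Suc j" "d - Suc i = j" by (auto simp: d)
  have "mode_coeff l m d (Suc i) * (real (Suc i) * (real (Suc i) + real l))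
      = (real ((m + d) choose Suc i) * real (Suc i)) * (real ((l + d) choose j) * (real l + real (Suc i))) * (- 1) ^ j"
    unfolding mode_coeff_def e by (simp only: ac_simps)
  also have "\<dots> = - (mode_coeff l m d i * (real (d - i) * (real (d - i) + real m)))"
    unfolding 1 2[symmetric] mode_coeff_def e by (simp add: ac_simps)
  finally show ?thesis .
qed

lemma harmonic_mode_poly: "\<exists>G. has_grad_lap (mode_poly s s' l m d) G (\<lambda>_. 0)"
proof -
  let ?T = "plane_term s 1 2 l :: nat \<Rightarrow> real^4 \<Rightarrow> real" and ?S = "plane_term s' 3 4 m"
  have ne: "(1::4) \<noteq> 2" "(3::4) \<noteq> 4" "(1::4) \<noteq> 3" "(2::4) \<noteq> 3" "(1::4) \<noteq> 4" "(2::4) \<noteq> 4"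
    by simp_all
  have orth: "plane_term_grad s 1 2 l i p \<bullet> plane_term_grad s' 3 4 m j p = 0" for i j and p :: "real^4"
    by (rule plane_term_grad_orthogonal) (use ne in auto)
  have each: "has_grad_lap (\<lambda>p. mode_coeff l m d i * (?T i p * ?S (d - i) p))
      (\<lambda>p. mode_coeff l m d i *\<^sub>R (?T i p *\<^sub>R plane_term_grad s' 3 4 m (d - i) p
        + ?S (d - i) p *\<^sub>R plane_term_grad s 1 2 l i p))
      (\<lambda>p. mode_coeff l m d i * (?T i p * (4 * real (d - i) * (real (d - i) + real m) * ?S (d - Suc i) p))
        + mode_coeff l m d i * (?S (d - i) p * (4 * real i * (real i + real l) * ?T (i - 1) p)))" for i
    by (rule has_grad_lap_eq[OF has_grad_lap_cmult[where c = "mode_coeff l m d i", OF has_grad_lap_mult[OF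
            has_grad_lap_plane_term[OF ne(1), of s l i] has_grad_lap_plane_term[OF ne(2), of s' m "d - i"]]]])
       (simp_all add: orth distrib_left ac_simps)
  have sum: "(\<Sum>i\<le>d. mode_coeff l m d i * (?T i p * (4 * real (d - i) * (real (d - i) + real m) * ?S (d - Suc i) p))
        + mode_coeff l m d i * (?S (d - i) p * (4 * real i * (real i + real l) * ?T (i - 1) p))) = 0"
    (is "(\<Sum>i\<le>d. ?A i + ?B i) = 0") for p
  proof -
    \<comment> \<open>\<open>?A i\<close> lowers the power in the second plane, \<open>?B i\<close>
      that in the first. The end terms \<open>?A d\<close> and \<open>?B 0\<close> carry a factor 0;
      after an index shift \<open>?A i\<close> and \<open>?B (Suc i)\<close> belong to the same
      product and cancel.\<close>
    have "(\<Sum>i\<le>d. ?A i) = (\<Sum>i<d. ?A i)"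
      by (simp add: lessThan_Suc_atMost[symmetric])
    moreover have "(\<Sum>i\<le>d. ?B i) = (\<Sum>i<d. ?B (Suc i))"
      by (simp add: sum.atMost_shift)
    moreover have "?B (Suc i) = - ?A i" if "i < d" for i
    proof -
      have "?B (Suc i) = 4 * (mode_coeff l m d (Suc i) * (real (Suc i) * (real (Suc i) + real l)))
          * (?S (d - Suc i) p * ?T i p)"
        by (simp only: ac_simps diff_Suc_1)
      then show ?thesis
        unfolding mode_coeff_Suc[OF that] by (simp add: ac_simps)
    qed
    ultimately show ?thesis
      by (simp add: sum.distrib sum_negf)
  qed
  have "has_grad_lap (\<lambda>p. \<Sum>i\<le>d. mode_coeff l m d i * (?T i p * ?S (d - i) p))
      (\<lambda>p. \<Sum>i\<le>d. mode_coeff l m d i *\<^sub>R (?T i p *\<^sub>R plane_term_grad s' 3 4 m (d - i) p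
        + ?S (d - i) p *\<^sub>R plane_term_grad s 1 2 l i p))
      (\<lambda>p. \<Sum>i\<le>d. mode_coeff l m d i * (?T i p * (4 * real (d - i) * (real (d - i) + real m) * ?S (d - Suc i) p))
        + mode_coeff l m d i * (?S (d - i) p * (4 * real i * (real i + real l) * ?T (i - 1) p)))"
    by (rule has_grad_lap_sum[OF finite_atMost each])
  then show ?thesis
    unfolding sum mode_poly_def[abs_def] by blast
qed

lemma plane_power_scaleR: "plane_power s a b l (t *\<^sub>R p) = t ^ l * plane_power s a b l p"
  by (induction s a b l p rule: plane_power.induct) (auto simp: algebra_simps)

lemma mode_poly_scaleR: "mode_poly s s' l m d (t *\<^sub>R p) = t ^ (l + m + 2 * d) * mode_poly s s' l m d p"
proof -
  have "plane_sq a b (t *\<^sub>R p) ^ i = t ^ (2 * i) * plane_sq a b p ^ i" for a b i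
  proof -
    have "plane_sq a b (t *\<^sub>R p) = t ^ 2 * plane_sq a b p"
      by (simp add: plane_sq_def power_mult_distrib algebra_simps)
    then show ?thesis by (simp add: power_mult_distrib power_mult)
  qed
  then have T: "plane_term s a b l i (t *\<^sub>R p) = t ^ (l + 2 * i) * plane_term s a b l i p" for s a b l i
    by (simp add: plane_term_def plane_power_scaleR power_add)
  have "mode_coeff l m d i * (plane_term s 1 2 l i (t *\<^sub>R p) * plane_term s' 3 4 m (d - i) (t *\<^sub>R p))
      = t ^ (l + m + 2 * d) * (mode_coeff l m d i * (plane_term s 1 2 l i p * plane_term s' 3 4 m (d - i) p))"
    if "i \<le> d" for i
  proof -
    have "l + m + 2 * d = (l + 2 * i) + (m + 2 * (d - i))" using that by simp
    then show ?thesis unfolding T by (simp only: power_add) (simp only: ac_simps)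
  qed
  then show ?thesis
    unfolding mode_poly_def sum_distrib_left by (intro sum.cong) auto
qed

lemma real_polynomial_function_nth: "real_polynomial_function (\<lambda>p::real^'n. p $ i)"
  by (simp add: real_polynomial_function.intros(1) bounded_linear_vec_nth)

lemma real_polynomial_plane_power: "real_polynomial_function (plane_power s a b l)"
proof (induction l arbitrary: s)
  case 0
  show ?case by (simp add: real_polynomial_function.intros(2))
next
  case (Suc l)
  have "plane_power True a b (Suc l) =
      (\<lambda>p. p $ a * plane_power True a b l p - p $ b * plane_power False a b l p)"
    "plane_power False a b (Suc l) =
      (\<lambda>p. p $ a * plane_power False a b l p + p $ b * plane_power True a b l p)"
    by auto
  moreover have "real_polynomial_function \<dots>"
    by (intro real_polynomial_function.intros(3,4) real_polynomial_function_nth Suc)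
  moreover have "real_polynomial_function
      (\<lambda>p. p $ a * plane_power True a b l p - p $ b * plane_power False a b l p)"
    by (intro real_polynomial_function_diff real_polynomial_function.intros(4) real_polynomial_function_nth Suc)
  ultimately show ?case by (cases s) (simp_all del: plane_power.simps)
qed

lemma real_polynomial_mode_poly: "real_polynomial_function (mode_poly s s' l m d)"
  unfolding mode_poly_def[abs_def] plane_term_def plane_sq_def
  by (intro real_polynomial_function_sum real_polynomial_function.intros(2-4) real_polynomial_function_nth
      real_polynomial_plane_power real_polynomial_function_power finite_atMost)


section \<open>Calculus on the 3-sphere\<close>

text \<open>Tangent vectors are multiples of velocities of great circles, and along a curve inside
  the sphere the derivative is unique. The normal direction is out of reach of such curves.\<close>

lemma sphere_derivative_unique:
  fixes f :: "'a::real_inner \<Rightarrow> 'b::real_normed_vector"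
  assumes A: "(f has_derivative A) (at p within sphere 0 1)"
    and B: "(f has_derivative B) (at p within sphere 0 1)"
    and p: "p \<in> sphere 0 1" and v: "v \<bullet> p = 0"
  shows "A v = B v"
proof (cases "v = 0")
  case True
  then show ?thesis
    using A B by (simp add: linear_0 has_derivative_linear)
next
  case False
  define e where "e = v /\<^sub>R norm v"
  have pp: "p \<bullet> p = 1" using p by (simp add: norm_eq_1)
  have e: "e \<bullet> e = 1" "e \<bullet> p = 0" "p \<bullet> e = 0" "v = norm v *\<^sub>R e"
    using v False by (simp_all add: e_def inner_commute dot_square_norm power2_eq_square)
  define \<gamma> where "\<gamma> t = cos t *\<^sub>R p + sin t *\<^sub>R e" for t :: real
  have d: "(\<gamma> has_derivative (\<lambda>h. h *\<^sub>R e)) (at 0)"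
    unfolding \<gamma>_def by (auto intro!: derivative_eq_intros)
  have \<gamma>: "\<gamma> ` UNIV \<subseteq> sphere 0 1"
  proof -
    have "\<gamma> t \<bullet> \<gamma> t = 1" for t
      by (simp add: \<gamma>_def inner_simps pp e power2_eq_square[symmetric])
    then show ?thesis by (auto simp: norm_eq_1)
  qed
  have chain: "(f \<circ> \<gamma> has_derivative L \<circ> (\<lambda>h. h *\<^sub>R e)) (at 0)"
    if "(f has_derivative L) (at p within sphere 0 1)" for L
  proof (rule diff_chain_within[OF d])
    show "(f has_derivative L) (at (\<gamma> 0) within range \<gamma>)"
      using has_derivative_subset[OF that \<gamma>] by (simp add: \<gamma>_def)
  qed
  have "A \<circ> (\<lambda>h. h *\<^sub>R e) = B \<circ> (\<lambda>h. h *\<^sub>R e)"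
    using has_derivative_unique[OF chain[OF A] chain[OF B]] .
  then have "A (norm v *\<^sub>R e) = B (norm v *\<^sub>R e)" by (simp add: fun_eq_iff)
  then show ?thesis using e(4) by simp
qed

lemma sphere_derivative_cong:
  fixes f :: "'a::real_inner \<Rightarrow> 'b::real_normed_vector"
  assumes A: "(f has_derivative A) (at p within sphere 0 1)" and p: "p \<in> sphere 0 1"
    and B: "linear B" and AB: "\<And>h. h \<bullet> p = 0 \<Longrightarrow> B h = A h"
  shows "(f has_derivative B) (at p within sphere 0 1)"
proof -
  \<comment> \<open>On the sphere \<open>q \<bullet> p - 1 = - \<bar>q - p\<bar>\<^sup>2 / 2\<close> is of second order, so normal components are free.\<close>
  define c where "c = B p - A p"
  have pp: "p \<bullet> p = 1" using p by (simp add: norm_eq_1)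
  have linA: "linear A" using A by (rule has_derivative_linear)
  have B_eq: "B h = A h + (h \<bullet> p) *\<^sub>R c" for h
  proof -
    have h: "h = (h - (h \<bullet> p) *\<^sub>R p) + (h \<bullet> p) *\<^sub>R p" by simp
    have "B h = B (h - (h \<bullet> p) *\<^sub>R p) + (h \<bullet> p) *\<^sub>R B p"
      by (subst h) (simp only: linear_add[OF B] linear_scale[OF B])
    also have "B (h - (h \<bullet> p) *\<^sub>R p) = A h - (h \<bullet> p) *\<^sub>R A p"
      by (simp add: AB inner_diff_left pp linear_diff[OF linA] linear_scale[OF linA])
    finally show ?thesis by (simp add: c_def algebra_simps)
  qed
  have "((\<lambda>q. q \<bullet> p - 1 + (q - p) \<bullet> (q - p) / 2) has_derivative (\<lambda>h. h \<bullet> p)) (at p within sphere 0 1)"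
    by (auto intro!: derivative_eq_intros)
  then have "((\<lambda>q. f q + (q \<bullet> p - 1 + (q - p) \<bullet> (q - p) / 2) *\<^sub>R c) has_derivative
      (\<lambda>h. A h + (h \<bullet> p) *\<^sub>R c)) (at p within sphere 0 1)"
    by (intro has_derivative_add A has_derivative_scaleR_left)
  then have "((\<lambda>q. f q + (q \<bullet> p - 1 + (q - p) \<bullet> (q - p) / 2) *\<^sub>R c) has_derivative B) (at p within sphere 0 1)"
    by (simp only: B_eq[symmetric])
  then show ?thesis
  proof (rule has_derivative_transform[OF p, rotated])
    fix q :: 'a assume "q \<in> sphere 0 1"
    then have "q \<bullet> q = 1" by (simp add: norm_eq_1)
    then have "(q - p) \<bullet> (q - p) = 2 - 2 * (q \<bullet> p)"
      using pp by (simp add: inner_simps inner_commute)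
    then show "f q = f q + (q \<bullet> p - 1 + (q - p) \<bullet> (q - p) / 2) *\<^sub>R c"
      by (simp add: diff_divide_distrib)
  qed
qed

lemma linear_axis_expansion:
  fixes h :: "real^'n"
  assumes "linear f"
  shows "f h = (\<Sum>i\<in>UNIV. h $ i *\<^sub>R f (axis i 1))"
proof -
  have "f (\<Sum>i\<in>UNIV. h $ i *\<^sub>R axis i 1) = (\<Sum>i\<in>UNIV. h $ i *\<^sub>R f (axis i 1))"
    by (simp add: linear_sum[OF assms] linear_scale[OF assms])
  then show ?thesis
    using basis_expansion[of h] by (simp add: scalar_mult_eq_scaleR)
qed

definition tangential :: "(real^4 \<Rightarrow> real^4) \<Rightarrow> real^4 \<Rightarrow> real^4" where
  "tangential G p = G p - (G p \<bullet> p) *\<^sub>R p"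

text \<open>The differential of \<open>tangential G\<close>, preceded by the projection
  \<open>k\<close> of \<open>h\<close> to the tangent space. The projection makes it vanish on the
  normal, which is the normalisation in the definition of the divergence.\<close>

definition sphere_hessian ::
    "(real^4 \<Rightarrow> real^4) \<Rightarrow> (real^4 \<Rightarrow> real^4 \<Rightarrow> real^4) \<Rightarrow> real^4 \<Rightarrow> real^4 \<Rightarrow> real^4" where
  "sphere_hessian G D p h =
     (let k = h - (h \<bullet> p) *\<^sub>R p in D p k - (D p k \<bullet> p + G p \<bullet> k) *\<^sub>R p - (G p \<bullet> p) *\<^sub>R k)"

definition hessian_S3 :: "(real^4 \<Rightarrow> real) \<Rightarrow> real^4 \<Rightarrow> real^4 \<Rightarrow> real^4" where
  "hessian_S3 f p = (THE D. (grad_S3 f has_derivative D) (at p within S3) \<and> D p = 0)"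

lemma laplacian_eq_trace: "laplacian_S3 f p = trace (matrix (hessian_S3 f p))"
  by (simp add: laplacian_S3_def div_S3_def hessian_S3_def)

lemma grad_S3_eqI:
  assumes p: "p \<in> S3" and f: "(f has_derivative (\<lambda>h. v \<bullet> h)) (at p within S3)" and v: "v \<bullet> p = 0"
  shows "grad_S3 f p = v"
  unfolding grad_S3_def
proof (rule the_equality)
  fix w assume w: "w \<bullet> p = 0 \<and> (f has_derivative (\<lambda>h. w \<bullet> h)) (at p within S3)"
  then have "(w - v) \<bullet> p = 0" by (simp add: inner_diff_left v)
  \<comment> \<open>The difference of two candidates is itself tangent and can be tested against
    itself.\<close>
  from sphere_derivative_unique[OF conjunct2[OF w] f p this] have "(w - v) \<bullet> (w - v) = 0"
    by (simp add: inner_simps)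
  then show "w = v" by simp
qed (use f v in simp)

text \<open>Uniqueness on the tangent space, together with the prescribed value 0 on the normal,
  fixes the whole linear map.\<close>

lemma hessian_S3_eqI:
  assumes p: "p \<in> S3" and D: "(grad_S3 f has_derivative D) (at p within S3)" "D p = 0"
  shows "hessian_S3 f p = D"
  unfolding hessian_S3_def
proof (rule the_equality)
  fix E assume E: "(grad_S3 f has_derivative E) (at p within S3) \<and> E p = 0"
  have lin: "linear D" "linear E" using D(1) E by (auto intro: has_derivative_linear)
  have pp: "p \<bullet> p = 1" using p by (simp add: norm_eq_1)
  show "E = D"
  proof
    fix h
    have h: "h = (h - (h \<bullet> p) *\<^sub>R p) + (h \<bullet> p) *\<^sub>R p" by simp
    have "E (h - (h \<bullet> p) *\<^sub>R p) = D (h - (h \<bullet> p) *\<^sub>R p)"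
      by (rule sphere_derivative_unique[OF conjunct1[OF E] D(1) p]) (simp add: inner_diff_left pp)
    then show "E h = D h"
      using D(2) E by (simp add: linear_diff[OF lin(1)] linear_diff[OF lin(2)]
          linear_scale[OF lin(1)] linear_scale[OF lin(2)])
  qed
qed (use D in simp)

lemma linear_sphere_hessian:
  assumes "linear (D p)"
  shows "linear (sphere_hessian G D p)"
proof -
  have k: "linear (\<lambda>h. h - (h \<bullet> p) *\<^sub>R p)"
    by (rule linearI) (auto simp: algebra_simps inner_simps)
  have "linear (\<lambda>k. D p k - (D p k \<bullet> p + G p \<bullet> k) *\<^sub>R p - (G p \<bullet> p) *\<^sub>R k)"
    by (rule linearI) (simp_all add: linear_add[OF assms] linear_scale[OF assms] algebra_simps inner_simps)
  from linear_compose[OF k this] show ?thesis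
    by (simp add: sphere_hessian_def[abs_def] Let_def o_def)
qed

section \<open>Gradient, Hessian and Laplacian of the sphere from a local extension\<close>

context
  fixes U :: "(real^4) set" and F f :: "real^4 \<Rightarrow> real" and G and D
  assumes U: "open U"
    and F: "\<And>q. q \<in> U \<Longrightarrow> (F has_derivative (\<lambda>h. G q \<bullet> h)) (at q)"
    and G: "\<And>q. q \<in> U \<Longrightarrow> (G has_derivative D q) (at q)"
    and eq: "\<And>q. q \<in> U \<inter> S3 \<Longrightarrow> F q = f q"
begin

lemma tangential_local:
  assumes p: "p \<in> U \<inter> S3"
  shows "tangential G p \<bullet> p = 0" "(f has_derivative (\<lambda>h. tangential G p \<bullet> h)) (at p within S3)"
    "grad_S3 f p = tangential G p"
proof -
  obtain e where e: "e > 0" "ball p e \<subseteq> U" using U p open_contains_ball by blast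
  show t: "tangential G p \<bullet> p = 0"
    using p by (simp add: tangential_def inner_simps norm_eq_1)
  have "(f has_derivative (\<lambda>h. G p \<bullet> h)) (at p within S3)"
  proof (rule has_derivative_transform_within[OF has_derivative_at_withinI[OF F] e(1)])
    show "F q = f q" if "q \<in> S3" "dist q p < e" for q
      using e that by (intro eq) (auto simp: dist_commute)
  qed (use p in auto)
  then show f: "(f has_derivative (\<lambda>h. tangential G p \<bullet> h)) (at p within S3)"
  proof (rule sphere_derivative_cong)
    show "linear (\<lambda>h. tangential G p \<bullet> h)" by (simp add: bounded_linear.linear bounded_linear_inner_right)
    show "tangential G p \<bullet> h = G p \<bullet> h" if "h \<bullet> p = 0" for h
      using that by (simp add: tangential_def inner_simps inner_commute)
  qed (use p in auto)
  show "grad_S3 f p = tangential G p"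
    using p by (intro grad_S3_eqI f t) auto
qed

lemma hessian_local:
  assumes p: "p \<in> U \<inter> S3"
  shows "(grad_S3 f has_derivative sphere_hessian G D p) (at p within S3)"
    "sphere_hessian G D p p = 0" "hessian_S3 f p = sphere_hessian G D p"
proof -
  obtain e where e: "e > 0" "ball p e \<subseteq> U" using U p open_contains_ball by blast
  have linD: "linear (D p)" using G p has_derivative_linear by blast
  have "((\<lambda>q. G q - (G q \<bullet> q) *\<^sub>R q) has_derivative
      (\<lambda>k. D p k - ((G p \<bullet> p) *\<^sub>R k + (G p \<bullet> k + D p k \<bullet> p) *\<^sub>R p))) (at p)"
    using p by (intro has_derivative_diff has_derivative_scaleR has_derivative_inner G has_derivative_ident) auto
  also have "(\<lambda>k. D p k - ((G p \<bullet> p) *\<^sub>R k + (G p \<bullet> k + D p k \<bullet> p) *\<^sub>R p))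
      = (\<lambda>k. D p k - (D p k \<bullet> p + G p \<bullet> k) *\<^sub>R p - (G p \<bullet> p) *\<^sub>R k)"
    by (simp add: fun_eq_iff algebra_simps)
  finally have "(tangential G has_derivative
      (\<lambda>k. D p k - (D p k \<bullet> p + G p \<bullet> k) *\<^sub>R p - (G p \<bullet> p) *\<^sub>R k)) (at p within S3)"
    unfolding tangential_def[abs_def] by (rule has_derivative_at_withinI)
  then have "(grad_S3 f has_derivative
      (\<lambda>k. D p k - (D p k \<bullet> p + G p \<bullet> k) *\<^sub>R p - (G p \<bullet> p) *\<^sub>R k)) (at p within S3)"
  proof (rule has_derivative_transform_within[OF _ e(1)])
    show "tangential G q = grad_S3 f q" if "q \<in> S3" "dist q p < e" for q
      using e that by (subst tangential_local(3)) (auto simp: dist_commute)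
  qed (use p in auto)
  then show 1: "(grad_S3 f has_derivative sphere_hessian G D p) (at p within S3)"
  proof (rule sphere_derivative_cong)
    show "linear (sphere_hessian G D p)" using linD by (rule linear_sphere_hessian)
  qed (use p in \<open>auto simp: sphere_hessian_def\<close>)
  have "p \<bullet> p = 1" using p by (simp add: norm_eq_1)
  then show 2: "sphere_hessian G D p p = 0"
    by (simp add: sphere_hessian_def linear_0[OF linD])
  show "hessian_S3 f p = sphere_hessian G D p"
    using p by (intro hessian_S3_eqI 1 2) auto
qed

text \<open>For an extension \<open>F\<close> this is \<open>\<Delta> F - F_rr - 3 F_r\<close> at
  radius 1. The 3 is the dimension of the sphere: \<open>G p \<bullet> p\<close> multiplies the
  tangential projection, whose trace is 3.\<close>

lemma laplacian_local:
  assumes p: "p \<in> U \<inter> S3"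
  shows "laplacian_S3 f p = trace (matrix (D p)) - D p p \<bullet> p - 3 * (G p \<bullet> p)"
proof -
  have linD: "linear (D p)" using G p has_derivative_linear by blast
  have pp: "p \<bullet> p = 1" using p by (simp add: norm_eq_1)
  \<comment> \<open>\<open>\<phi>\<close> collects the coefficient of the normal correction in
    \<open>sphere_hessian\<close>. The trace of \<open>h \<mapsto> \<phi> h *\<^sub>R p\<close> is
    \<open>\<phi> p\<close>, which is 0 because the tangential part of \<open>p\<close> is
    0.\<close>
  define \<phi> where "\<phi> h = (let k = h - (h \<bullet> p) *\<^sub>R p in D p k \<bullet> p + G p \<bullet> k)" for h
  have D_k: "D p (h - (h \<bullet> p) *\<^sub>R p) = D p h - (h \<bullet> p) *\<^sub>R D p p" for h
    by (simp add: linear_diff[OF linD] linear_scale[OF linD])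
  have "\<phi> h = D p h \<bullet> p - (h \<bullet> p) * (D p p \<bullet> p) + (G p \<bullet> h - (h \<bullet> p) * (G p \<bullet> p))" for h
    unfolding \<phi>_def Let_def D_k by (simp add: inner_simps)
  then have \<phi>_eq: "\<phi> = (\<lambda>h. D p h \<bullet> p - (h \<bullet> p) * (D p p \<bullet> p) + (G p \<bullet> h - (h \<bullet> p) * (G p \<bullet> p)))" ..
  have lin: "linear \<phi>"
    unfolding \<phi>_eq by (intro linearI) (simp_all add: linear_add[OF linD] linear_scale[OF linD] algebra_simps inner_simps)
  have "(\<Sum>i\<in>UNIV. \<phi> (axis i 1) * p $ i) = \<phi> p"
    using linear_axis_expansion[OF lin, of p] by (simp add: mult.commute)
  also have "\<phi> p = 0" using pp by (simp add: \<phi>_def linear_0[OF linD])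
  finally have \<phi>: "(\<Sum>i\<in>UNIV. \<phi> (axis i 1) * p $ i) = 0" .
  have 1: "sphere_hessian G D p (axis i 1) $ i = D p (axis i 1) $ i - p $ i * D p p $ i
      - \<phi> (axis i 1) * p $ i - (G p \<bullet> p) * (1 - p $ i * p $ i)" for i
    unfolding sphere_hessian_def \<phi>_def Let_def D_k by (simp add: inner_axis')
  have "(\<Sum>i\<in>UNIV. p $ i * D p p $ i) = D p p \<bullet> p" "(\<Sum>i\<in>UNIV. p $ i * p $ i) = 1"
    using pp by (simp_all add: inner_vec_def mult.commute)
  then show ?thesis
    unfolding laplacian_eq_trace hessian_local(3)[OF p] trace_matrix 1
    by (simp add: sum_subtractf \<phi> sum_distrib_left[symmetric])
qed

end

text \<open>Everything that Green's identity asks of a function, as data on the sphere alone.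
  Gradient \<open>T\<close> and Hessian \<open>D\<close> are carried along, so linear combinations
  need no matching of local extensions.\<close>

definition C2_S3 :: "(real^4 \<Rightarrow> real) \<Rightarrow> (real^4 \<Rightarrow> real^4) \<Rightarrow> (real^4 \<Rightarrow> real^4 \<Rightarrow> real^4) \<Rightarrow> bool" where
  "C2_S3 f T D \<longleftrightarrow>
     (\<forall>p\<in>S3. (f has_derivative (\<lambda>h. T p \<bullet> h)) (at p within S3) \<and> T p \<bullet> p = 0 \<and>
             (T has_derivative D p) (at p within S3) \<and> D p p = 0) \<and>
     (\<forall>v. continuous_on S3 (\<lambda>p. D p v))"

lemma C2_S3_laplacian:
  assumes "C2_S3 f T D" "p \<in> S3"
  shows "laplacian_S3 f p = trace (matrix (D p))"
proof -
  have T: "grad_S3 f q = T q" if "q \<in> S3" for q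
    using assms that by (intro grad_S3_eqI) (auto simp: C2_S3_def)
  have "(T has_derivative D p) (at p within S3)" using assms by (auto simp: C2_S3_def)
  then have "(grad_S3 f has_derivative D p) (at p within S3)"
    by (rule has_derivative_transform[OF assms(2), rotated]) (simp add: T)
  then have "hessian_S3 f p = D p"
    using assms by (intro hessian_S3_eqI) (auto simp: C2_S3_def)
  then show ?thesis by (simp add: laplacian_eq_trace)
qed

text \<open>A smooth function may have a different extension near each point, but gradient and
  Hessian of the sphere do not depend on it, so the local formulas glue to global continuous
  fields.\<close>

lemma smooth_imp_C2_S3:
  assumes "smooth_on_S3 f"
  shows "C2_S3 f (grad_S3 f) (hessian_S3 f)"
proof -
  have loc: "(f has_derivative (\<lambda>h. grad_S3 f p \<bullet> h)) (at p within S3) \<and> grad_S3 f p \<bullet> p = 0 \<and>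
      (grad_S3 f has_derivative hessian_S3 f p) (at p within S3) \<and> hessian_S3 f p p = 0 \<and>
      (\<forall>v. continuous (at p within S3) (\<lambda>p. hessian_S3 f p v))" if p: "p \<in> S3" for p
  proof -
    obtain U F where U: "open U" "p \<in> U" and Ck: "\<And>r. Ck_on r U F" and eq: "\<And>q. q \<in> U \<inter> S3 \<Longrightarrow> F q = f q"
      using bspec[OF assms[unfolded smooth_on_S3_def] p] by (elim exE conjE) (rule that, assumption, assumption, erule spec, erule bspec)
    have "Ck_on (Suc (Suc 0)) U F" by (rule Ck)
    then obtain F' where F': "\<And>q. q \<in> U \<Longrightarrow> (F has_derivative F' q) (at q)"
        and "\<And>v. Ck_on (Suc 0) U (\<lambda>q. F' q v)"
      unfolding Ck_on.simps(2)[of "Suc 0"] by (elim exE conjE) (rule that, erule (1) bspec, erule spec)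
    then have "\<forall>v. \<exists>f'. (\<forall>q\<in>U. ((\<lambda>q. F' q v) has_derivative f' q) (at q)) \<and> (\<forall>w. continuous_on U (\<lambda>q. f' q w))"
      by simp
    from choice[OF this] obtain F'' where F'': "\<And>v q. q \<in> U \<Longrightarrow> ((\<lambda>q. F' q v) has_derivative F'' v q) (at q)"
        and cont: "\<And>v w. continuous_on U (\<lambda>q. F'' v q w)"
      by blast
    \<comment> \<open>The extension comes with a separate second derivative for each direction;
      gradient and Hessian are assembled from the four coordinate directions.\<close>
    define G where "G q = (\<chi> i. F' q (axis i 1))" for q
    define D where "D q h = (\<chi> i. F'' (axis i 1) q h)" for q h
    have hF: "(F has_derivative (\<lambda>h. G q \<bullet> h)) (at q)" if q: "q \<in> U" for q
    proof -
      have lin: "linear (F' q)" using F'[OF q] by (rule has_derivative_linear)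
      have "F' q h = G q \<bullet> h" for h
        using linear_axis_expansion[OF lin, of h] by (simp add: G_def inner_vec_def mult.commute)
      then have "F' q = (\<lambda>h. G q \<bullet> h)" by auto
      with F'[OF q] show ?thesis by simp
    qed
    have hG: "(G has_derivative D q) (at q)" if q: "q \<in> U" for q
    proof -
      have "((\<lambda>q. G q \<bullet> axis i 1) has_derivative (\<lambda>h. D q h \<bullet> axis i 1)) (at q)" for i
        using F''[OF q, of "axis i 1"] by (simp add: G_def D_def inner_axis)
      then show ?thesis
        by (subst has_derivative_componentwise_within) (auto simp: Basis_vec_def)
    qed
    note local = U(1) hF hG eq
    have pU: "p \<in> U \<inter> S3" using U p by simp
    have contD: "continuous_on U (\<lambda>q. D q v)" for v
      unfolding D_def by (intro continuous_on_vec_lambda cont)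
    have hD: "D q (h - c *\<^sub>R r) = D q h - c *\<^sub>R D q r" if "q \<in> U" for q h c r
      using has_derivative_linear[OF hG[OF that]] by (simp add: linear_diff linear_scale)
    \<comment> \<open>Here \<open>q\<close> is base point and argument at once, while continuity is
      known for fixed arguments; linearity in the argument separates the two roles.\<close>
    have contDq: "continuous_on U (\<lambda>q. D q q)"
    proof -
      have "D q q = (\<Sum>i\<in>UNIV. q $ i *\<^sub>R D q (axis i 1))" if "q \<in> U" for q
        using linear_axis_expansion[OF has_derivative_linear[OF hG[OF that]]] .
      moreover have "continuous_on U (\<lambda>q. \<Sum>i\<in>UNIV. q $ i *\<^sub>R D q (axis i 1))"
        by (intro continuous_intros contD)
      ultimately show ?thesis by (simp cong: continuous_on_cong)
    qed
    have contG: "continuous_on U G"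
      using hG by (intro has_derivative_continuous_on[of U G D]) (simp add: has_derivative_at_withinI)
    have "continuous (at p within S3) (\<lambda>q. hessian_S3 f q v)" for v
    proof -
      have "continuous_on U (\<lambda>q. (D q v - (v \<bullet> q) *\<^sub>R D q q)
          - ((D q v - (v \<bullet> q) *\<^sub>R D q q) \<bullet> q + G q \<bullet> (v - (v \<bullet> q) *\<^sub>R q)) *\<^sub>R q - (G q \<bullet> q) *\<^sub>R (v - (v \<bullet> q) *\<^sub>R q))"
        by (intro continuous_intros contD contG contDq)
      then have "continuous_on U (\<lambda>q. sphere_hessian G D q v)"
        by (rule continuous_on_eq) (simp add: sphere_hessian_def Let_def hD)
      then have "continuous (at p) (\<lambda>q. sphere_hessian G D q v)"
        using U continuous_on_eq_continuous_at by blast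
      then have c: "continuous (at p within S3) (\<lambda>q. sphere_hessian G D q v)"
        by (rule continuous_at_imp_continuous_at_within)
      obtain e where e: "e > 0" "ball p e \<subseteq> U" using U open_contains_ball by blast
      show ?thesis
      proof (rule continuous_transform_within[OF c e(1) p])
        fix q assume q: "q \<in> S3" "dist q p < e"
        then have "q \<in> U \<inter> S3" using e by (auto simp: dist_commute)
        then show "sphere_hessian G D q v = hessian_S3 f q v"
          using hessian_local(3)[OF local] by simp
      qed
    qed
    with tangential_local[OF local pU] hessian_local[OF local pU] show ?thesis by simp
  qed
  then show ?thesis
    unfolding C2_S3_def by (auto simp: continuous_on_eq_continuous_within)
qed

lemma C2_S3_add:
  assumes "C2_S3 f T D" "C2_S3 f' T' D'"
  shows "C2_S3 (\<lambda>p. f p + f' p) (\<lambda>p. T p + T' p) (\<lambda>p h. D p h + D' p h)"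
proof -
  have *: "((\<lambda>p. f p + f' p) has_derivative (\<lambda>h. (T p + T' p) \<bullet> h)) (at p within S3)" if "p \<in> S3" for p
    unfolding inner_add_left using assms that by (intro has_derivative_add) (auto simp: C2_S3_def)
  show ?thesis
    unfolding C2_S3_def
  proof (intro conjI ballI allI *)
    fix p :: "real^4" assume "p \<in> S3"
    then show "((\<lambda>p. T p + T' p) has_derivative (\<lambda>h. D p h + D' p h)) (at p within S3)"
      using assms by (intro has_derivative_add) (auto simp: C2_S3_def)
  qed (use assms in \<open>auto simp: C2_S3_def inner_add_left intro!: continuous_intros\<close>)
qed

lemma C2_S3_cmult:
  assumes "C2_S3 f T D"
  shows "C2_S3 (\<lambda>p. c * f p) (\<lambda>p. c *\<^sub>R T p) (\<lambda>p h. c *\<^sub>R D p h)"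
proof -
  have *: "((\<lambda>p. c * f p) has_derivative (\<lambda>h. (c *\<^sub>R T p) \<bullet> h)) (at p within S3)" if "p \<in> S3" for p
    unfolding inner_scaleR_left using assms that
    by (intro has_derivative_mult_right) (auto simp: C2_S3_def)
  show ?thesis
    unfolding C2_S3_def
  proof (intro conjI ballI allI *)
    fix p :: "real^4" assume "p \<in> S3"
    then show "((\<lambda>p. c *\<^sub>R T p) has_derivative (\<lambda>h. c *\<^sub>R D p h)) (at p within S3)"
      using assms by (intro has_derivative_scaleR_right) (auto simp: C2_S3_def)
  qed (use assms in \<open>auto simp: C2_S3_def intro!: continuous_intros\<close>)
qed


section \<open>The modes are restricted harmonic polynomials\<close>

lemma real_polynomial_derivative:
  fixes F :: "'a::real_normed_vector \<Rightarrow> real"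
  assumes "real_polynomial_function F"
  shows "\<exists>F'. (\<forall>p. (F has_derivative F' p) (at p)) \<and> (\<forall>v. real_polynomial_function (\<lambda>p. F' p v))"
  using assms
proof induction
  case (linear f)
  then have "(f has_derivative f) (at p)" for p by (rule bounded_linear_imp_has_derivative)
  then show ?case by (intro exI[of _ "\<lambda>p. f"]) auto
next
  case (const c)
  show ?case by (intro exI[of _ "\<lambda>p h. 0"]) auto
next
  case (add f g)
  then obtain f' g' where
    "\<And>p. (f has_derivative f' p) (at p)" "\<And>v. real_polynomial_function (\<lambda>p. f' p v)"
    "\<And>p. (g has_derivative g' p) (at p)" "\<And>v. real_polynomial_function (\<lambda>p. g' p v)" by blast
  then show ?case
    by (intro exI[of _ "\<lambda>p h. f' p h + g' p h"]) (auto intro: has_derivative_add)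
next
  case (mult f g)
  then obtain f' g' where
    "\<And>p. (f has_derivative f' p) (at p)" "\<And>v. real_polynomial_function (\<lambda>p. f' p v)"
    "\<And>p. (g has_derivative g' p) (at p)" "\<And>v. real_polynomial_function (\<lambda>p. g' p v)" by blast
  then show ?case using mult(1,2)
    by (intro exI[of _ "\<lambda>p h. f p * g' p h + f' p h * g p"]) (auto intro!: has_derivative_mult real_polynomial_function.intros(3,4))
qed

lemma Ck_on_real_polynomial: "real_polynomial_function F \<Longrightarrow> Ck_on r UNIV F"
proof (induction r arbitrary: F)
  case 0
  then show ?case by (simp add: continuous_on_polymonial_function real_polynomial_function_eq)
next
  case (Suc r)
  from real_polynomial_derivative[OF Suc.prems] obtain F' where
    "\<forall>p. (F has_derivative F' p) (at p)" "\<forall>v. real_polynomial_function (\<lambda>p. F' p v)" by blast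
  with Suc.IH show ?case by auto
qed

lemma smooth_on_S3_polynomial:
  assumes "real_polynomial_function F" "\<And>p. p \<in> S3 \<Longrightarrow> f p = F p"
  shows "smooth_on_S3 f"
  unfolding smooth_on_S3_def
  by (intro ballI exI[of _ UNIV] exI[of _ F]) (use assms in \<open>auto intro: Ck_on_real_polynomial\<close>)

text \<open>Euler's relations: differentiate \<open>F (t *\<^sub>R p) = t ^ k * F p\<close> once and
  twice in \<open>t\<close> and put \<open>t = 1\<close>.\<close>

lemma homogeneous_derivatives:
  fixes F :: "real^'n \<Rightarrow> real"
  assumes F: "\<And>p. (F has_derivative (\<lambda>h. G p \<bullet> h)) (at p)" and G: "\<And>p. (G has_derivative D p) (at p)"
    and hom: "\<And>t p. F (t *\<^sub>R p) = t ^ k * F p"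
  shows "G p \<bullet> p = real k * F p" "D p p \<bullet> p = real k * (real k - 1) * F p"
proof -
  have 1: "G (t *\<^sub>R p) \<bullet> p = real k * t ^ (k - 1) * F p" for t
  proof -
    have "((\<lambda>s. F (s *\<^sub>R p)) has_derivative (\<lambda>h. G (t *\<^sub>R p) \<bullet> (h *\<^sub>R p))) (at t)"
      by (rule has_derivative_compose[OF _ F]) (auto intro!: derivative_eq_intros)
    then have "((\<lambda>s. s ^ k * F p) has_real_derivative G (t *\<^sub>R p) \<bullet> p) (at t)"
      by (simp add: hom has_field_derivative_def mult_commute_abs)
    moreover have "((\<lambda>s. s ^ k * F p) has_real_derivative real k * t ^ (k - 1) * F p) (at t)"
      by (auto intro!: derivative_eq_intros)
    ultimately show ?thesis by (rule DERIV_unique)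
  qed
  from 1[of 1] show "G p \<bullet> p = real k * F p" by simp
  have "((\<lambda>s. G (s *\<^sub>R p)) has_derivative (\<lambda>h. D (1 *\<^sub>R p) (h *\<^sub>R p))) (at 1)"
    by (rule has_derivative_compose[OF _ G]) (auto intro!: derivative_eq_intros)
  then have "((\<lambda>s. G (s *\<^sub>R p) \<bullet> p) has_derivative (\<lambda>h. D p (h *\<^sub>R p) \<bullet> p)) (at 1)"
    by (intro has_derivative_inner_left) simp
  then have "((\<lambda>s. real k * s ^ (k - 1) * F p) has_real_derivative D p p \<bullet> p) (at 1)"
    using has_derivative_linear[OF G, of p]
    by (simp add: 1 has_field_derivative_def linear_scale mult_commute_abs)
  \<comment> \<open>For \<open>k = 0\<close> the exponent \<open>k - 1\<close> is truncated, but the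
    factor \<open>real k\<close> makes both sides 0.\<close>
  moreover have "((\<lambda>s. real k * s ^ (k - 1) * F p) has_real_derivative real k * (real k - 1) * F p) (at 1)"
    by (cases k) (auto intro!: derivative_eq_intros)
  ultimately show "D p p \<bullet> p = real k * (real k - 1) * F p" by (rule DERIV_unique)
qed

text \<open>Euler's relations turn the radial derivatives in \<open>laplacian_local\<close> into
  multiples of \<open>F\<close>, and the eigenvalue is
  \<open>0 - k (k - 1) - 3 k = - k (k + 2)\<close>.\<close>

lemma laplacian_harmonic_homogeneous:
  assumes F: "has_grad_lap F G (\<lambda>_. 0)" and hom: "\<And>t p. F (t *\<^sub>R p) = t ^ k * F p"
    and eq: "\<And>p. p \<in> S3 \<Longrightarrow> f p = F p" and p: "p \<in> S3"
  shows "laplacian_S3 f p = - (real k * (real k + 2)) * f p"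
proof -
  obtain D where D: "\<And>p. (F has_derivative (\<lambda>h. G p \<bullet> h)) (at p)" "\<And>p. (G has_derivative D p) (at p)"
      "\<And>p. trace (matrix (D p)) = 0"
    using F unfolding has_grad_lap_def by blast
  have "laplacian_S3 f p = trace (matrix (D p)) - D p p \<bullet> p - 3 * (G p \<bullet> p)"
    by (rule laplacian_local[of UNIV F G D]) (use D eq p in auto)
  also have "\<dots> = - (real k * (real k + 2)) * f p"
    unfolding homogeneous_derivatives[OF D(1,2) hom] D(3) eq[OF p] by (simp add: algebra_simps)
  finally show ?thesis .
qed

definition mode_ext :: "nat \<Rightarrow> int \<Rightarrow> int \<Rightarrow> real^4 \<Rightarrow> real" where
  "mode_ext k l m = mode_poly (l \<ge> 0) (m \<ge> 0) (nat \<bar>l\<bar>) (nat \<bar>m\<bar>) (mode_degree k l m)"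

lemma mode_degree_eq:
  assumes "mode_exists k l m"
  shows "k = nat \<bar>l\<bar> + nat \<bar>m\<bar> + 2 * mode_degree k l m"
proof -
  have le: "\<bar>l\<bar> + \<bar>m\<bar> \<le> int k" and "even (l + m - int k)"
    using assms by (auto simp: mode_exists_def cong_iff_dvd_diff)
  then have "even (int k - (\<bar>l\<bar> + \<bar>m\<bar>))" by auto
  then obtain c where "int k - (\<bar>l\<bar> + \<bar>m\<bar>) = 2 * c" by (elim evenE)
  with le show ?thesis by (simp add: mode_degree_def)
qed

lemma jacobi_cos_double:
  "jacobi_poly a b d (cos (2 * x)) =
     (\<Sum>i\<le>d. mode_coeff b a d i * ((cos x)\<^sup>2) ^ i * ((sin x)\<^sup>2) ^ (d - i))"
proof -
  have c: "cos (2 * x) + 1 = 2 * (cos x)\<^sup>2" "cos (2 * x) - 1 = - 2 * (sin x)\<^sup>2"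
    by (simp_all add: cos_double sin_squared_eq)
  have *: "(2 * (cos x)\<^sup>2) ^ i * (- 2 * (sin x)\<^sup>2) ^ (d - i) =
      2 ^ d * ((- 1) ^ (d - i) * ((cos x)\<^sup>2) ^ i * ((sin x)\<^sup>2) ^ (d - i))" if "i \<le> d" for i
  proof -
    have "(- 2 * (sin x)\<^sup>2) ^ (d - i) = 2 ^ (d - i) * ((- 1) ^ (d - i) * ((sin x)\<^sup>2) ^ (d - i))"
      by (simp only: power_mult_distrib[symmetric]) simp
    moreover have "2 ^ i * 2 ^ (d - i) = (2 ^ d :: real)"
      using that by (simp add: power_add[symmetric])
    ultimately show ?thesis
      by (simp add: power_mult_distrib mult.left_commute[of _ "2 ^ i"] flip: \<open>2 ^ i * 2 ^ (d - i) = 2 ^ d\<close>)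
  qed
  show ?thesis
    unfolding jacobi_poly_def c mode_coeff_def atLeast0AtMost sum_distrib_left
  proof (intro sum.cong refl)
    fix i assume "i \<in> {..d}"
    then show "1 / 2 ^ d * (real (a + d choose i) * real (b + d choose (d - i)) *
        (2 * (cos x)\<^sup>2) ^ i * (- 2 * (sin x)\<^sup>2) ^ (d - i)) =
      real (a + d choose i) * real (b + d choose (d - i)) * (- 1) ^ (d - i) *
        ((cos x)\<^sup>2) ^ i * ((sin x)\<^sup>2) ^ (d - i)"
      unfolding mult.assoc[of _ "(2 * (cos x)\<^sup>2) ^ i"] by (subst *) auto
  qed
qed

lemma mode_ext_toroidal: "mode_ext k l m (toroidal \<xi> \<theta> \<phi>) = mode_raw k l m \<xi> \<theta> \<phi>"
proof -
  let ?p = "toroidal \<xi> \<theta> \<phi>"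
  have nth: "?p $ 1 = cos \<xi> * cos \<theta>" "?p $ 2 = cos \<xi> * sin \<theta>" "?p $ 3 = sin \<xi> * cos \<phi>" "?p $ 4 = sin \<xi> * sin \<phi>"
    by (simp_all add: toroidal_def vector_4)
  have sq: "plane_sq 1 2 ?p = (cos \<xi>)\<^sup>2" "plane_sq 3 4 ?p = (sin \<xi>)\<^sup>2"
    by (simp_all add: plane_sq_def nth power_mult_distrib distrib_left[symmetric])
  have pw: "plane_power (l \<ge> 0) 1 2 (nat \<bar>l\<bar>) ?p = cos \<xi> ^ nat \<bar>l\<bar> * mode_angular l \<theta>"
    "plane_power (m \<ge> 0) 3 4 (nat \<bar>m\<bar>) ?p = sin \<xi> ^ nat \<bar>m\<bar> * mode_angular m \<phi>"
    by (simp_all add: plane_power_polar[OF nth(1,2)] plane_power_polar[OF nth(3,4)] mode_angular_def)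
  show ?thesis
    unfolding mode_ext_def mode_poly_def plane_term_def sq pw mode_raw_def mode_radial_def jacobi_cos_double
    by (simp add: sum_distrib_left sum_distrib_right mult_ac)
qed

lemma S3_toroidalE:
  assumes "p \<in> S3"
  obtains \<xi> \<theta> \<phi> where "p = toroidal \<xi> \<theta> \<phi>" "\<xi> \<in> {0..pi/2}"
  using S3_toroidal[OF assms] by (auto simp: toroidal_box_def)

lemma mode_eq_ext:
  assumes "p \<in> S3"
  shows "\<Psi> k l m p = mode_ext k l m p / mode_norm k l m"
proof -
  obtain \<xi> \<theta> \<phi> where "p = toroidal \<xi> \<theta> \<phi>" "\<xi> \<in> {0..pi/2}" using S3_toroidalE[OF assms] .
  then show ?thesis by (simp add: mode_toroidal mode_ext_toroidal)
qed

lemma mode_polynomial: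
  "\<exists>F. real_polynomial_function F \<and> (\<forall>p\<in>S3. \<Psi> k l m p = F p)"
proof -
  have "real_polynomial_function (\<lambda>p. mode_ext k l m p * (1 / mode_norm k l m))"
    unfolding mode_ext_def by (intro real_polynomial_function.intros(2,4) real_polynomial_mode_poly)
  then show ?thesis by (intro exI[of _ "\<lambda>p. mode_ext k l m p * (1 / mode_norm k l m)"]) (simp add: mode_eq_ext)
qed

lemma mode_laplacian:
  assumes "mode_exists k l m" "p \<in> S3"
  shows "laplacian_S3 (\<Psi> k l m) p = - (real k * (real k + 2)) * \<Psi> k l m p"
proof -
  obtain G where "has_grad_lap (mode_ext k l m) G (\<lambda>_. 0)"
    unfolding mode_ext_def using harmonic_mode_poly by blast
  from has_grad_lap_cmult[OF this, of "1 / mode_norm k l m"]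
  have G: "has_grad_lap (\<lambda>p. mode_ext k l m p / mode_norm k l m) (\<lambda>p. (1 / mode_norm k l m) *\<^sub>R G p) (\<lambda>_. 0)"
    by simp
  have "mode_ext k l m (t *\<^sub>R q) = t ^ k * mode_ext k l m q" for t q
    unfolding mode_ext_def mode_poly_scaleR mode_degree_eq[OF assms(1), symmetric] ..
  then show ?thesis
    using assms(2) by (intro laplacian_harmonic_homogeneous[OF G]) (auto simp: mode_eq_ext)
qed


section \<open>Integration in toroidal coordinates\<close>

text \<open>The matrix \<open>Q\<close> with rows \<open>e i\<close> is orthogonal, and the trace is
  invariant under conjugation. This allows the divergence to be computed in the frame of toroidal
  coordinates.\<close>

lemma trace_orthonormal:
  fixes e :: "'n::finite \<Rightarrow> real^'n" and L :: "real^'n \<Rightarrow> real^'n"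
  assumes L: "linear L" and e: "\<And>i j. e i \<bullet> e j = (if i = j then 1 else 0)"
  shows "trace (matrix L) = (\<Sum>i\<in>UNIV. L (e i) \<bullet> e i)"
proof -
  define Q :: "real^'n^'n" where "Q = (\<chi> i. e i)"
  have "Q ** transpose Q = mat 1"
    using e by (simp add: Q_def matrix_matrix_mult_def transpose_def mat_def vec_eq_iff inner_vec_def)
  then have Q: "transpose Q ** Q = mat 1"
    by (simp add: matrix_left_right_inverse)
  have "(\<Sum>i\<in>UNIV. L (e i) \<bullet> e i) = trace (Q ** (matrix L ** transpose Q))"
  proof -
    have "L (e i) \<bullet> e i = (Q ** (matrix L ** transpose Q)) $ i $ i" for i
    proof -
      have "L (e i) = matrix L *v e i" using L by (simp add: matrix_works)
      then show ?thesis
        by (simp add: matrix_matrix_mult_def matrix_vector_mult_def inner_vec_def Q_def transpose_def mult.commute)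
    qed
    then show ?thesis by (simp add: trace_def)
  qed
  also have "\<dots> = trace (matrix L)"
    by (subst trace_mul_sym) (simp add: matrix_mul_assoc[symmetric] Q)
  finally show ?thesis ..
qed

lemma all_4I: "P 1 \<Longrightarrow> P 2 \<Longrightarrow> P 3 \<Longrightarrow> P 4 \<Longrightarrow> P i" for P :: "4 \<Rightarrow> bool"
  using forall_4[of P] by simp

lemma has_vector_derivative_vec:
  fixes f :: "real \<Rightarrow> real^'n"
  assumes "\<And>i. ((\<lambda>t. f t $ i) has_real_derivative v $ i) (at x)"
  shows "(f has_vector_derivative v) (at x)"
  unfolding has_vector_derivative_def
  by (subst has_derivative_componentwise_within)
     (use assms in \<open>auto simp: Basis_vec_def inner_axis has_field_derivative_def mult_commute_abs\<close>)

section \<open>The orthonormal frame of toroidal coordinates\<close>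

definition frame_\<xi> :: "real \<Rightarrow> real \<Rightarrow> real \<Rightarrow> real^4" where
  "frame_\<xi> \<xi> \<theta> \<phi> = vector [- sin \<xi> * cos \<theta>, - sin \<xi> * sin \<theta>, cos \<xi> * cos \<phi>, cos \<xi> * sin \<phi>]"

text \<open>The coordinate circle in \<open>\<theta>\<close> has speed \<open>cos \<xi>\<close>;
  this is its unit direction, which stays defined where the circle shrinks to a point. The same
  holds for \<open>frame_\<phi>\<close> with speed \<open>sin \<xi>\<close>.\<close>

definition frame_\<theta> :: "real \<Rightarrow> real^4" where
  "frame_\<theta> \<theta> = vector [- sin \<theta>, cos \<theta>, 0, 0]"

definition frame_\<phi> :: "real \<Rightarrow> real^4" where
  "frame_\<phi> \<phi> = vector [0, 0, - sin \<phi>, cos \<phi>]"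

lemma toroidal_derivatives:
  "((\<lambda>t. toroidal t \<theta> \<phi>) has_vector_derivative frame_\<xi> \<xi> \<theta> \<phi>) (at \<xi>)"
  "((\<lambda>t. toroidal \<xi> t \<phi>) has_vector_derivative cos \<xi> *\<^sub>R frame_\<theta> \<theta>) (at \<theta>)"
  "((\<lambda>t. toroidal \<xi> \<theta> t) has_vector_derivative sin \<xi> *\<^sub>R frame_\<phi> \<phi>) (at \<phi>)"
proof -
  show "((\<lambda>t. toroidal t \<theta> \<phi>) has_vector_derivative frame_\<xi> \<xi> \<theta> \<phi>) (at \<xi>)"
    by (rule has_vector_derivative_vec, rule all_4I)
       (auto simp: toroidal_def frame_\<xi>_def vector_4 intro!: derivative_eq_intros)
  show "((\<lambda>t. toroidal \<xi> t \<phi>) has_vector_derivative cos \<xi> *\<^sub>R frame_\<theta> \<theta>) (at \<theta>)"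
    by (rule has_vector_derivative_vec, rule all_4I)
       (auto simp: toroidal_def frame_\<theta>_def vector_4 intro!: derivative_eq_intros)
  show "((\<lambda>t. toroidal \<xi> \<theta> t) has_vector_derivative sin \<xi> *\<^sub>R frame_\<phi> \<phi>) (at \<phi>)"
    by (rule has_vector_derivative_vec, rule all_4I)
       (auto simp: toroidal_def frame_\<phi>_def vector_4 intro!: derivative_eq_intros)
qed

lemma inner_vector_4:
  "(vector [a, b, c, d] :: real^4) \<bullet> vector [a', b', c', d'] = a * a' + b * b' + c * c' + d * d'"
  by (simp add: inner_vec_def sum_4 vector_4)

lemma sin_cos_squares: "sin x * sin x + cos x * cos x = 1" "sin x * (sin x * y) + cos x * (cos x * y) = y"
  for x y :: real
proof -
  show 1: "sin x * sin x + cos x * cos x = 1"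
    using sin_cos_squared_add[of x] by (simp add: power2_eq_square)
  have "sin x * (sin x * y) + cos x * (cos x * y) = (sin x * sin x + cos x * cos x) * y"
    by (simp only: distrib_right mult.assoc)
  then show "sin x * (sin x * y) + cos x * (cos x * y) = y" using 1 by simp
qed

lemma frame_orthonormal:
  "frame_\<xi> \<xi> \<theta> \<phi> \<bullet> frame_\<xi> \<xi> \<theta> \<phi> = 1" "frame_\<theta> \<theta> \<bullet> frame_\<theta> \<theta> = 1" "frame_\<phi> \<phi> \<bullet> frame_\<phi> \<phi> = 1"
  "toroidal \<xi> \<theta> \<phi> \<bullet> toroidal \<xi> \<theta> \<phi> = 1"
  "frame_\<xi> \<xi> \<theta> \<phi> \<bullet> frame_\<theta> \<theta> = 0" "frame_\<xi> \<xi> \<theta> \<phi> \<bullet> frame_\<phi> \<phi> = 0" "frame_\<theta> \<theta> \<bullet> frame_\<phi> \<phi> = 0"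
  "frame_\<xi> \<xi> \<theta> \<phi> \<bullet> toroidal \<xi> \<theta> \<phi> = 0" "frame_\<theta> \<theta> \<bullet> toroidal \<xi> \<theta> \<phi> = 0" "frame_\<phi> \<phi> \<bullet> toroidal \<xi> \<theta> \<phi> = 0"
proof -
  have sq: "(a * cos b) * (a * cos b) + (a * sin b) * (a * sin b) = a * a" for a b :: real
    using sin_cos_squares(2)[of b "a * a"] by (simp add: algebra_simps)
  show "toroidal \<xi> \<theta> \<phi> \<bullet> toroidal \<xi> \<theta> \<phi> = 1"
    using toroidal_in_S3 by (simp add: norm_eq_1)
  show "frame_\<xi> \<xi> \<theta> \<phi> \<bullet> frame_\<xi> \<xi> \<theta> \<phi> = 1"
    using sq[of "sin \<xi>" \<theta>] sq[of "cos \<xi>" \<phi>] sin_cos_squares(1)[of \<xi>]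
    by (simp add: frame_\<xi>_def inner_vector_4)
  show "frame_\<xi> \<xi> \<theta> \<phi> \<bullet> toroidal \<xi> \<theta> \<phi> = 0"
    using sin_cos_squares(2)[of \<theta> "cos \<xi> * sin \<xi>"] sin_cos_squares(2)[of \<phi> "cos \<xi> * sin \<xi>"]
    by (simp add: frame_\<xi>_def toroidal_def inner_vector_4 algebra_simps)
qed (auto simp: frame_\<xi>_def frame_\<theta>_def frame_\<phi>_def toroidal_def inner_vector_4 sin_cos_squares algebra_simps)

text \<open>The Gram matrix is diagonal with entries 1, \<open>cos^2\<close> and
  \<open>sin^2\<close>. The range of \<open>\<xi>\<close> makes the root of the determinant the
  product itself and not only its absolute value.\<close>

lemma volume_density_eq:
  assumes "\<xi> \<in> {0..pi/2}"
  shows "volume_density \<xi> \<theta> \<phi> = cos \<xi> * sin \<xi>"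
proof -
  have fr: "toroidal_frame \<xi> \<theta> \<phi> = vector [frame_\<xi> \<xi> \<theta> \<phi>, cos \<xi> *\<^sub>R frame_\<theta> \<theta>, sin \<xi> *\<^sub>R frame_\<phi> \<phi>]"
    unfolding toroidal_frame_def by (simp add: vector_derivative_at[OF toroidal_derivatives(1)]
        vector_derivative_at[OF toroidal_derivatives(2)] vector_derivative_at[OF toroidal_derivatives(3)])
  have "det (\<chi> i j. (toroidal_frame \<xi> \<theta> \<phi> $ i) \<bullet> (toroidal_frame \<xi> \<theta> \<phi> $ j)) = (cos \<xi> * sin \<xi>)\<^sup>2"
    unfolding fr by (simp add: det_3 vector_3 frame_orthonormal
        frame_orthonormal(5-7)[THEN trans[OF inner_commute]] power2_eq_square)
  moreover have "0 \<le> cos \<xi> * sin \<xi>"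
    using assms by (intro mult_nonneg_nonneg) (auto intro: cos_ge_zero sin_ge_zero)
  ultimately show ?thesis by (simp add: volume_density_def)
qed

lemma continuous_on_vector_4 [continuous_intros]:
  fixes a b c d :: "'x::t2_space \<Rightarrow> real"
  assumes "continuous_on X a" "continuous_on X b" "continuous_on X c" "continuous_on X d"
  shows "continuous_on X (\<lambda>x. vector [a x, b x, c x, d x] :: real^4)"
proof -
  have "(vector [a x, b x, c x, d x] :: real^4)
      = a x *\<^sub>R axis 1 1 + b x *\<^sub>R axis 2 1 + c x *\<^sub>R axis 3 1 + d x *\<^sub>R axis 4 1" for x
    by (simp add: vec_eq_iff forall_4 vector_4 axis_def)
  then show ?thesis
    using assms by (simp only:) (intro continuous_intros)
qed

lemma continuous_on_toroidal [continuous_intros]: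
  fixes a b c :: "'x::t2_space \<Rightarrow> real"
  assumes "continuous_on X a" "continuous_on X b" "continuous_on X c"
  shows "continuous_on X (\<lambda>x. toroidal (a x) (b x) (c x))"
    "continuous_on X (\<lambda>x. frame_\<xi> (a x) (b x) (c x))"
  unfolding toroidal_def frame_\<xi>_def by (intro continuous_intros assms)+

lemma continuous_on_frame [continuous_intros]:
  fixes a :: "'x::t2_space \<Rightarrow> real"
  assumes "continuous_on X a"
  shows "continuous_on X (\<lambda>x. frame_\<theta> (a x))" "continuous_on X (\<lambda>x. frame_\<phi> (a x))"
  unfolding frame_\<theta>_def frame_\<phi>_def by (intro continuous_intros assms)+

lemma continuous_on_compose_toroidal:
  fixes a b c :: "'x::t2_space \<Rightarrow> real"
  assumes "continuous_on S3 g" "continuous_on X a" "continuous_on X b" "continuous_on X c"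
  shows "continuous_on X (\<lambda>x. g (toroidal (a x) (b x) (c x)))"
  by (rule continuous_on_compose2[OF assms(1) continuous_on_toroidal(1)[OF assms(2-4)]])
     (use toroidal_in_S3 in blast)

section \<open>Integrals over the sphere as integrals over the coordinate box\<close>

lemma toroidal_box_cbox: "toroidal_box = cbox (0, 0, 0) (pi/2, 2*pi, 2*pi)"
  by (simp add: toroidal_box_def cbox_Pair_eq)

text \<open>The gauge integral makes Fubini for continuous functions and the fundamental theorem
  available; continuity on the compact box gives integrability.\<close>

lemma integral_S3_cbox:
  assumes g: "continuous_on S3 g"
  shows "integral_S3 g =
    integral (cbox (0, 0, 0) (pi/2, 2*pi, 2*pi)) (\<lambda>(\<xi>, \<theta>, \<phi>). g (toroidal \<xi> \<theta> \<phi>) * (cos \<xi> * sin \<xi>))"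
proof -
  let ?f = "\<lambda>(\<xi>, \<theta>, \<phi>). g (toroidal \<xi> \<theta> \<phi>) * (cos \<xi> * sin \<xi>)"
  have "integral_S3 g = set_lebesgue_integral lborel toroidal_box ?f"
    unfolding integral_S3_def
    by (rule set_lebesgue_integral_cong)
       (simp add: toroidal_box_cbox, auto simp: toroidal_box_def volume_density_eq)
  also have "\<dots> = integral toroidal_box ?f"
  proof (rule set_borel_integral_eq_integral)
    have "continuous_on toroidal_box ?f"
      unfolding case_prod_beta by (intro continuous_intros continuous_on_compose_toroidal g)
    then show "set_integrable lborel toroidal_box ?f"
      unfolding set_integrable_def by (intro borel_integrable_compact) (auto simp: toroidal_box_cbox)
  qed
  finally show ?thesis by (simp only: toroidal_box_cbox)
qed

lemma integral_S3_iterated: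
  assumes g: "continuous_on S3 g"
  shows "integral_S3 g = integral {0..pi/2} (\<lambda>\<xi>. integral {0..2*pi} (\<lambda>\<theta>. integral {0..2*pi}
           (\<lambda>\<phi>. g (toroidal \<xi> \<theta> \<phi>) * (cos \<xi> * sin \<xi>))))"
proof -
  let ?f = "\<lambda>(\<xi>, \<theta>, \<phi>). g (toroidal \<xi> \<theta> \<phi>) * (cos \<xi> * sin \<xi>)"
  have "continuous_on X ?f" for X
    unfolding case_prod_beta by (intro continuous_intros continuous_on_compose_toroidal g)
  moreover have "continuous_on X (\<lambda>(\<theta>, \<phi>). g (toroidal \<xi> \<theta> \<phi>) * (cos \<xi> * sin \<xi>))" for X \<xi>
    unfolding case_prod_beta by (intro continuous_intros continuous_on_compose_toroidal g)
  ultimately show ?thesis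
    unfolding integral_S3_cbox[OF g]
    by (subst integral_prod_continuous) (auto simp: integral_prod_continuous)
qed

lemma integrable_toroidal:
  assumes "continuous_on S3 g"
  shows "(\<lambda>x. g (toroidal (fst x) (fst (snd x)) (snd (snd x))) * (cos (fst x) * sin (fst x)))
      integrable_on cbox a b"
  by (intro integrable_continuous continuous_intros continuous_on_compose_toroidal assms)

section \<open>Linearity of the integral and of the inner product\<close>

lemma integral_S3_add:
  assumes "continuous_on S3 f" "continuous_on S3 g"
  shows "integral_S3 (\<lambda>p. f p + g p) = integral_S3 f + integral_S3 g"
  unfolding integral_S3_cbox[OF assms(1)] integral_S3_cbox[OF assms(2)]
    integral_S3_cbox[OF continuous_on_add[OF assms]] case_prod_beta distrib_right
  by (intro integral_add integrable_toroidal assms)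

lemma integral_S3_cmult:
  assumes "continuous_on S3 f"
  shows "integral_S3 (\<lambda>p. c * f p) = c * integral_S3 f"
  unfolding integral_S3_cbox[OF assms]
    integral_S3_cbox[OF continuous_on_mult_left[OF assms]] case_prod_beta mult.assoc
  by (rule integral_mult_right)

lemma integral_S3_cong:
  assumes "\<And>p. p \<in> S3 \<Longrightarrow> f p = g p"
  shows "integral_S3 f = integral_S3 g"
proof -
  have "f (toroidal \<xi> \<theta> \<phi>) = g (toroidal \<xi> \<theta> \<phi>)" for \<xi> \<theta> \<phi>
    by (rule assms[OF toroidal_in_S3])
  then show ?thesis by (simp add: integral_S3_def)
qed

lemma inner_S3_cong: "(\<And>p. p \<in> S3 \<Longrightarrow> f p = g p) \<Longrightarrow> inner_S3 h f = inner_S3 h g"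
  unfolding inner_S3_def by (intro integral_S3_cong) simp

lemma inner_S3_commute: "inner_S3 f g = inner_S3 g f"
  by (simp add: inner_S3_def mult.commute)

lemma inner_S3_add:
  assumes "continuous_on S3 f" "continuous_on S3 g" "continuous_on S3 h"
  shows "inner_S3 f (\<lambda>p. g p + h p) = inner_S3 f g + inner_S3 f h"
  using integral_S3_add[OF continuous_on_mult[OF assms(1,2)] continuous_on_mult[OF assms(1,3)]]
  by (simp add: inner_S3_def distrib_left)

lemma inner_S3_cmult:
  assumes "continuous_on S3 f" "continuous_on S3 g"
  shows "inner_S3 f (\<lambda>p. c * g p) = c * inner_S3 f g"
  using integral_S3_cmult[OF continuous_on_mult[OF assms], of c]
  by (simp add: inner_S3_def mult.left_commute)

lemma inner_S3_zero: "inner_S3 f (\<lambda>p. 0) = 0"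
  using integral_S3_cmult[of "\<lambda>_. 0" 0, OF continuous_on_const] by (simp add: inner_S3_def)

lemma inner_S3_divide:
  assumes "continuous_on S3 f" "continuous_on S3 g"
  shows "inner_S3 f (\<lambda>p. g p / c) = inner_S3 f g / c"
  using inner_S3_cmult[OF assms, of "1 / c"] by simp

lemma inner_S3_diff:
  assumes "continuous_on S3 f" "continuous_on S3 g" "continuous_on S3 h"
  shows "inner_S3 f (\<lambda>p. g p - h p) = inner_S3 f g - inner_S3 f h"
  using inner_S3_add[OF assms(1,2) continuous_on_minus[OF assms(3)]] inner_S3_cmult[OF assms(1,3), of "- 1"]
  by simp

text \<open>The continuity rules belong to the set because every linearity step has continuity of
  the terms as a side condition.\<close>

lemmas inner_S3_linear = inner_S3_add inner_S3_cmult inner_S3_divide inner_S3_diff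
  continuous_on_add continuous_on_diff continuous_on_mult_left


section \<open>The divergence theorem and orthogonality of eigenfunctions\<close>

lemma has_integral_real_derivative:
  fixes f F :: "real \<Rightarrow> real"
  assumes "a \<le> b" "\<And>x. (F has_real_derivative f x) (at x)"
  shows "(f has_integral F b - F a) {a..b}"
  using assms by (intro fundamental_theorem_of_calculus)
    (auto simp: has_real_derivative_iff_has_vector_derivative[symmetric] intro: has_field_derivative_at_within)

text \<open>Fubini puts the differentiated variable innermost, and the fundamental theorem leaves
  the difference of the boundary values. The hypothesis \<open>per\<close> covers periodicity in an
  angle as well as vanishing at both ends.\<close>

lemma integral_derivative_eq_0:
  fixes f :: "real \<Rightarrow> 'c::euclidean_space \<Rightarrow> real"
  assumes ab: "a \<le> b" and d: "\<And>x y. ((\<lambda>x. f x y) has_real_derivative f' x y) (at x)"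
    and cont: "continuous_on (cbox (a, c) (b, d)) (\<lambda>(x, y). f' x y)"
    and per: "\<And>y. f b y = f a y"
  shows "integral (cbox (a, c) (b, d)) (\<lambda>(x, y). f' x y) = 0"
proof -
  have 1: "integral {a..b} (\<lambda>x. f' x y) = 0" for y
  proof -
    have "((\<lambda>x. f' x y) has_integral f b y - f a y) {a..b}"
      by (rule has_integral_real_derivative[OF ab d])
    then show ?thesis using per by (simp add: integral_unique)
  qed
  have "integral (cbox (a, c) (b, d)) (\<lambda>(x, y). f' x y) = integral (cbox a b) (\<lambda>x. integral (cbox c d) (f' x))"
    using integral_prod_continuous[OF cont] by simp
  also have "\<dots> = integral (cbox c d) (\<lambda>y. integral (cbox a b) (\<lambda>x. f' x y))"
    using cont by (rule integral_swap_continuous)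
  also have "\<dots> = 0" by (simp add: 1)
  finally show ?thesis .
qed

lemma vector_derivative_along_S3:
  fixes V :: "real^4 \<Rightarrow> 'b::real_normed_vector"
  assumes V: "(V has_derivative L) (at (\<gamma> t) within S3)" and \<gamma>: "(\<gamma> has_vector_derivative v) (at t)" "\<And>t. \<gamma> t \<in> S3"
  shows "((\<lambda>t. V (\<gamma> t)) has_vector_derivative L v) (at t)"
proof -
  have "(V \<circ> \<gamma> has_derivative L \<circ> (\<lambda>h. h *\<^sub>R v)) (at t)"
  proof (rule diff_chain_within)
    show "(\<gamma> has_derivative (\<lambda>h. h *\<^sub>R v)) (at t)" using \<gamma>(1) by (simp add: has_vector_derivative_def)
    show "(V has_derivative L) (at (\<gamma> t) within range \<gamma>)"
      using \<gamma>(2) by (intro has_derivative_subset[OF V]) auto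
  qed
  moreover have "L \<circ> (\<lambda>h. h *\<^sub>R v) = (\<lambda>h. h *\<^sub>R L v)"
    using has_derivative_linear[OF V] by (auto simp: linear_scale)
  ultimately show ?thesis by (simp add: has_vector_derivative_def o_def)
qed

lemma frame_derivatives:
  "((\<lambda>t. frame_\<xi> t \<theta> \<phi>) has_vector_derivative - toroidal \<xi> \<theta> \<phi>) (at \<xi>)"
  "(frame_\<theta> has_vector_derivative vector [- cos \<theta>, - sin \<theta>, 0, 0]) (at \<theta>)"
  "(frame_\<phi> has_vector_derivative vector [0, 0, - cos \<phi>, - sin \<phi>]) (at \<phi>)"
proof -
  show "((\<lambda>t. frame_\<xi> t \<theta> \<phi>) has_vector_derivative - toroidal \<xi> \<theta> \<phi>) (at \<xi>)"
    by (rule has_vector_derivative_vec, rule all_4I)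
       (auto simp: toroidal_def frame_\<xi>_def vector_4 intro!: derivative_eq_intros)
  show "(frame_\<theta> has_vector_derivative vector [- cos \<theta>, - sin \<theta>, 0, 0]) (at \<theta>)"
    by (rule has_vector_derivative_vec, rule all_4I)
       (auto simp: frame_\<theta>_def vector_4 intro!: derivative_eq_intros)
  show "(frame_\<phi> has_vector_derivative vector [0, 0, - cos \<phi>, - sin \<phi>]) (at \<phi>)"
    by (rule has_vector_derivative_vec, rule all_4I)
       (auto simp: frame_\<phi>_def vector_4 intro!: derivative_eq_intros)
qed

text \<open>The derivative of a circle frame points to the centre of its circle. Resolved along the
  sphere it has a part in direction \<open>frame_\<xi>\<close> and a normal part, which a tangent
  field does not see.\<close>

lemma circle_frame:
  "vector [- cos \<theta>, - sin \<theta>, 0, 0] = sin \<xi> *\<^sub>R frame_\<xi> \<xi> \<theta> \<phi> - cos \<xi> *\<^sub>R toroidal \<xi> \<theta> \<phi>"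
  "vector [0, 0, - cos \<phi>, - sin \<phi>] = - cos \<xi> *\<^sub>R frame_\<xi> \<xi> \<theta> \<phi> - sin \<xi> *\<^sub>R toroidal \<xi> \<theta> \<phi>"
proof -
  have sq: "sin \<xi> * (sin \<xi> * y) = y - cos \<xi> * (cos \<xi> * y)" for y
    using sin_cos_squares(2)[of \<xi> y] by simp
  show "vector [- cos \<theta>, - sin \<theta>, 0, 0] = sin \<xi> *\<^sub>R frame_\<xi> \<xi> \<theta> \<phi> - cos \<xi> *\<^sub>R toroidal \<xi> \<theta> \<phi>"
    by (simp add: vec_eq_iff forall_4 vector_4 frame_\<xi>_def toroidal_def sq)
  show "vector [0, 0, - cos \<phi>, - sin \<phi>] = - cos \<xi> *\<^sub>R frame_\<xi> \<xi> \<theta> \<phi> - sin \<xi> *\<^sub>R toroidal \<xi> \<theta> \<phi>"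
    by (simp add: vec_eq_iff forall_4 vector_4 frame_\<xi>_def toroidal_def sq)
qed

lemma divergence_theorem_S3:
  fixes V :: "real^4 \<Rightarrow> real^4"
  assumes V: "\<And>p. p \<in> S3 \<Longrightarrow> (V has_derivative D p) (at p within S3)"
    and tan: "\<And>p. p \<in> S3 \<Longrightarrow> V p \<bullet> p = 0" and D0: "\<And>p. p \<in> S3 \<Longrightarrow> D p p = 0"
    and contD: "\<And>v. continuous_on S3 (\<lambda>p. D p v)"
  shows "integral_S3 (\<lambda>p. trace (matrix (D p))) = 0"
proof -
  have lin: "linear (D p)" if "p \<in> S3" for p using V[OF that] by (rule has_derivative_linear)
  have contV: "continuous_on S3 V" using V by (rule has_derivative_continuous_on)
  let ?p = "\<lambda>\<xi> \<theta> \<phi>. toroidal \<xi> \<theta> \<phi>"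
  \<comment> \<open>Each of \<open>A\<close>, \<open>B\<close>, \<open>C\<close> is a frame
    component of \<open>V\<close> times the density, divided by the speed of the coordinate curve:
    1, \<open>cos \<xi>\<close> and \<open>sin \<xi>\<close>. The division is exact, so nothing is
    singular at the ends of the \<open>\<xi>\<close>-range.\<close>
  define A where "A \<xi> \<theta> \<phi> = cos \<xi> * sin \<xi> * (V (?p \<xi> \<theta> \<phi>) \<bullet> frame_\<xi> \<xi> \<theta> \<phi>)" for \<xi> \<theta> \<phi>
  define A' where "A' \<xi> \<theta> \<phi> = cos \<xi> * sin \<xi> * (D (?p \<xi> \<theta> \<phi>) (frame_\<xi> \<xi> \<theta> \<phi>) \<bullet> frame_\<xi> \<xi> \<theta> \<phi>)
    + (cos \<xi> * cos \<xi> - sin \<xi> * sin \<xi>) * (V (?p \<xi> \<theta> \<phi>) \<bullet> frame_\<xi> \<xi> \<theta> \<phi>)" for \<xi> \<theta> \<phi>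
  define B where "B \<xi> \<theta> \<phi> = sin \<xi> * (V (?p \<xi> \<theta> \<phi>) \<bullet> frame_\<theta> \<theta>)" for \<xi> \<theta> \<phi>
  define B' where "B' \<xi> \<theta> \<phi> = cos \<xi> * sin \<xi> * (D (?p \<xi> \<theta> \<phi>) (frame_\<theta> \<theta>) \<bullet> frame_\<theta> \<theta>)
    + sin \<xi> * sin \<xi> * (V (?p \<xi> \<theta> \<phi>) \<bullet> frame_\<xi> \<xi> \<theta> \<phi>)" for \<xi> \<theta> \<phi>
  define C where "C \<xi> \<theta> \<phi> = cos \<xi> * (V (?p \<xi> \<theta> \<phi>) \<bullet> frame_\<phi> \<phi>)" for \<xi> \<theta> \<phi>
  define C' where "C' \<xi> \<theta> \<phi> = cos \<xi> * sin \<xi> * (D (?p \<xi> \<theta> \<phi>) (frame_\<phi> \<phi>) \<bullet> frame_\<phi> \<phi>)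
    - cos \<xi> * cos \<xi> * (V (?p \<xi> \<theta> \<phi>) \<bullet> frame_\<xi> \<xi> \<theta> \<phi>)" for \<xi> \<theta> \<phi>
  have tanp: "V (?p \<xi> \<theta> \<phi>) \<bullet> ?p \<xi> \<theta> \<phi> = 0" for \<xi> \<theta> \<phi> by (rule tan[OF toroidal_in_S3])
  have scale: "D (?p \<xi> \<theta> \<phi>) (c *\<^sub>R v) = c *\<^sub>R D (?p \<xi> \<theta> \<phi>) v" for \<xi> \<theta> \<phi> c v
    by (rule linear_scale[OF lin[OF toroidal_in_S3]])
  note along = vector_derivative_along_S3[OF V[OF toroidal_in_S3]]
  have inner_deriv: "((\<lambda>t. f t \<bullet> g t) has_real_derivative f x \<bullet> g' + f' \<bullet> g x) (at x)"
    if "(f has_vector_derivative f') (at x)" "(g has_vector_derivative g') (at x)"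
    for f g :: "real \<Rightarrow> real^4" and f' g' x
    using bounded_bilinear.has_vector_derivative[OF bounded_bilinear_inner that]
    by (simp add: has_real_derivative_iff_has_vector_derivative)
  have dA: "((\<lambda>t. A t \<theta> \<phi>) has_real_derivative A' \<xi> \<theta> \<phi>) (at \<xi>)" for \<xi> \<theta> \<phi>
  proof -
    note * = inner_deriv[OF along[OF toroidal_derivatives(1) toroidal_in_S3] frame_derivatives(1)]
    show ?thesis
      unfolding A_def A'_def
      by (rule derivative_eq_intros * refl)+ (simp add: tanp algebra_simps)
  qed
  have dB: "((\<lambda>t. B \<xi> t \<phi>) has_real_derivative B' \<xi> \<theta> \<phi>) (at \<theta>)" for \<xi> \<theta> \<phi>
  proof -
    note * = inner_deriv[OF along[OF toroidal_derivatives(2) toroidal_in_S3] frame_derivatives(2)]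
    show ?thesis
      unfolding B_def B'_def
      by (rule derivative_eq_intros * refl)+
         (simp add: tanp scale circle_frame(1)[of \<theta> \<xi> \<phi>] inner_diff_right algebra_simps)
  qed
  have dC: "((\<lambda>t. C \<xi> \<theta> t) has_real_derivative C' \<xi> \<theta> \<phi>) (at \<phi>)" for \<xi> \<theta> \<phi>
  proof -
    note * = inner_deriv[OF along[OF toroidal_derivatives(3) toroidal_in_S3] frame_derivatives(3)]
    show ?thesis
      unfolding C_def C'_def
      by (rule derivative_eq_intros * refl)+
         (simp add: tanp scale circle_frame(2)[of \<phi> \<xi> \<theta>] inner_diff_right algebra_simps)
  qed
  \<comment> \<open>The terms without \<open>D\<close> cancel,
    \<open>(cos^2 - sin^2) + sin^2 - cos^2 = 0\<close>. The position vector completes the frame to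
    an orthonormal basis and contributes nothing because \<open>D p p = 0\<close>.\<close>
  have trace: "trace (matrix (D (?p \<xi> \<theta> \<phi>))) * (cos \<xi> * sin \<xi>) = A' \<xi> \<theta> \<phi> + (B' \<xi> \<theta> \<phi> + C' \<xi> \<theta> \<phi>)" for \<xi> \<theta> \<phi>
  proof -
    let ?e = "\<lambda>i::4. (vector [frame_\<xi> \<xi> \<theta> \<phi>, frame_\<theta> \<theta>, frame_\<phi> \<phi>, ?p \<xi> \<theta> \<phi>] :: real^4^4) $ i"
    have e: "?e 1 = frame_\<xi> \<xi> \<theta> \<phi>" "?e 2 = frame_\<theta> \<theta>" "?e 3 = frame_\<phi> \<phi>" "?e 4 = ?p \<xi> \<theta> \<phi>"
      by (simp_all add: vector_def)
    have "\<forall>i j. ?e i \<bullet> ?e j = (if i = j then 1 else 0)"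
      unfolding forall_4 e
      by (simp add: frame_orthonormal frame_orthonormal(5-10)[THEN trans[OF inner_commute]])
    then have "trace (matrix (D (?p \<xi> \<theta> \<phi>))) = (\<Sum>i\<in>UNIV. D (?p \<xi> \<theta> \<phi>) (?e i) \<bullet> ?e i)"
      by (intro trace_orthonormal lin toroidal_in_S3) blast
    then show ?thesis
      unfolding sum_4 e D0[OF toroidal_in_S3] A'_def B'_def C'_def by (simp add: algebra_simps)
  qed
  have contDv: "continuous_on X (\<lambda>x. D (?p (a x) (b x) (c x)) (v x))"
    if "continuous_on X a" "continuous_on X b" "continuous_on X c" "continuous_on X v"
    for X :: "'x::t2_space set" and a b c v
  proof -
    have "continuous_on X (\<lambda>x. \<Sum>i\<in>UNIV. v x $ i *\<^sub>R D (?p (a x) (b x) (c x)) (axis i 1))"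
      by (intro continuous_intros that continuous_on_compose_toroidal[OF contD])
    then show ?thesis
      by (rule continuous_on_eq) (rule linear_axis_expansion[OF lin[OF toroidal_in_S3], symmetric])
  qed
  let ?Q = "cbox (0, 0, 0) (pi/2, 2*pi, 2*pi) :: (real \<times> real \<times> real) set"
  have cont: "continuous_on X (\<lambda>(\<xi>, \<theta>, \<phi>). A' \<xi> \<theta> \<phi>)" "continuous_on X (\<lambda>(\<xi>, \<theta>, \<phi>). B' \<xi> \<theta> \<phi>)"
    "continuous_on X (\<lambda>(\<xi>, \<theta>, \<phi>). C' \<xi> \<theta> \<phi>)" for X
    unfolding A'_def B'_def C'_def case_prod_beta
    by (intro continuous_intros contDv continuous_on_compose_toroidal[OF contV])+
  have contB: "continuous_on X (\<lambda>(\<theta>, \<phi>). B' \<xi> \<theta> \<phi>)" and contC: "continuous_on X (\<lambda>(\<theta>, \<phi>). C' \<xi> \<theta> \<phi>)" for X \<xi>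
    unfolding B'_def C'_def case_prod_beta
    by (intro continuous_intros contDv continuous_on_compose_toroidal[OF contV])+
  \<comment> \<open>Here the boundary values vanish because of the factor
    \<open>cos \<xi> * sin \<xi>\<close>; for the two angles they agree by periodicity.\<close>
  have IA: "integral ?Q (\<lambda>(\<xi>, \<theta>, \<phi>). A' \<xi> \<theta> \<phi>) = 0"
  proof -
    have "integral ?Q (\<lambda>(\<xi>, y). A' \<xi> (fst y) (snd y)) = 0"
      by (rule integral_derivative_eq_0[where f = "\<lambda>\<xi> y. A \<xi> (fst y) (snd y)"])
         (use dA cont(1) in \<open>auto simp: A_def case_prod_beta\<close>)
    then show ?thesis by (simp add: case_prod_unfold)
  qed
  have IB: "integral ?Q (\<lambda>(\<xi>, \<theta>, \<phi>). B' \<xi> \<theta> \<phi>) = 0"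
  proof -
    have "integral (cbox (0, 0) (2*pi, 2*pi)) (\<lambda>(\<theta>, \<phi>). B' \<xi> \<theta> \<phi>) = 0" for \<xi>
      by (rule integral_derivative_eq_0[where f = "\<lambda>\<theta> \<phi>. B \<xi> \<theta> \<phi>"])
         (use dB contB in \<open>auto simp: B_def toroidal_def frame_\<theta>_def\<close>)
    then show ?thesis
      using cont(2) by (subst integral_prod_continuous) auto
  qed
  have IC: "integral ?Q (\<lambda>(\<xi>, \<theta>, \<phi>). C' \<xi> \<theta> \<phi>) = 0"
  proof -
    have "integral {0..2*pi} (\<lambda>\<phi>. C' \<xi> \<theta> \<phi>) = 0" for \<xi> \<theta>
    proof -
      have "((\<lambda>\<phi>. C' \<xi> \<theta> \<phi>) has_integral C \<xi> \<theta> (2*pi) - C \<xi> \<theta> 0) {0..2*pi}"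
        by (rule has_integral_real_derivative[OF _ dC]) simp
      then show ?thesis by (simp add: integral_unique C_def toroidal_def frame_\<phi>_def)
    qed
    then have "integral (cbox (0, 0) (2*pi, 2*pi)) (\<lambda>(\<theta>, \<phi>). C' \<xi> \<theta> \<phi>) = 0" for \<xi>
      using contC by (subst integral_prod_continuous) auto
    then show ?thesis
      using cont(3) by (subst integral_prod_continuous) auto
  qed
  have "continuous_on S3 (\<lambda>p. trace (matrix (D p)))"
    unfolding trace_matrix by (intro continuous_intros contD)
  then have "integral_S3 (\<lambda>p. trace (matrix (D p)))
      = integral ?Q (\<lambda>x. (case x of (\<xi>, \<theta>, \<phi>) \<Rightarrow> A' \<xi> \<theta> \<phi>) +
          ((case x of (\<xi>, \<theta>, \<phi>) \<Rightarrow> B' \<xi> \<theta> \<phi>) + (case x of (\<xi>, \<theta>, \<phi>) \<Rightarrow> C' \<xi> \<theta> \<phi>)))"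
    by (simp add: integral_S3_cbox trace case_prod_unfold)
  also have "\<dots> = 0"
    by (simp add: integral_add integrable_add integrable_continuous[OF cont(1)]
        integrable_continuous[OF cont(2)] integrable_continuous[OF cont(3)] IA IB IC)
  finally show ?thesis .
qed

text \<open>Green's second identity: the divergence of \<open>f \<nabla> g - g \<nabla> f\<close>,
  in which the products of the gradients cancel.\<close>

lemma green_S3:
  assumes f: "C2_S3 f T D" and g: "C2_S3 g T' D'"
  shows "integral_S3 (\<lambda>p. f p * trace (matrix (D' p)) - g p * trace (matrix (D p))) = 0"
proof -
  define W where "W p h = (f p *\<^sub>R D' p h + (T p \<bullet> h) *\<^sub>R T' p) - (g p *\<^sub>R D p h + (T' p \<bullet> h) *\<^sub>R T p)" for p h
  have contf: "continuous_on S3 f" "continuous_on S3 g"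
    using f g by (auto simp: C2_S3_def intro: has_derivative_continuous_on)
  have contT: "continuous_on S3 T" "continuous_on S3 T'"
    using f g by (auto simp: C2_S3_def intro: has_derivative_continuous_on)
  have "integral_S3 (\<lambda>p. trace (matrix (W p))) = 0"
  proof (rule divergence_theorem_S3)
    fix p assume p: "p \<in> S3"
    show "((\<lambda>p. f p *\<^sub>R T' p - g p *\<^sub>R T p) has_derivative W p) (at p within S3)"
      unfolding W_def using f g p
      by (intro has_derivative_diff has_derivative_scaleR) (auto simp: C2_S3_def)
    show "(f p *\<^sub>R T' p - g p *\<^sub>R T p) \<bullet> p = 0" "W p p = 0"
      using f g p by (auto simp: C2_S3_def W_def inner_diff_left)
  next
    fix v
    show "continuous_on S3 (\<lambda>p. W p v)"
      unfolding W_def using f g by (intro continuous_intros contf contT) (auto simp: C2_S3_def)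
  qed
  moreover have "trace (matrix (W p)) = f p * trace (matrix (D' p)) - g p * trace (matrix (D p))" for p
  proof -
    have "trace (matrix (W p)) = (f p * trace (matrix (D' p)) + (\<Sum>i\<in>UNIV. (T p \<bullet> axis i 1) * T' p $ i))
        - (g p * trace (matrix (D p)) + (\<Sum>i\<in>UNIV. (T' p \<bullet> axis i 1) * T p $ i))"
      by (simp add: trace_matrix W_def sum_subtractf sum.distrib sum_distrib_left)
    then show ?thesis
      unfolding sum_inner_axis by (simp add: inner_commute)
  qed
  ultimately show ?thesis by simp
qed

lemma C2_S3_continuous: "C2_S3 f T D \<Longrightarrow> continuous_on S3 f"
  by (auto simp: C2_S3_def intro: has_derivative_continuous_on)

lemma eigenfunctions_orthogonal:
  assumes f: "C2_S3 f T D" "\<And>p. p \<in> S3 \<Longrightarrow> trace (matrix (D p)) = a * f p"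
    and g: "C2_S3 g T' D'" "\<And>p. p \<in> S3 \<Longrightarrow> trace (matrix (D' p)) = b * g p" and ab: "a \<noteq> b"
  shows "inner_S3 f g = 0"
proof -
  have "0 = integral_S3 (\<lambda>p. f p * trace (matrix (D' p)) - g p * trace (matrix (D p)))"
    using green_S3[OF f(1) g(1)] by simp
  also have "\<dots> = integral_S3 (\<lambda>p. (b - a) * (f p * g p))"
    by (rule integral_S3_cong) (simp add: f(2) g(2) algebra_simps)
  also have "\<dots> = (b - a) * inner_S3 f g"
    unfolding inner_S3_def
    by (rule integral_S3_cmult) (intro continuous_on_mult C2_S3_continuous[OF f(1)] C2_S3_continuous[OF g(1)])
  finally show ?thesis using ab by simp
qed


section \<open>Invariance under screw and flip\<close>

lemma periodic_integral_shift:
  fixes h :: "real \<Rightarrow> real"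
  assumes h: "continuous_on UNIV h" "\<And>t. h (t + T) = h t" and c: "0 \<le> c" "c \<le> T"
  shows "integral {0..T} (\<lambda>t. h (t + c)) = integral {0..T} h"
proof -
  have cont: "continuous_on X h" for X using h(1) continuous_on_subset by blast
  have int: "h integrable_on {x..y}" for x y by (intro integrable_continuous_real cont)
  have "integral {0..T} (\<lambda>t. h (t + c)) = integral {c..T + c} h"
    using integral_shift[OF cont, where a = 0 and b = T and c = c] by (simp add: o_def)
  also have "\<dots> = integral {c..T} h + integral {T..T + c} h"
    using c by (intro Henstock_Kurzweil_Integration.integral_combine[symmetric] int) auto
  also have "integral {T..T + c} h = integral {0..c} h"
    using integral_shift[OF cont, where a = 0 and b = c and c = T] by (simp add: o_def h(2) add.commute)
  also have "integral {c..T} h + integral {0..c} h = integral {0..T} h"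
    using c Henstock_Kurzweil_Integration.integral_combine[OF _ _ int, of 0 c T] by simp
  finally show ?thesis .
qed

text \<open>The reflection is an involution, so it transports integrability in both directions; the
  two integrals then agree by definition, whether or not \<open>h\<close> is integrable.\<close>

lemma integral_reflect_interval:
  fixes h :: "real \<Rightarrow> real"
  assumes "0 \<le> b"
  shows "integral {0..b} (\<lambda>x. h (b - x)) = integral {0..b} h"
proof -
  have img: "(\<lambda>x. - x + b) ` {0..b} = {0..b}"
    by (auto intro!: image_eqI[of _ _ "b - x" for x])
  have *: "((\<lambda>x. f (b - x)) has_integral i) {0..b}" if "(f has_integral i) {0..b}" for f :: "real \<Rightarrow> real" and i
    using has_integral_affinity[of f i 0 b "- 1" b] that img by (simp add: minus_diff_commute)
  have "((\<lambda>x. h (b - x)) has_integral i) {0..b} \<longleftrightarrow> (h has_integral i) {0..b}" for i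
    using *[of h i] *[of "\<lambda>x. h (b - x)" i] by auto
  then show ?thesis by (simp add: integral_def integrable_on_def)
qed

text \<open>\<open>c - t = T - (t + (T - c))\<close>: a translation combined with the reflection of
  \<open>{0..T}\<close>.\<close>

lemma periodic_integral_reflect:
  fixes h :: "real \<Rightarrow> real"
  assumes h: "continuous_on UNIV h" "\<And>t. h (t + T) = h t" and c: "0 \<le> c" "c \<le> T"
  shows "integral {0..T} (\<lambda>t. h (c - t)) = integral {0..T} h"
proof -
  have per: "h (T - t) = h (- t)" for t using h(2)[of "- t"] by simp
  have "integral {0..T} (\<lambda>t. (\<lambda>t. h (T - t)) (t + (T - c))) = integral {0..T} (\<lambda>t. h (T - t))"
    using c by (intro periodic_integral_shift continuous_on_compose2[OF h(1)] continuous_intros)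
      (auto simp: per)
  also have "\<dots> = integral {0..T} h"
    using c by (intro integral_reflect_interval) auto
  finally show ?thesis by simp
qed

text \<open>In Cartesian coordinates the generators are linear. This shows their continuity, which
  the definition by a choice of toroidal coordinates hides.\<close>

lemma screw_eq:
  fixes n :: nat
  assumes "p \<in> S3"
  defines "c \<equiv> pi / real n"
  shows "screw n p = vector [cos c * p $ 1 - sin c * p $ 2, sin c * p $ 1 + cos c * p $ 2,
                             cos c * p $ 3 - sin c * p $ 4, sin c * p $ 3 + cos c * p $ 4]"
proof -
  obtain \<xi> \<theta> \<phi> where p: "p = toroidal \<xi> \<theta> \<phi>" "\<xi> \<in> {0..pi/2}" using S3_toroidalE[OF assms(1)] .
  have c: "2 * pi / (2 * real n) = c" by (simp add: c_def)
  show ?thesis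
    unfolding p(1) screw_toroidal[OF p(2)] c
    by (simp add: toroidal_def vec_eq_iff forall_4 vector_4 cos_add sin_add algebra_simps)
qed

lemma flip_eq:
  assumes "p \<in> S3"
  shows "flip p = vector [p $ 3, - p $ 4, - p $ 1, p $ 2]"
proof -
  obtain \<xi> \<theta> \<phi> where p: "p = toroidal \<xi> \<theta> \<phi>" "\<xi> \<in> {0..pi/2}" using S3_toroidalE[OF assms(1)] .
  show ?thesis
    unfolding p(1) flip_toroidal[OF p(2)]
    by (simp add: toroidal_def vec_eq_iff forall_4 vector_4 cos_diff sin_diff)
qed

lemma screw_flip_S3:
  assumes "p \<in> S3"
  shows "screw n p \<in> S3" "flip p \<in> S3"
proof -
  obtain \<xi> \<theta> \<phi> where p: "p = toroidal \<xi> \<theta> \<phi>" "\<xi> \<in> {0..pi/2}" using S3_toroidalE[OF assms(1)] .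
  show "screw n p \<in> S3" "flip p \<in> S3"
    unfolding p(1) screw_toroidal[OF p(2)] flip_toroidal[OF p(2)] by (rule toroidal_in_S3)+
qed

lemma continuous_screw_flip: "continuous_on S3 (screw n)" "continuous_on S3 flip"
proof -
  have "continuous_on S3 (\<lambda>p::real^4. vector [cos (pi / real n) * p $ 1 - sin (pi / real n) * p $ 2,
      sin (pi / real n) * p $ 1 + cos (pi / real n) * p $ 2,
      cos (pi / real n) * p $ 3 - sin (pi / real n) * p $ 4,
      sin (pi / real n) * p $ 3 + cos (pi / real n) * p $ 4] :: real^4)"
    by (intro continuous_intros)
  then show "continuous_on S3 (screw n)"
    by (rule continuous_on_eq) (rule screw_eq[symmetric])
  have "continuous_on S3 (\<lambda>p::real^4. vector [p $ 3, - p $ 4, - p $ 1, p $ 2] :: real^4)"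
    by (intro continuous_intros)
  then show "continuous_on S3 flip"
    by (rule continuous_on_eq) (rule flip_eq[symmetric])
qed

lemma toroidal_periodic:
  "toroidal \<xi> (\<theta> + 2 * pi) \<phi> = toroidal \<xi> \<theta> \<phi>" "toroidal \<xi> \<theta> (\<phi> + 2 * pi) = toroidal \<xi> \<theta> \<phi>"
  by (simp_all add: toroidal_def)

section \<open>Invariance of the integral, torus by torus\<close>

lemma continuous_torus_slices:
  fixes g :: "real^4 \<Rightarrow> real"
  assumes g: "continuous_on S3 g"
  shows "continuous_on X (\<lambda>\<phi>. g (toroidal \<xi> \<theta> \<phi>) * r)"
    "continuous_on X (\<lambda>\<theta>. g (toroidal \<xi> \<theta> \<phi>) * r)"
    "continuous_on UNIV (\<lambda>\<theta>. integral {0..2*pi} (\<lambda>\<phi>. g (toroidal \<xi> \<theta> \<phi>) * r))"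
    "continuous_on UNIV (\<lambda>\<phi>. integral {0..2*pi} (\<lambda>\<theta>. g (toroidal \<xi> \<theta> \<phi>) * r))"
proof -
  show "continuous_on X (\<lambda>\<phi>. g (toroidal \<xi> \<theta> \<phi>) * r)" "continuous_on X (\<lambda>\<theta>. g (toroidal \<xi> \<theta> \<phi>) * r)"
    by (intro continuous_intros continuous_on_compose_toroidal[OF g])+
  have "continuous_on (UNIV \<times> cbox 0 (2*pi)) (\<lambda>(\<theta>, \<phi>). g (toroidal \<xi> \<theta> \<phi>) * r)"
    "continuous_on (UNIV \<times> cbox 0 (2*pi)) (\<lambda>(\<phi>, \<theta>). g (toroidal \<xi> \<theta> \<phi>) * r)"
    unfolding case_prod_beta by (intro continuous_intros continuous_on_compose_toroidal[OF g])+
  from this[THEN integral_continuous_on_param]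
  show "continuous_on UNIV (\<lambda>\<theta>. integral {0..2*pi} (\<lambda>\<phi>. g (toroidal \<xi> \<theta> \<phi>) * r))"
    "continuous_on UNIV (\<lambda>\<phi>. integral {0..2*pi} (\<lambda>\<theta>. g (toroidal \<xi> \<theta> \<phi>) * r))"
    by (simp_all only: cbox_interval)
qed

lemma integral_torus_shift:
  fixes g :: "real^4 \<Rightarrow> real"
  assumes g: "continuous_on S3 g" and c: "0 \<le> c" "c \<le> 2 * pi"
  shows "integral {0..2*pi} (\<lambda>\<theta>. integral {0..2*pi} (\<lambda>\<phi>. g (toroidal \<xi> (\<theta> + c) (\<phi> + c)) * r)) =
         integral {0..2*pi} (\<lambda>\<theta>. integral {0..2*pi} (\<lambda>\<phi>. g (toroidal \<xi> \<theta> \<phi>) * r))"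
proof -
  note cont = continuous_torus_slices[OF g]
  have 1: "integral {0..2*pi} (\<lambda>\<phi>. g (toroidal \<xi> \<theta> (\<phi> + c)) * r) = integral {0..2*pi} (\<lambda>\<phi>. g (toroidal \<xi> \<theta> \<phi>) * r)" for \<theta>
    by (rule periodic_integral_shift[OF cont(1) _ c]) (simp only: toroidal_periodic)
  show ?thesis
    unfolding 1 by (rule periodic_integral_shift[OF cont(3) _ c]) (simp only: toroidal_periodic)
qed

text \<open>The flip exchanges the two circles, so after reflecting each angle the order of
  integration has to be exchanged as well.\<close>

lemma integral_torus_reflect:
  fixes g :: "real^4 \<Rightarrow> real"
  assumes g: "continuous_on S3 g"
  shows "integral {0..2*pi} (\<lambda>\<theta>. integral {0..2*pi} (\<lambda>\<phi>. g (toroidal \<xi> (- \<phi>) (pi - \<theta>)) * r)) =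
         integral {0..2*pi} (\<lambda>\<theta>. integral {0..2*pi} (\<lambda>\<phi>. g (toroidal \<xi> \<theta> \<phi>) * r))"
proof -
  note cont = continuous_torus_slices[OF g]
  have "integral {0..2*pi} (\<lambda>\<phi>. g (toroidal \<xi> (0 - \<phi>) \<theta>) * r) = integral {0..2*pi} (\<lambda>\<phi>. g (toroidal \<xi> \<phi> \<theta>) * r)" for \<theta>
    by (rule periodic_integral_reflect[OF cont(2)]) (simp_all only: toroidal_periodic order_refl pi_ge_zero mult_nonneg_nonneg zero_le_numeral)
  then have 1: "integral {0..2*pi} (\<lambda>\<phi>. g (toroidal \<xi> (- \<phi>) \<theta>) * r) = integral {0..2*pi} (\<lambda>\<phi>. g (toroidal \<xi> \<phi> \<theta>) * r)" for \<theta>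
    by (simp only: diff_0)
  have swap: "continuous_on (cbox (0, 0) (2*pi, 2*pi)) (\<lambda>(\<theta>, \<phi>). g (toroidal \<xi> \<phi> \<theta>) * r)"
    unfolding case_prod_beta by (intro continuous_intros continuous_on_compose_toroidal[OF g])
  have "integral {0..2*pi} (\<lambda>\<theta>. integral {0..2*pi} (\<lambda>\<phi>. g (toroidal \<xi> \<phi> (pi - \<theta>)) * r))
      = integral {0..2*pi} (\<lambda>\<theta>. integral {0..2*pi} (\<lambda>\<phi>. g (toroidal \<xi> \<phi> \<theta>) * r))"
    by (rule periodic_integral_reflect[OF cont(4)]) (simp_all only: toroidal_periodic pi_ge_zero, simp)
  also have "\<dots> = integral {0..2*pi} (\<lambda>\<phi>. integral {0..2*pi} (\<lambda>\<theta>. g (toroidal \<xi> \<phi> \<theta>) * r))"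
    using integral_swap_continuous[OF swap] by (simp only: cbox_interval)
  finally show ?thesis unfolding 1 .
qed

lemma integral_S3_screw:
  assumes g: "continuous_on S3 g" and n: "n \<ge> 1"
  shows "integral_S3 (\<lambda>p. g (screw n p)) = integral_S3 g"
proof -
  have c: "continuous_on S3 (\<lambda>p. g (screw n p))"
    by (rule continuous_on_compose2[OF g continuous_screw_flip(1)]) (use screw_flip_S3 in blast)
  have n': "0 \<le> 2 * pi / (2 * real n)" "2 * pi / (2 * real n) \<le> 2 * pi" using n by (simp_all add: divide_le_eq)
  show ?thesis
    unfolding integral_S3_iterated[OF c] integral_S3_iterated[OF g]
    by (rule Henstock_Kurzweil_Integration.integral_cong)
       (simp only: screw_toroidal integral_torus_shift[OF g n'])
qed

text \<open>The flip sends \<open>\<xi>\<close> to \<open>pi/2 - \<xi>\<close>; this exchanges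
  \<open>cos\<close> and \<open>sin\<close> and so preserves the density.\<close>

lemma integral_S3_flip:
  assumes g: "continuous_on S3 g"
  shows "integral_S3 (\<lambda>p. g (flip p)) = integral_S3 g"
proof -
  have c: "continuous_on S3 (\<lambda>p. g (flip p))"
    by (rule continuous_on_compose2[OF g continuous_screw_flip(2)]) (use screw_flip_S3 in blast)
  define H where "H \<xi> = integral {0..2*pi} (\<lambda>\<theta>. integral {0..2*pi} (\<lambda>\<phi>. g (toroidal \<xi> \<theta> \<phi>) * (cos \<xi> * sin \<xi>)))" for \<xi>
  have "integral_S3 (\<lambda>p. g (flip p)) = integral {0..pi/2} (\<lambda>\<xi>. integral {0..2*pi} (\<lambda>\<theta>. integral {0..2*pi}
      (\<lambda>\<phi>. g (toroidal (pi/2 - \<xi>) (- \<phi>) (pi - \<theta>)) * (cos \<xi> * sin \<xi>))))"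
    unfolding integral_S3_iterated[OF c]
    by (intro Henstock_Kurzweil_Integration.integral_cong) (simp add: flip_toroidal)
  also have "\<dots> = integral {0..pi/2} (\<lambda>\<xi>. H (pi/2 - \<xi>))"
    unfolding integral_torus_reflect[OF g] H_def
    by (simp add: cos_diff sin_diff mult.commute[of "sin _" "cos _"])
  also have "\<dots> = integral {0..pi/2} H"
    by (rule integral_reflect_interval) simp
  also have "\<dots> = integral_S3 g"
    unfolding integral_S3_iterated[OF g] H_def ..
  finally show ?thesis .
qed

lemma C2_S3_mode:
  "C2_S3 (\<Psi> k l m) (grad_S3 (\<Psi> k l m)) (hessian_S3 (\<Psi> k l m))"
  using mode_polynomial[of k l m] by (intro smooth_imp_C2_S3) (auto intro: smooth_on_S3_polynomial)

lemma mode_continuous: "continuous_on S3 (\<Psi> k l m)"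
  by (rule C2_S3_continuous[OF C2_S3_mode])

lemma mode_degree_sym:
  "mode_degree k (- l) m = mode_degree k l m" "mode_degree k l (- m) = mode_degree k l m"
  "mode_degree k l m = mode_degree k m l"
  by (simp_all add: mode_degree_def add.commute)

lemma mode_norm_sym:
  "mode_norm k (- l) m = mode_norm k l m" "mode_norm k l (- m) = mode_norm k l m"
  "mode_norm k m l = mode_norm k l m"
  by (simp_all add: mode_norm_def Let_def mode_degree_sym mode_degree_sym(3)[of k m l] add.commute mult.commute)

lemma mode_norm_pos: "mode_norm k l m > 0"
  unfolding mode_norm_def Let_def by (intro mult_pos_pos) auto

lemma mode_radial_sym:
  "mode_radial k (- l) m = mode_radial k l m" "mode_radial k l (- m) = mode_radial k l m"
  by (simp_all add: mode_radial_def mode_degree_sym fun_eq_iff)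

text \<open>The symmetry \<open>P_d^(a,b) (- u) = (- 1)^d P_d^(b,a) (u)\<close> of Jacobi
  polynomials, since \<open>pi / 2 - \<xi>\<close> changes the sign of
  \<open>cos (2 * \<xi>)\<close>. On coefficients it is the reversal of the sum.\<close>

lemma mode_radial_reflect:
  "mode_radial k l m (pi / 2 - \<xi>) = (- 1) ^ mode_degree k l m * mode_radial k m l \<xi>"
proof -
  let ?d = "mode_degree k l m" and ?a = "nat \<bar>l\<bar>" and ?b = "nat \<bar>m\<bar>"
  have cs: "cos (pi / 2 - \<xi>) = sin \<xi>" "sin (pi / 2 - \<xi>) = cos \<xi>"
    by (simp_all add: cos_diff sin_diff)
  have "(\<Sum>i\<le>?d. mode_coeff ?a ?b ?d i * ((sin \<xi>)\<^sup>2) ^ i * ((cos \<xi>)\<^sup>2) ^ (?d - i))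
      = (\<Sum>i\<le>?d. mode_coeff ?a ?b ?d (?d - i) * ((sin \<xi>)\<^sup>2) ^ (?d - i) * ((cos \<xi>)\<^sup>2) ^ i)"
    by (rule sum.reindex_bij_witness[of _ "\<lambda>i. ?d - i" "\<lambda>i. ?d - i"]) auto
  also have "\<dots> = (- 1) ^ ?d * (\<Sum>i\<le>?d. mode_coeff ?b ?a ?d i * ((cos \<xi>)\<^sup>2) ^ i * ((sin \<xi>)\<^sup>2) ^ (?d - i))"
    unfolding sum_distrib_left
  proof (intro sum.cong refl)
    fix i assume "i \<in> {..?d}"
    then obtain j where d: "?d = i + j" by (auto simp: le_iff_add)
    have "(- 1) ^ (i + j) * (- 1) ^ j = ((- 1) ^ i :: real)"
      by (simp add: power_add mult.assoc flip: power_mult_distrib)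
    then show "mode_coeff ?a ?b ?d (?d - i) * ((sin \<xi>)\<^sup>2) ^ (?d - i) * ((cos \<xi>)\<^sup>2) ^ i =
        (- 1) ^ ?d * (mode_coeff ?b ?a ?d i * ((cos \<xi>)\<^sup>2) ^ i * ((sin \<xi>)\<^sup>2) ^ (?d - i))"
      unfolding d mode_coeff_def by simp
  qed
  finally show ?thesis
    unfolding mode_radial_def jacobi_cos_double cs mode_degree_sym(3)[of k m l]
    by (simp add: mult_ac)
qed

text \<open>The factors of \<open>\<sigma>\<close> arise one by one: the parity of \<open>d\<close>
  from the radial reflection, the sign of \<open>l\<close> from the angle \<open>- \<phi>\<close>,
  and the sign and the parity of \<open>m\<close> from the angle
  \<open>pi - \<theta>\<close>.\<close>

lemma mode_flip:
  assumes "p \<in> S3"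
  shows "\<Psi> k l m (flip p) = real_of_int (\<sigma> k l m) * \<Psi> k m l p"
proof -
  obtain \<xi> \<theta> \<phi> where p: "p = toroidal \<xi> \<theta> \<phi>" "\<xi> \<in> {0..pi/2}" using S3_toroidalE[OF assms] .
  have \<xi>: "pi/2 - \<xi> \<in> {0..pi/2}" using p(2) by auto
  have l: "mode_angular l (- \<phi>) = (if l \<ge> 0 then 1 else - 1) * mode_angular l \<phi>"
    by (simp add: mode_angular_def)
  define M where "M = nat \<bar>m\<bar>"
  have M: "mode_angular m x = (if m \<ge> 0 then cos (real M * x) else sin (real M * x))" for x
    by (simp add: mode_angular_def M_def)
  have even_M: "even M \<longleftrightarrow> even m" by (simp add: M_def even_nat_iff)
  have "cos (real M * pi) = (if even m then 1 else - 1)" "sin (real M * pi) = 0"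
    by (simp_all add: cos_npi even_M)
  then have m: "mode_angular m (pi - \<theta>) =
      (if m \<ge> 0 then 1 else - 1) * (if even m then 1 else - 1) * mode_angular m \<theta>"
    by (simp add: M right_diff_distrib cos_diff sin_diff)
  show ?thesis
    unfolding p(1) flip_toroidal[OF p(2)] mode_toroidal[OF p(2)] mode_toroidal[OF \<xi>] mode_raw_def
      mode_radial_reflect l m mode_norm_sym(3)[of k m l]
    by (simp add: mode_sign_def)
qed


section \<open>Norms of Jacobi polynomials\<close>

text \<open>Half the Beta function at \<open>a + 1\<close> and \<open>b + 1\<close>. The derivative
  of \<open>cos^(2a+2) sin^(2b+2)\<close> integrates to 0 and trades two powers of
  \<open>cos\<close> for two of \<open>sin\<close>; hence \<open>b\<close> is arbitrary in the
  induction on \<open>a\<close>.\<close>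

lemma beta_integral:
  "((\<lambda>x. cos x ^ (2 * a + 1) * sin x ^ (2 * b + 1)) has_integral
      fact a * fact b / (2 * fact (a + b + 1))) {0..pi/2}"
proof (induction a arbitrary: b)
  case 0
  have "((\<lambda>x. real (2 * b + 2) * (cos x ^ (2 * 0 + 1) * sin x ^ (2 * b + 1))) has_integral
      sin (pi/2) ^ Suc (2 * b + 1) - sin 0 ^ Suc (2 * b + 1)) {0..pi/2}"
  proof (rule has_integral_real_derivative)
    fix x :: real
    show "((\<lambda>x. sin x ^ Suc (2 * b + 1)) has_real_derivative
        real (2 * b + 2) * (cos x ^ (2 * 0 + 1) * sin x ^ (2 * b + 1))) (at x)"
      using DERIV_power_Suc[OF DERIV_sin, of "2 * b + 1" x] by (simp add: algebra_simps)
  qed simp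
  from has_integral_mult_right[OF this, of "1 / real (2 * b + 2)"]
  have "((\<lambda>x. cos x ^ (2 * 0 + 1) * sin x ^ (2 * b + 1)) has_integral 1 / real (2 * b + 2)) {0..pi/2}"
    by (simp add: mult.assoc[symmetric])
  moreover have "1 / real (2 * b + 2) = fact 0 * fact b / (2 * fact (0 + b + 1))"
  proof -
    have "real (2 * b + 2) = 2 * (1 + real b)" by simp
    then show ?thesis by (simp add: divide_simps)
  qed
  ultimately show ?case by (simp only:)
next
  case (Suc a)
  let ?f = "\<lambda>x::real. cos x ^ Suc (2 * a + 1) * sin x ^ Suc (2 * b + 1)"
  have "((\<lambda>x. real (2 * b + 2) * (cos x ^ (2 * Suc a + 1) * sin x ^ (2 * b + 1))
      - real (2 * a + 2) * (cos x ^ (2 * a + 1) * sin x ^ (2 * Suc b + 1))) has_integral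
      ?f (pi/2) - ?f 0) {0..pi/2}"
  proof (rule has_integral_real_derivative)
    fix x :: real
    show "(?f has_real_derivative real (2 * b + 2) * (cos x ^ (2 * Suc a + 1) * sin x ^ (2 * b + 1))
        - real (2 * a + 2) * (cos x ^ (2 * a + 1) * sin x ^ (2 * Suc b + 1))) (at x)"
      using DERIV_mult[OF DERIV_power_Suc[OF DERIV_cos, of "2 * a + 1" x]
          DERIV_power_Suc[OF DERIV_sin, of "2 * b + 1" x]]
      by (simp add: algebra_simps)
  qed simp
  then have 1: "((\<lambda>x. real (2 * b + 2) * (cos x ^ (2 * Suc a + 1) * sin x ^ (2 * b + 1))
      - real (2 * a + 2) * (cos x ^ (2 * a + 1) * sin x ^ (2 * Suc b + 1))) has_integral 0) {0..pi/2}"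
    by simp
  have "((\<lambda>x. real (2 * b + 2) * (cos x ^ (2 * Suc a + 1) * sin x ^ (2 * b + 1))) has_integral
      0 + real (2 * a + 2) * (fact a * fact (Suc b) / (2 * fact (a + Suc b + 1)))) {0..pi/2}"
    using has_integral_add[OF 1 has_integral_mult_right[OF Suc[of "Suc b"], of "real (2 * a + 2)"]] by simp
  from has_integral_mult_right[OF this, of "1 / real (2 * b + 2)"]
  have "((\<lambda>x. cos x ^ (2 * Suc a + 1) * sin x ^ (2 * b + 1)) has_integral
      1 / real (2 * b + 2) * (real (2 * a + 2) * (fact a * fact (Suc b) / (2 * fact (a + Suc b + 1))))) {0..pi/2}"
    by (simp add: mult.assoc[symmetric])
  also have "1 / real (2 * b + 2) * (real (2 * a + 2) * (fact a * fact (Suc b) / (2 * fact (a + Suc b + 1))))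
      = (fact (Suc a) * fact b / (2 * fact (Suc a + b + 1)) :: real)"
  proof -
    have "real (2 * b + 2) = 2 * (1 + real b)" "real (2 * a + 2) = 2 * (1 + real a)" by simp_all
    then show ?thesis by (simp add: divide_simps) (simp add: algebra_simps)
  qed
  finally show ?case .
qed

text \<open>Pascal's rule: a difference of order \<open>Suc d\<close> is a difference of order
  \<open>d\<close> of the first differences.\<close>

lemma alternating_sum_Suc:
  fixes f :: "nat \<Rightarrow> real"
  shows "(\<Sum>s\<le>Suc d. (- 1) ^ s * real (Suc d choose s) * f s)
       = (\<Sum>s\<le>d. (- 1) ^ s * real (d choose s) * (f s - f (Suc s)))"
proof -
  have "(\<Sum>s\<le>Suc d. (- 1) ^ s * real (Suc d choose s) * f s)
      = f 0 + (\<Sum>s\<le>d. (- 1) ^ Suc s * real (Suc d choose Suc s) * f (Suc s))"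
    by (subst sum.atMost_Suc_shift) simp
  also have "\<dots> = f 0 + (\<Sum>s\<le>d. (- 1) ^ Suc s * real (d choose Suc s) * f (Suc s))
      - (\<Sum>s\<le>d. (- 1) ^ s * real (d choose s) * f (Suc s))"
    by (simp add: sum.distrib[symmetric] sum_subtractf[symmetric] algebra_simps flip: sum_negf)
  also have "f 0 + (\<Sum>s\<le>d. (- 1) ^ Suc s * real (d choose Suc s) * f (Suc s))
      = (\<Sum>s\<le>Suc d. (- 1) ^ s * real (d choose s) * f s)"
    by (subst sum.atMost_Suc_shift) simp
  also have "\<dots> = (\<Sum>s\<le>d. (- 1) ^ s * real (d choose s) * f s)" by simp
  finally show ?thesis by (simp add: sum_subtractf right_diff_distrib)
qed

text \<open>A finite difference in the upper argument lowers the lower argument of a binomial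
  coefficient by 1; \<open>d\<close> of them lower \<open>j\<close> by \<open>d\<close> and give 0
  when \<open>j < d\<close>.\<close>

lemma alternating_binomial_sum:
  "(\<Sum>s\<le>d. (- 1) ^ s * real (d choose s) * real ((N + s) choose j))
     = (- 1) ^ d * (if d \<le> j then real (N choose (j - d)) else 0)"
proof (induction d arbitrary: N)
  case 0
  then show ?case by simp
next
  case (Suc d)
  have "(\<Sum>s\<le>Suc d. (- 1) ^ s * real (Suc d choose s) * real ((N + s) choose j))
      = (\<Sum>s\<le>d. (- 1) ^ s * real (d choose s) * real ((N + s) choose j))
        - (\<Sum>s\<le>d. (- 1) ^ s * real (d choose s) * real ((Suc N + s) choose j))"
    unfolding alternating_sum_Suc by (simp add: right_diff_distrib sum_subtractf)
  also have "\<dots> = (- 1) ^ d * (if d \<le> j then real (N choose (j - d)) else 0)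
      - (- 1) ^ d * (if d \<le> j then real (Suc N choose (j - d)) else 0)"
    unfolding Suc ..
  also have "\<dots> = (- 1) ^ Suc d * (if Suc d \<le> j then real (N choose (j - Suc d)) else 0)"
  proof (cases "Suc d \<le> j")
    case True
    then have "j - d = Suc (j - Suc d)" by simp
    then have "Suc N choose (j - d) = (N choose (j - Suc d)) + (N choose (j - d))" by simp
    with True show ?thesis by (simp add: algebra_simps)
  next
    case False
    then show ?thesis by (cases "d = j") auto
  qed
  finally show ?case .
qed

text \<open>The Jacobi polynomial \<open>P\<^sub>d\<close> with parameters \<open>(m, l)\<close>, in the variable \<open>sin\<^sup>2 x = (1 - cos 2x) / 2\<close>.\<close>

definition jacobi :: "nat \<Rightarrow> nat \<Rightarrow> nat \<Rightarrow> real poly" where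
  "jacobi l m d = (\<Sum>i\<le>d. smult (mode_coeff l m d i) ([:1, -1:] ^ i * [:0, 1:] ^ (d - i)))"

lemma jacobi_poly_eq: "jacobi_poly m l d (cos (2 * x)) = poly (jacobi l m d) ((sin x)\<^sup>2)"
  by (simp add: jacobi_cos_double jacobi_def poly_sum poly_power cos_squared_eq mult.assoc)

lemma degree_jacobi: "degree (jacobi l m d) \<le> d"
  unfolding jacobi_def
proof (rule degree_sum_le)
  fix i assume "i \<in> {..d}"
  then have "degree ([:1, -1:] ^ i * [:0, 1:] ^ (d - i) :: real poly) = d"
    by (simp add: degree_mult_eq degree_power_eq)
  then show "degree (smult (mode_coeff l m d i) ([:1, -1:] ^ i * [:0, 1:] ^ (d - i))) \<le> d"
    by (metis degree_smult_le)
qed simp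

text \<open>Each product \<open>(1 - t)^i t^(d-i)\<close> has leading coefficient
  \<open>(- 1)^i\<close>. With the sign in \<open>mode_coeff\<close> all terms acquire the common
  sign \<open>(- 1)^d\<close>, and Vandermonde's identity adds them up.\<close>

lemma coeff_jacobi: "coeff (jacobi l m d) d = (- 1) ^ d * real ((l + m + 2 * d) choose d)"
proof -
  have "coeff ([:1, -1:] ^ i * [:0, 1:] ^ (d - i) :: real poly) d = (- 1) ^ i" if "i \<le> d" for i
  proof -
    have "degree ([:1, -1:] ^ i * [:0, 1:] ^ (d - i) :: real poly) = d"
      using that by (simp add: degree_mult_eq degree_power_eq)
    then have "coeff ([:1, -1:] ^ i * [:0, 1:] ^ (d - i) :: real poly) d
        = lead_coeff ([:1, -1:] ^ i * [:0, 1:] ^ (d - i))" by simp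
    then show ?thesis by (simp add: lead_coeff_mult lead_coeff_power)
  qed
  then have "coeff (jacobi l m d) d = (\<Sum>i\<le>d. mode_coeff l m d i * (- 1) ^ i)"
    by (simp add: jacobi_def coeff_sum)
  also have "\<dots> = (\<Sum>i\<le>d. (- 1) ^ d * real (((m + d) choose i) * ((l + d) choose (d - i))))"
  proof (intro sum.cong refl)
    fix i assume "i \<in> {..d}"
    then have "(- 1) ^ (d - i) * (- 1) ^ i = ((- 1) ^ d :: real)" by (simp add: power_add[symmetric])
    then show "mode_coeff l m d i * (- 1) ^ i = (- 1) ^ d * real (((m + d) choose i) * ((l + d) choose (d - i)))"
      unfolding mode_coeff_def by (simp add: mult_ac)
  qed
  also have "\<dots> = (- 1) ^ d * real ((m + d + (l + d)) choose d)"
    unfolding vandermonde[symmetric] by (simp add: sum_distrib_left)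
  also have "m + d + (l + d) = l + m + 2 * d" by simp
  finally show ?thesis .
qed

text \<open>The squared prefactor \<open>cos^l sin^m\<close> of the radial function times the volume
  density.\<close>

definition radial_weight :: "nat \<Rightarrow> nat \<Rightarrow> real \<Rightarrow> real" where
  "radial_weight l m x = cos x ^ (2 * l + 1) * sin x ^ (2 * m + 1)"

text \<open>In factorials, the binomial coefficients and the Beta value combine to a constant times
  the summand of \<open>alternating_binomial_sum\<close>. \<open>N\<close> stands for the factorial
  in the denominator of the Beta value, which is the same for all \<open>i\<close>.\<close>

lemma moment_coefficient:
  fixes N :: real
  assumes d: "d = i + s" and N: "N \<noteq> 0"
  shows "real ((m + d) choose i) * real ((l + d) choose s) * (- 1) ^ s * (fact (l + i) * fact (m + j + s) / (2 * N))
    = fact (l + d) * fact (m + d) * fact j / (2 * fact d * N) *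
      ((- 1) ^ s * real (d choose s) * real ((m + j + s) choose j))"
proof -
  have b: "real ((m + d) choose i) = fact (m + d) / (fact i * fact (m + s))"
    "real ((l + d) choose s) = fact (l + d) / (fact s * fact (l + i))"
    "real (d choose s) = fact d / (fact s * fact i)"
    "real ((m + j + s) choose j) = fact (m + j + s) / (fact j * fact (m + s))"
    using binomial_fact[of i "m + d"] binomial_fact[of s "l + d"] binomial_fact[of s d]
      binomial_fact[of j "m + j + s"] by (simp_all add: d)
  show ?thesis
    unfolding b using N by (simp add: divide_simps)
qed

text \<open>The termwise Beta integrals form a finite difference of order \<open>d\<close> of a
  polynomial of degree \<open>j\<close>, which vanishes for \<open>j < d\<close>: the Jacobi
  polynomial is orthogonal to all lower powers of \<open>sin^2\<close>.\<close>

lemma jacobi_moment: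
  assumes "j \<le> d"
  shows "((\<lambda>x. radial_weight l m x * poly (jacobi l m d) ((sin x)\<^sup>2) * ((sin x)\<^sup>2) ^ j) has_integral
     (if j = d then (- 1) ^ d * fact (l + d) * fact (m + d) / (2 * fact (l + m + 2 * d + 1)) else 0)) {0..pi/2}"
proof -
  let ?K = "fact (l + d) * fact (m + d) * fact j / (2 * fact d * fact (l + m + d + j + 1)) :: real"
  have "((\<lambda>x. \<Sum>i\<le>d. mode_coeff l m d i * (cos x ^ (2 * (l + i) + 1) * sin x ^ (2 * (m + (d - i) + j) + 1))) has_integral
      (\<Sum>i\<le>d. mode_coeff l m d i *
        (fact (l + i) * fact (m + (d - i) + j) / (2 * fact (l + i + (m + (d - i) + j) + 1))))) {0..pi/2}"
    by (intro has_integral_sum has_integral_mult_right beta_integral) simp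
  moreover have "(\<Sum>i\<le>d. mode_coeff l m d i * (cos x ^ (2 * (l + i) + 1) * sin x ^ (2 * (m + (d - i) + j) + 1)))
      = radial_weight l m x * poly (jacobi l m d) ((sin x)\<^sup>2) * ((sin x)\<^sup>2) ^ j" for x
  proof -
    have "poly (jacobi l m d) ((sin x)\<^sup>2) = (\<Sum>i\<le>d. mode_coeff l m d i * ((cos x)\<^sup>2) ^ i * ((sin x)\<^sup>2) ^ (d - i))"
      unfolding jacobi_poly_eq[symmetric] jacobi_cos_double ..
    moreover have odd_power: "y ^ (2 * (a + b) + 1) = y ^ (2 * a + 1) * (y\<^sup>2) ^ b" for y :: real and a b
      by (simp add: power_add power_mult)
    ultimately show ?thesis
      unfolding odd_power radial_weight_def by (simp only: sum_distrib_left sum_distrib_right mult_ac)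
  qed
  moreover have "(\<Sum>i\<le>d. mode_coeff l m d i *
        (fact (l + i) * fact (m + (d - i) + j) / (2 * fact (l + i + (m + (d - i) + j) + 1))))
      = (\<Sum>i\<le>d. ?K * ((- 1) ^ (d - i) * real (d choose (d - i)) * real ((m + j + (d - i)) choose j)))"
  proof (intro sum.cong refl)
    fix i assume "i \<in> {..d}"
    then obtain s where d: "d = i + s" by (auto simp: le_iff_add)
    then have e: "d - i = s" "m + s + j = m + j + s" "l + i + (m + j + s) + 1 = l + m + d + j + 1"
      by auto
    show "mode_coeff l m d i *
        (fact (l + i) * fact (m + (d - i) + j) / (2 * fact (l + i + (m + (d - i) + j) + 1)))
      = ?K * ((- 1) ^ (d - i) * real (d choose (d - i)) * real ((m + j + (d - i)) choose j))"
      unfolding mode_coeff_def e by (rule moment_coefficient[OF d]) (rule fact_nonzero)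
  qed
  moreover have "(\<Sum>i\<le>d. ?K * ((- 1) ^ (d - i) * real (d choose (d - i)) * real ((m + j + (d - i)) choose j)))
      = ?K * (\<Sum>s\<le>d. (- 1) ^ s * real (d choose s) * real ((m + j + s) choose j))"
    unfolding sum_distrib_left
    by (rule sum.reindex_bij_witness[of _ "\<lambda>i. d - i" "\<lambda>i. d - i"]) auto
  moreover have "\<dots> = (if j = d then (- 1) ^ d * fact (l + d) * fact (m + d) / (2 * fact (l + m + 2 * d + 1)) else 0)"
  proof (cases "j = d")
    case True
    have "(l + m + d + d + 1) = l + m + 2 * d + 1" by simp
    with True show ?thesis unfolding alternating_binomial_sum by (simp only:) simp
  qed (use assms in \<open>simp add: alternating_binomial_sum\<close>)
  ultimately show ?thesis by (simp only:)
qed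

text \<open>One of the two factors is expanded in powers of \<open>sin^2\<close>. Only the power
  \<open>d\<close> survives, so the norm is the leading coefficient times the top moment.\<close>

lemma jacobi_norm:
  "((\<lambda>x. radial_weight l m x * (poly (jacobi l m d) ((sin x)\<^sup>2))\<^sup>2) has_integral
     fact (l + d) * fact (m + d) / (2 * (real (l + m + 2 * d) + 1) * fact d * fact (l + m + d))) {0..pi/2}"
proof -
  let ?J = "jacobi l m d"
  have "((\<lambda>x. \<Sum>j\<le>d. coeff ?J j * (radial_weight l m x * poly ?J ((sin x)\<^sup>2) * ((sin x)\<^sup>2) ^ j)) has_integral
      (\<Sum>j\<le>d. coeff ?J j *
        (if j = d then (- 1) ^ d * fact (l + d) * fact (m + d) / (2 * fact (l + m + 2 * d + 1)) else 0))) {0..pi/2}"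
    by (intro has_integral_sum has_integral_mult_right jacobi_moment) auto
  moreover have "(\<Sum>j\<le>d. coeff ?J j * (radial_weight l m x * poly ?J ((sin x)\<^sup>2) * ((sin x)\<^sup>2) ^ j))
      = radial_weight l m x * (poly ?J ((sin x)\<^sup>2))\<^sup>2" for x
  proof -
    have "poly ?J ((sin x)\<^sup>2) = (\<Sum>j\<le>d. coeff ?J j * ((sin x)\<^sup>2) ^ j)"
      unfolding poly_altdef using degree_jacobi[of l m d]
      by (intro sum.mono_neutral_left) (auto simp: coeff_eq_0)
    then have "radial_weight l m x * poly ?J ((sin x)\<^sup>2) * poly ?J ((sin x)\<^sup>2)
        = radial_weight l m x * poly ?J ((sin x)\<^sup>2) * (\<Sum>j\<le>d. coeff ?J j * ((sin x)\<^sup>2) ^ j)" by simp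
    then show ?thesis by (simp add: sum_distrib_left power2_eq_square mult_ac)
  qed
  moreover have "(\<Sum>j\<le>d. coeff ?J j *
        (if j = d then (- 1) ^ d * fact (l + d) * fact (m + d) / (2 * fact (l + m + 2 * d + 1)) else 0))
      = fact (l + d) * fact (m + d) / (2 * (real (l + m + 2 * d) + 1) * fact d * fact (l + m + d))"
  proof -
    have "real ((l + m + 2 * d) choose d) = fact (l + m + 2 * d) / (fact d * fact (l + m + d))"
    proof -
      have "l + m + 2 * d - d = l + m + d" by simp
      then show ?thesis using binomial_fact[of d "l + m + 2 * d"] by (simp only:) simp
    qed
    moreover have "fact (l + m + 2 * d + 1) = (real (l + m + 2 * d) + 1) * fact (l + m + 2 * d)" by simp
    moreover have "(- 1) ^ d * (- 1) ^ d = (1::real)" by (simp flip: power_mult_distrib)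
    ultimately show ?thesis
      by (simp add: coeff_jacobi if_distrib[of "(*) _"] sum.delta del: fact_Suc cong: if_cong)
  qed
  ultimately show ?thesis by simp
qed


section \<open>Orthonormality and completeness of the modes\<close>

lemma integral_cos_multiple:
  "((\<lambda>t. cos (of_int n * t)) has_integral (if n = 0 then 2 * pi else 0)) {0..2*pi}"
proof (cases "n = 0")
  case True
  then show ?thesis using has_integral_const_real[of "1::real" 0 "2 * pi"] by simp
next
  case False
  have "((\<lambda>t. cos (of_int n * t)) has_integral
      sin (of_int n * (2 * pi)) / of_int n - sin (of_int n * 0) / of_int n) {0..2*pi}"
  proof (rule has_integral_real_derivative)
    fix t :: real
    show "((\<lambda>t. sin (of_int n * t) / of_int n) has_real_derivative cos (of_int n * t)) (at t)"
      using False by (auto intro!: derivative_eq_intros)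
  qed simp
  moreover have "sin (of_int n * (2 * pi)) = 0"
    by (metis mult.assoc mult.commute sin_int_2pin)
  ultimately show ?thesis using False by simp
qed

lemma integral_sin_multiple:
  "((\<lambda>t. sin (of_int n * t)) has_integral 0) {0..2*pi}"
proof (cases "n = 0")
  case True
  then show ?thesis by simp
next
  case False
  have "((\<lambda>t. sin (of_int n * t)) has_integral
      (- cos (of_int n * (2 * pi)) / of_int n) - (- cos (of_int n * 0) / of_int n)) {0..2*pi}"
  proof (rule has_integral_real_derivative)
    fix t :: real
    show "((\<lambda>t. - cos (of_int n * t) / of_int n) has_real_derivative sin (of_int n * t)) (at t)"
      using False by (auto intro!: derivative_eq_intros)
  qed simp
  moreover have "cos (of_int n * (2 * pi)) = 1"
    by (metis mult.assoc mult.commute cos_int_2pin)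
  ultimately show ?thesis by simp
qed

lemma mode_angular_orthogonal:
  "((\<lambda>t. mode_angular l t * mode_angular l' t) has_integral
      (if l = l' then (if l = 0 then 2 * pi else pi) else 0)) {0..2*pi}"
proof -
  define a b where "a = \<bar>l\<bar>" and "b = \<bar>l'\<bar>"
  have ab: "a \<ge> 0" "b \<ge> 0" by (simp_all add: a_def b_def)
  note C = integral_cos_multiple[of "a - b"] integral_cos_multiple[of "a + b"]
  note S = integral_sin_multiple[of "a - b"] integral_sin_multiple[of "a + b"]
  note half = has_integral_mult_right[of _ _ _ "1/2 :: real"]
  consider "l \<ge> 0" "l' \<ge> 0" | "l \<ge> 0" "l' < 0" | "l < 0" "l' \<ge> 0" | "l < 0" "l' < 0" by linarith
  then show ?thesis
  proof cases
    case 1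
    have "((\<lambda>t. 1/2 * (cos (of_int (a - b) * t) + cos (of_int (a + b) * t))) has_integral
        1/2 * ((if a - b = 0 then 2 * pi else 0) + (if a + b = 0 then 2 * pi else 0))) {0..2*pi}"
      by (intro half has_integral_add C)
    moreover have "1/2 * (cos (of_int (a - b) * t) + cos (of_int (a + b) * t)) = mode_angular l t * mode_angular l' t" for t
    proof -
      have "mode_angular l t = cos (of_int a * t)" "mode_angular l' t = cos (of_int b * t)"
        using 1 by (simp_all add: mode_angular_def a_def b_def)
      then show ?thesis
        by (simp only: cos_times_cos of_int_add of_int_diff left_diff_distrib distrib_right; simp)
    qed
    moreover have "1/2 * ((if a - b = 0 then 2 * pi else 0) + (if a + b = 0 then 2 * pi else 0))
        = (if l = l' then (if l = 0 then 2 * pi else pi) else 0)"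
      using 1 by (auto simp: a_def b_def)
    ultimately show ?thesis by simp
  next
    case 2
    have "((\<lambda>t. 1/2 * (sin (of_int (a + b) * t) - sin (of_int (a - b) * t))) has_integral
        1/2 * (0 - 0)) {0..2*pi}"
      by (intro half has_integral_diff S)
    moreover have "1/2 * (sin (of_int (a + b) * t) - sin (of_int (a - b) * t)) = mode_angular l t * mode_angular l' t" for t
    proof -
      have "mode_angular l t = cos (of_int a * t)" "mode_angular l' t = sin (of_int b * t)"
        using 2 by (simp_all add: mode_angular_def a_def b_def)
      then show ?thesis
        by (simp only: cos_times_sin of_int_add of_int_diff left_diff_distrib distrib_right; simp)
    qed
    ultimately show ?thesis using 2 by simp
  next
    case 3
    have "((\<lambda>t. 1/2 * (sin (of_int (a + b) * t) + sin (of_int (a - b) * t))) has_integral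
        1/2 * (0 + 0)) {0..2*pi}"
      by (intro half has_integral_add S)
    moreover have "1/2 * (sin (of_int (a + b) * t) + sin (of_int (a - b) * t)) = mode_angular l t * mode_angular l' t" for t
    proof -
      have "mode_angular l t = sin (of_int a * t)" "mode_angular l' t = cos (of_int b * t)"
        using 3 by (simp_all add: mode_angular_def a_def b_def)
      then show ?thesis
        by (simp only: sin_times_cos of_int_add of_int_diff left_diff_distrib distrib_right; simp)
    qed
    ultimately show ?thesis using 3 by simp
  next
    case 4
    have "((\<lambda>t. 1/2 * (cos (of_int (a - b) * t) - cos (of_int (a + b) * t))) has_integral
        1/2 * ((if a - b = 0 then 2 * pi else 0) - (if a + b = 0 then 2 * pi else 0))) {0..2*pi}"
      by (intro half has_integral_diff C)
    moreover have "1/2 * (cos (of_int (a - b) * t) - cos (of_int (a + b) * t)) = mode_angular l t * mode_angular l' t" for t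
    proof -
      have "mode_angular l t = sin (of_int a * t)" "mode_angular l' t = sin (of_int b * t)"
        using 4 by (simp_all add: mode_angular_def a_def b_def)
      then show ?thesis
        by (simp only: sin_times_sin of_int_add of_int_diff left_diff_distrib distrib_right; simp)
    qed
    moreover have "1/2 * ((if a - b = 0 then 2 * pi else 0) - (if a + b = 0 then 2 * pi else 0))
        = (if l = l' then (if l = 0 then 2 * pi else pi) else 0)"
      using 4 by (auto simp: a_def b_def)
    ultimately show ?thesis by simp
  qed
qed

lemma mode_radial_norm:
  assumes "mode_exists k l m"
  shows "((\<lambda>x. (mode_radial k l m x)\<^sup>2 * (cos x * sin x)) has_integral
    (let a = nat \<bar>l\<bar>; b = nat \<bar>m\<bar>; d = mode_degree k l m in
      fact (a + d) * fact (b + d) / (2 * (real k + 1) * fact d * fact (a + b + d)))) {0..pi/2}"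
proof -
  define a b d where "a = nat \<bar>l\<bar>" and "b = nat \<bar>m\<bar>" and "d = mode_degree k l m"
  have k: "real (a + b + 2 * d) = real k"
    using mode_degree_eq[OF assms] by (simp only: a_def b_def d_def)
  have "radial_weight a b x * (poly (jacobi a b d) ((sin x)\<^sup>2))\<^sup>2 = (mode_radial k l m x)\<^sup>2 * (cos x * sin x)" for x
  proof -
    have "y ^ (2 * n + 1) = y ^ n * y ^ n * y" for y :: real and n
      by (simp add: power_add[symmetric] mult_2)
    then show ?thesis
      unfolding mode_radial_def a_def[symmetric] b_def[symmetric] d_def[symmetric] jacobi_poly_eq radial_weight_def
      by (simp only: power_mult_distrib power2_eq_square mult_ac)
  qed
  with jacobi_norm[of a b d] show ?thesis
    unfolding k Let_def a_def[symmetric] b_def[symmetric] d_def[symmetric] by simp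
qed

text \<open>Different angular indices are separated by the angular integrals. With equal indices and
  equal \<open>k\<close> the degree \<open>d\<close> is the same too, so the radial integral that
  remains is a norm.\<close>

lemma mode_orthonormal:
  assumes "mode_exists k l m"
  shows "inner_S3 (\<Psi> k l m) (\<Psi> k l' m') = (if l = l' \<and> m = m' then 1 else 0)"
proof -
  let ?N = "mode_norm k l m * mode_norm k l' m'"
  define R where "R x = mode_radial k l m x * mode_radial k l' m' x * (cos x * sin x) / ?N" for x
  define A where "A l l' = (if l = l' then (if l = 0 then 2 * pi else pi) else 0)" for l l' :: int
  have A: "integral {0..2*pi} (\<lambda>t. mode_angular l t * mode_angular l' t) = A l l'" for l l'
    unfolding A_def by (rule integral_unique[OF mode_angular_orthogonal])
  have "inner_S3 (\<Psi> k l m) (\<Psi> k l' m') = integral {0..pi/2} (\<lambda>\<xi>. integral {0..2*pi} (\<lambda>\<theta>. integral {0..2*pi}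
      (\<lambda>\<phi>. \<Psi> k l m (toroidal \<xi> \<theta> \<phi>) * \<Psi> k l' m' (toroidal \<xi> \<theta> \<phi>) * (cos \<xi> * sin \<xi>))))"
    unfolding inner_S3_def by (rule integral_S3_iterated) (intro continuous_on_mult mode_continuous)
  also have "\<dots> = integral {0..pi/2} (\<lambda>\<xi>. R \<xi> * (A l l' * A m m'))"
  proof (rule Henstock_Kurzweil_Integration.integral_cong)
    fix \<xi> :: real assume \<xi>: "\<xi> \<in> {0..pi/2}"
    have eq: "\<Psi> k l m (toroidal \<xi> \<theta> \<phi>) * \<Psi> k l' m' (toroidal \<xi> \<theta> \<phi>) * (cos \<xi> * sin \<xi>)
        = (R \<xi> * (mode_angular l \<theta> * mode_angular l' \<theta>)) * (mode_angular m \<phi> * mode_angular m' \<phi>)" for \<theta> \<phi>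
      unfolding mode_toroidal[OF \<xi>] mode_raw_def R_def by (simp add: field_simps)
    show "integral {0..2*pi} (\<lambda>\<theta>. integral {0..2*pi}
      (\<lambda>\<phi>. \<Psi> k l m (toroidal \<xi> \<theta> \<phi>) * \<Psi> k l' m' (toroidal \<xi> \<theta> \<phi>) * (cos \<xi> * sin \<xi>))) = R \<xi> * (A l l' * A m m')"
      unfolding eq integral_mult_right integral_mult_left A by simp
  qed
  also have "\<dots> = integral {0..pi/2} R * (A l l' * A m m')"
    by (rule integral_mult_left)
  also have "\<dots> = (if l = l' \<and> m = m' then 1 else 0)"
  proof (cases "l = l' \<and> m = m'")
    case False
    then show ?thesis by (auto simp: A_def)
  next
    case True
    define I where "I = (let a = nat \<bar>l\<bar>; b = nat \<bar>m\<bar>; d = mode_degree k l m in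
      fact (a + d) * fact (b + d) / (2 * (real k + 1) * fact d * fact (a + b + d)) :: real)"
    have I: "I > 0" by (simp add: I_def Let_def)
    \<comment> \<open>The power of 2 accounts for the indices equal to 0, where the angular integral
      is \<open>2 * pi\<close> instead of \<open>pi\<close>.\<close>
    have N: "mode_norm k l m * mode_norm k l m = 2 ^ ((if l = 0 then 1 else 0) + (if m = 0 then 1 else 0)) * (pi * pi) * I"
    proof -
      have "mode_norm k l m = sqrt (2 ^ ((if l = 0 then 1 else 0) + (if m = 0 then 1 else 0))) * pi * sqrt I"
        by (simp add: mode_norm_def I_def Let_def)
      then have "mode_norm k l m * mode_norm k l m =
          (sqrt (2 ^ ((if l = 0 then 1 else 0) + (if m = 0 then 1 else 0)))
           * sqrt (2 ^ ((if l = 0 then 1 else 0) + (if m = 0 then 1 else 0)))) * (pi * pi) * (sqrt I * sqrt I)"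
        by (simp only: mult_ac)
      then show ?thesis using I by (simp only: real_sqrt_mult_self) simp
    qed
    have R: "R = (\<lambda>x. (1 / (mode_norm k l m * mode_norm k l m)) * ((mode_radial k l m x)\<^sup>2 * (cos x * sin x)))"
      using True by (simp add: R_def power2_eq_square fun_eq_iff)
    have "integral {0..pi/2} R = (1 / (mode_norm k l m * mode_norm k l m)) * I"
      unfolding R integral_mult_right I_def integral_unique[OF mode_radial_norm[OF assms]] ..
    then show ?thesis
      using True I unfolding N by (simp add: A_def)
  qed
  finally show ?thesis .
qed

text \<open>A mode with its Jacobi polynomial replaced by an arbitrary polynomial in
  \<open>sin^2\<close>; these functions mediate between modes and monomials.\<close>

definition torus_fn :: "int \<Rightarrow> int \<Rightarrow> real poly \<Rightarrow> real^4 \<Rightarrow> real" where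
  "torus_fn l m q p = plane_power (l \<ge> 0) 1 2 (nat \<bar>l\<bar>) p * plane_power (m \<ge> 0) 3 4 (nat \<bar>m\<bar>) p * poly q (plane_sq 3 4 p)"

lemma toroidal_nth:
  "toroidal \<xi> \<theta> \<phi> $ 1 = cos \<xi> * cos \<theta>" "toroidal \<xi> \<theta> \<phi> $ 2 = cos \<xi> * sin \<theta>"
  "toroidal \<xi> \<theta> \<phi> $ 3 = sin \<xi> * cos \<phi>" "toroidal \<xi> \<theta> \<phi> $ 4 = sin \<xi> * sin \<phi>"
  by (simp_all add: toroidal_def vector_4)

lemma torus_fn_toroidal:
  "torus_fn l m q (toroidal \<xi> \<theta> \<phi>) = cos \<xi> ^ nat \<bar>l\<bar> * sin \<xi> ^ nat \<bar>m\<bar> * poly q ((sin \<xi>)\<^sup>2)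
     * mode_angular l \<theta> * mode_angular m \<phi>"
proof -
  have "plane_sq 3 4 (toroidal \<xi> \<theta> \<phi>) = (sin \<xi>)\<^sup>2"
    by (simp add: plane_sq_def toroidal_nth power_mult_distrib distrib_left[symmetric])
  then show ?thesis
    by (simp add: torus_fn_def plane_power_polar[OF toroidal_nth(1,2)] plane_power_polar[OF toroidal_nth(3,4)]
        mode_angular_def)
qed

lemma continuous_torus_fn: "continuous_on X (torus_fn l m q)"
proof -
  have "continuous_on X (plane_power s a b l)" for s l and a b :: 4
    using real_polynomial_plane_power by (intro continuous_on_polymonial_function) (simp add: real_polynomial_function_eq)
  then show ?thesis
    unfolding torus_fn_def[abs_def] plane_sq_def by (intro continuous_intros)
qed

text \<open>A sequence with one polynomial of each exact degree spans: subtracting a multiple of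
  \<open>J n\<close> removes the coefficient of degree \<open>n\<close>.\<close>

lemma graded_poly_induct:
  fixes P :: "real poly \<Rightarrow> bool" and J :: "nat \<Rightarrow> real poly"
  assumes zero: "P 0" and comb: "\<And>p q c. P p \<Longrightarrow> P q \<Longrightarrow> P (p + smult c q)"
    and J: "\<And>d. P (J d)" "\<And>d. degree (J d) \<le> d" "\<And>d. coeff (J d) d \<noteq> 0"
  shows "P q"
proof -
  have "P q" if "\<forall>i\<ge>n. coeff q i = 0" for n q
    using that
  proof (induction n arbitrary: q)
    case 0
    then have "q = 0" by (simp add: poly_eq_iff)
    then show ?case using zero by simp
  next
    case (Suc n)
    define c where "c = coeff q n / coeff (J n) n"
    have "P (q - smult c (J n))"
    proof (rule Suc.IH, intro allI impI)
      fix i assume i: "n \<le> i"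
      show "coeff (q - smult c (J n)) i = 0"
      proof (cases "i = n")
        case True
        then show ?thesis using J(3)[of n] by (simp add: c_def)
      next
        case False
        with i have "coeff q i = 0" "degree (J n) < i"
          using Suc.prems J(2)[of n] by auto
        then show ?thesis by (simp add: coeff_eq_0)
      qed
    qed
    from comb[OF this J(1), of c n] show ?case by simp
  qed
  from this[of "Suc (degree q)"] show ?thesis by (simp add: coeff_eq_0)
qed

text \<open>For fixed \<open>l\<close> and \<open>m\<close> the modes of the wave numbers
  \<open>\<bar>l\<bar> + \<bar>m\<bar> + 2 * d\<close> run through Jacobi polynomials of every
  degree \<open>d\<close>, hence span all radial polynomials.\<close>

lemma orthogonal_torus_fn:
  assumes h: "continuous_on S3 h" and orth: "\<And>k l m. mode_exists k l m \<Longrightarrow> inner_S3 h (\<Psi> k l m) = 0"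
  shows "inner_S3 h (torus_fn l m q) = 0"
proof (rule graded_poly_induct[where P = "\<lambda>q. inner_S3 h (torus_fn l m q) = 0"
      and J = "jacobi (nat \<bar>l\<bar>) (nat \<bar>m\<bar>)"])
  show "inner_S3 h (torus_fn l m 0) = 0"
    by (simp add: torus_fn_def[abs_def] inner_S3_zero)
next
  fix p q c assume "inner_S3 h (torus_fn l m p) = 0" "inner_S3 h (torus_fn l m q) = 0"
  moreover have "torus_fn l m (p + smult c q) = (\<lambda>x. torus_fn l m p x + c * torus_fn l m q x)"
    by (simp add: torus_fn_def fun_eq_iff algebra_simps)
  ultimately show "inner_S3 h (torus_fn l m (p + smult c q)) = 0"
    by (simp add: inner_S3_linear h continuous_torus_fn)
next
  fix d
  define k where "k = nat \<bar>l\<bar> + nat \<bar>m\<bar> + 2 * d"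
  have ex: "mode_exists k l m"
    by (auto simp: mode_exists_def k_def cong_iff_dvd_diff)
  have d: "mode_degree k l m = d" by (simp add: mode_degree_def k_def)
  have "torus_fn l m (jacobi (nat \<bar>l\<bar>) (nat \<bar>m\<bar>) d) p = mode_norm k l m * \<Psi> k l m p" if p: "p \<in> S3" for p
  proof -
    obtain \<xi> \<theta> \<phi> where p: "p = toroidal \<xi> \<theta> \<phi>" "\<xi> \<in> {0..pi/2}" using S3_toroidalE[OF p] .
    show ?thesis
      using mode_norm_pos[of k l m] unfolding p(1) mode_toroidal[OF p(2)] torus_fn_toroidal mode_raw_def mode_radial_def d
      by (simp add: jacobi_poly_eq)
  qed
  then have "inner_S3 h (torus_fn l m (jacobi (nat \<bar>l\<bar>) (nat \<bar>m\<bar>) d)) = inner_S3 h (\<lambda>p. mode_norm k l m * \<Psi> k l m p)"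
    by (intro inner_S3_cong) simp
  also have "\<dots> = 0"
    by (simp add: inner_S3_linear h mode_continuous orth[OF ex])
  finally show "inner_S3 h (torus_fn l m (jacobi (nat \<bar>l\<bar>) (nat \<bar>m\<bar>) d)) = 0" .
qed (simp_all add: degree_jacobi coeff_jacobi)

text \<open>With \<open>z\<close> and \<open>w\<close> the two complex coordinates this is
  \<open>z^a * cnj z^b * w^c * cnj w^e\<close>. Multiplication by \<open>z\<close>, \<open>w\<close>
  or a conjugate only shifts exponents, and on each torus the monomial is a multiple of a single
  character.\<close>

definition complex_monomial :: "nat \<Rightarrow> nat \<Rightarrow> nat \<Rightarrow> nat \<Rightarrow> real^4 \<Rightarrow> complex" where
  "complex_monomial a b c e p = Complex (p $ 1) (p $ 2) ^ a * cnj (Complex (p $ 1) (p $ 2)) ^ b *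
     Complex (p $ 3) (p $ 4) ^ c * cnj (Complex (p $ 3) (p $ 4)) ^ e"

lemma complex_monomial_toroidal:
  "complex_monomial a b c e (toroidal \<xi> \<theta> \<phi>) =
     of_real (cos \<xi> ^ (a + b) * sin \<xi> ^ (c + e)) * cis (of_int (int a - int b) * \<theta> + of_int (int c - int e) * \<phi>)"
proof -
  have C: "Complex (r * cos t) (r * sin t) = of_real r * cis t" for r t
    by (simp add: complex_eq_iff)
  have "complex_monomial a b c e (toroidal \<xi> \<theta> \<phi>) =
     of_real (cos \<xi> ^ (a + b) * sin \<xi> ^ (c + e)) * (cis \<theta> ^ a * cis (- \<theta>) ^ b * cis \<phi> ^ c * cis (- \<phi>) ^ e)"
    unfolding complex_monomial_def toroidal_nth C complex_cnj_mult complex_cnj_complex_of_real cis_cnj power_mult_distrib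
    by (simp add: power_add mult_ac)
  also have "cis \<theta> ^ a * cis (- \<theta>) ^ b * cis \<phi> ^ c * cis (- \<phi>) ^ e
      = cis (of_int (int a - int b) * \<theta> + of_int (int c - int e) * \<phi>)"
    unfolding Complex.DeMoivre cis_mult by (rule arg_cong[where f = cis]) (simp add: algebra_simps)
  finally show ?thesis .
qed

text \<open>The factor \<open>sgn n\<close> makes the second formula right at \<open>n = 0\<close>:
  there \<open>- \<bar>n\<bar> = 0\<close> selects the constant cosine instead of a sine.\<close>

lemma mode_angular_abs:
  "cos (of_int n * t) = mode_angular \<bar>n\<bar> t" "sin (of_int n * t) = of_int (sgn n) * mode_angular (- \<bar>n\<bar>) t"
  by (auto simp: mode_angular_def abs_if sgn_if)

text \<open>The matched factors \<open>z * cnj z\<close> and \<open>w * cnj w\<close> are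
  \<open>1 - sin^2\<close> and \<open>sin^2\<close> and go into \<open>q\<close>; the excess
  exponents are the frequencies.\<close>

lemma complex_monomial_torus_fn:
  fixes a b c e :: nat
  defines "l \<equiv> int a - int b" and "m \<equiv> int c - int e"
  defines "q \<equiv> [:1, -1:] ^ min a b * [:0, 1:] ^ min c e"
  assumes p: "p \<in> S3"
  shows "Re (complex_monomial a b c e p) = torus_fn \<bar>l\<bar> \<bar>m\<bar> q p + (- of_int (sgn l * sgn m)) * torus_fn (- \<bar>l\<bar>) (- \<bar>m\<bar>) q p" (is ?A)
    "Im (complex_monomial a b c e p) = of_int (sgn l) * torus_fn (- \<bar>l\<bar>) \<bar>m\<bar> q p + of_int (sgn m) * torus_fn \<bar>l\<bar> (- \<bar>m\<bar>) q p" (is ?B)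
proof -
  obtain \<xi> \<theta> \<phi> where p: "p = toroidal \<xi> \<theta> \<phi>"
    using S3_toroidal[OF p] by auto
  have ab: "a + b = nat \<bar>l\<bar> + 2 * min a b" "c + e = nat \<bar>m\<bar> + 2 * min c e"
    unfolding l_def m_def by linarith+
  have P: "cos \<xi> ^ (a + b) * sin \<xi> ^ (c + e) = cos \<xi> ^ nat \<bar>l\<bar> * sin \<xi> ^ nat \<bar>m\<bar> * poly q ((sin \<xi>)\<^sup>2)"
    unfolding ab by (simp add: q_def power_add power_mult cos_squared_eq mult_ac)
  have cis: "Re (of_real r * cis t) = r * cos t" "Im (of_real r * cis t) = r * sin t" for r t
    by simp_all
  show ?A ?B
    unfolding p complex_monomial_toroidal l_def[symmetric] m_def[symmetric] P torus_fn_toroidal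
      cis cos_add sin_add mode_angular_abs
    by (simp_all add: algebra_simps)
qed

inductive trig_polynomial :: "(real^4 \<Rightarrow> real) \<Rightarrow> bool" where
  Re: "trig_polynomial (\<lambda>p. Re (complex_monomial a b c e p))"
| Im: "trig_polynomial (\<lambda>p. Im (complex_monomial a b c e p))"
| add: "trig_polynomial f \<Longrightarrow> trig_polynomial g \<Longrightarrow> trig_polynomial (\<lambda>p. f p + r * g p)"

lemma trig_polynomial_zero: "trig_polynomial (\<lambda>p. 0)"
  using trig_polynomial.Im[of 0 0 0 0] by (simp add: complex_monomial_def)

lemma trig_polynomial_cmult: "trig_polynomial f \<Longrightarrow> trig_polynomial (\<lambda>p. r * f p)"
  using trig_polynomial.add[OF trig_polynomial_zero, of f r] by simp

lemma complex_monomial_Suc: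
  "complex_monomial (Suc a) b c e p = Complex (p $ 1) (p $ 2) * complex_monomial a b c e p"
  "complex_monomial a (Suc b) c e p = cnj (Complex (p $ 1) (p $ 2)) * complex_monomial a b c e p"
  "complex_monomial a b (Suc c) e p = Complex (p $ 3) (p $ 4) * complex_monomial a b c e p"
  "complex_monomial a b c (Suc e) p = cnj (Complex (p $ 3) (p $ 4)) * complex_monomial a b c e p"
  by (simp_all add: complex_monomial_def)

text \<open>A coordinate is \<open>x = (z + cnj z) / 2\<close> or
  \<open>y = (z - cnj z) / (2 \<i>)\<close>; the second exchanges real and imaginary parts.\<close>

lemma trig_polynomial_nth:
  assumes "trig_polynomial f"
  shows "trig_polynomial (\<lambda>p. p $ i * f p)"
  using assms
proof induction
  case (add f g r)
  from trig_polynomial.add[OF add.IH, of r] show ?case by (simp add: algebra_simps)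
next
  case (Re a b c e)
  let ?Z = complex_monomial
  have "x * Re z = 1/2 * Re (Complex x y * z) + 1/2 * Re (cnj (Complex x y) * z)"
    "y * Re z = 1/2 * Im (Complex x y * z) + (- 1/2) * Im (cnj (Complex x y) * z)" for x y z
    by (simp_all add: algebra_simps)
  note * = this
  have "(\<lambda>p. p $ 1 * Re (?Z a b c e p)) = (\<lambda>p. 1/2 * Re (?Z (Suc a) b c e p) + 1/2 * Re (?Z a (Suc b) c e p))"
    "(\<lambda>p. p $ 2 * Re (?Z a b c e p)) = (\<lambda>p. 1/2 * Im (?Z (Suc a) b c e p) + (- 1/2) * Im (?Z a (Suc b) c e p))"
    "(\<lambda>p. p $ 3 * Re (?Z a b c e p)) = (\<lambda>p. 1/2 * Re (?Z a b (Suc c) e p) + 1/2 * Re (?Z a b c (Suc e) p))"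
    "(\<lambda>p. p $ 4 * Re (?Z a b c e p)) = (\<lambda>p. 1/2 * Im (?Z a b (Suc c) e p) + (- 1/2) * Im (?Z a b c (Suc e) p))"
    unfolding complex_monomial_Suc by (rule ext, rule *)+
  then have "\<forall>i. trig_polynomial (\<lambda>p. p $ i * Re (?Z a b c e p))"
    unfolding forall_4 by (simp only:) (intro conjI trig_polynomial.intros trig_polynomial_cmult)
  then show ?case ..
next
  case (Im a b c e)
  let ?Z = complex_monomial
  have "x * Im z = 1/2 * Im (Complex x y * z) + 1/2 * Im (cnj (Complex x y) * z)"
    "y * Im z = (- 1/2) * Re (Complex x y * z) + 1/2 * Re (cnj (Complex x y) * z)" for x y z
    by (simp_all add: algebra_simps)
  note * = this
  have "(\<lambda>p. p $ 1 * Im (?Z a b c e p)) = (\<lambda>p. 1/2 * Im (?Z (Suc a) b c e p) + 1/2 * Im (?Z a (Suc b) c e p))"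
    "(\<lambda>p. p $ 2 * Im (?Z a b c e p)) = (\<lambda>p. (- 1/2) * Re (?Z (Suc a) b c e p) + 1/2 * Re (?Z a (Suc b) c e p))"
    "(\<lambda>p. p $ 3 * Im (?Z a b c e p)) = (\<lambda>p. 1/2 * Im (?Z a b (Suc c) e p) + 1/2 * Im (?Z a b c (Suc e) p))"
    "(\<lambda>p. p $ 4 * Im (?Z a b c e p)) = (\<lambda>p. (- 1/2) * Re (?Z a b (Suc c) e p) + 1/2 * Re (?Z a b c (Suc e) p))"
    unfolding complex_monomial_Suc by (rule ext, rule *)+
  then have "\<forall>i. trig_polynomial (\<lambda>p. p $ i * Im (?Z a b c e p))"
    unfolding forall_4 by (simp only:) (intro conjI trig_polynomial.intros trig_polynomial_cmult)
  then show ?case ..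
qed

text \<open>\<open>g\<close> is arbitrary in the induction on \<open>F\<close>, so a product
  \<open>f * f'\<close> acts by acting twice. Applied to the constant 1 this puts every polynomial
  into the span.\<close>

lemma trig_polynomial_mult:
  assumes "real_polynomial_function F" "trig_polynomial g"
  shows "trig_polynomial (\<lambda>p. F p * g p)"
  using assms
proof (induction arbitrary: g)
  case (linear f)
  have "f p * g p = (\<Sum>i\<in>UNIV. f (axis i 1) * (p $ i * g p))" for p
    using linear_axis_expansion[OF bounded_linear.linear[OF linear(1)], of p]
    by (simp add: sum_distrib_left sum_distrib_right mult_ac)
  moreover have "trig_polynomial (\<lambda>p. \<Sum>i\<in>I. f (axis i 1) * (p $ i * g p))" if "finite I" for I
    using that
  proof induction
    case (insert i I)
    from trig_polynomial.add[OF insert.IH trig_polynomial_nth[OF linear(2), of i], of "f (axis i 1)"]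
    show ?case using insert.hyps by (simp add: add.commute)
  qed (simp add: trig_polynomial_zero)
  ultimately show ?case by simp
next
  case (add f f')
  from trig_polynomial.add[OF add.IH(1)[OF add.prems] add.IH(2)[OF add.prems], of 1]
  show ?case by (simp add: distrib_right)
next
  case (mult f f')
  from mult.IH(1)[OF mult.IH(2)[OF mult.prems]] show ?case by (simp add: mult.assoc)
qed (simp add: trig_polynomial_cmult)

lemma real_polynomial_imp_trig: "real_polynomial_function F \<Longrightarrow> trig_polynomial F"
  using trig_polynomial_mult[OF _ trig_polynomial.Re[of 0 0 0 0], of F] by (simp add: complex_monomial_def)

lemma integral_S3_bound:
  assumes g: "continuous_on S3 g" and B: "\<And>p. p \<in> S3 \<Longrightarrow> \<bar>g p\<bar> \<le> B" and "B \<ge> 0"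
  shows "\<bar>integral_S3 g\<bar> \<le> B * measure lborel (cbox (0, 0, 0) (pi/2, 2*pi, 2*pi))"
proof -
  have "norm (integral (cbox (0, 0, 0) (pi/2, 2*pi, 2*pi)) (\<lambda>(\<xi>, \<theta>, \<phi>). g (toroidal \<xi> \<theta> \<phi>) * (cos \<xi> * sin \<xi>)))
      \<le> B * measure lborel (cbox (0, 0, 0) (pi/2, 2*pi, 2*pi))"
  proof (rule integrable_bound[OF \<open>B \<ge> 0\<close>])
    show "(\<lambda>(\<xi>, \<theta>, \<phi>). g (toroidal \<xi> \<theta> \<phi>) * (cos \<xi> * sin \<xi>))
        integrable_on cbox (0, 0, 0) (pi/2, 2*pi, 2*pi)"
      unfolding case_prod_beta by (rule integrable_toroidal[OF g])
    fix x :: "real \<times> real \<times> real"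
    obtain \<xi> \<theta> \<phi> where x: "x = (\<xi>, \<theta>, \<phi>)" by (cases x)
    have "\<bar>cos \<xi> * sin \<xi>\<bar> \<le> 1" by (simp add: abs_mult mult_le_one)
    then have "\<bar>g (toroidal \<xi> \<theta> \<phi>)\<bar> * \<bar>cos \<xi> * sin \<xi>\<bar> \<le> B * 1"
      by (intro mult_mono B toroidal_in_S3) (use \<open>B \<ge> 0\<close> in auto)
    then show "norm (case x of (\<xi>, \<theta>, \<phi>) \<Rightarrow> g (toroidal \<xi> \<theta> \<phi>) * (cos \<xi> * sin \<xi>)) \<le> B"
      by (simp add: x abs_mult)
  qed
  then show ?thesis by (simp add: integral_S3_cbox[OF g])
qed

text \<open>The density vanishes at \<open>\<xi> = 0\<close> and \<open>\<xi> = pi/2\<close>, so the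
  vanishing integral gives \<open>h = 0\<close> only in between; continuity in \<open>\<xi>\<close>
  reaches the two remaining circles.\<close>

lemma inner_S3_self_eq_0:
  assumes h: "continuous_on S3 h" and "inner_S3 h h = 0" and p: "p \<in> S3"
  shows "h p = 0"
proof -
  let ?Q = "cbox (0, 0, 0) (pi/2, 2*pi, 2*pi) :: (real \<times> real \<times> real) set"
  let ?f = "\<lambda>(\<xi>, \<theta>, \<phi>). h (toroidal \<xi> \<theta> \<phi>) * h (toroidal \<xi> \<theta> \<phi>) * (cos \<xi> * sin \<xi>)"
  have c: "continuous_on ?Q ?f"
    unfolding case_prod_beta by (intro continuous_intros continuous_on_compose_toroidal h)
  have "integral ?Q ?f = 0"
    using assms(2) unfolding inner_S3_def by (simp add: integral_S3_cbox[OF continuous_on_mult[OF h h]])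
  moreover have "box (0, 0, 0) (pi/2, 2*pi, 2*pi) \<noteq> ({} :: (real \<times> real \<times> real) set)"
    by (simp add: box_ne_empty Basis_prod_def inner_prod_def)
  moreover have "?f x \<ge> 0" if x: "x \<in> ?Q" for x
  proof -
    obtain \<xi> \<theta> \<phi> where x': "x = (\<xi>, \<theta>, \<phi>)" by (cases x)
    with x have "0 \<le> \<xi>" "\<xi> \<le> pi/2" by (auto simp: cbox_Pair_eq)
    then have "0 \<le> cos \<xi>" "0 \<le> sin \<xi>" by (auto intro: cos_ge_zero sin_ge_zero)
    then show ?thesis by (simp add: x')
  qed
  ultimately have 0: "\<forall>x\<in>?Q. ?f x = 0"
    using integral_cbox_eq_0_iff[OF c] by blast
  obtain \<xi> \<theta> \<phi> where pt: "p = toroidal \<xi> \<theta> \<phi>" "\<xi> \<in> {0..pi/2}" "\<theta> \<in> {0..2*pi}" "\<phi> \<in> {0..2*pi}"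
    using S3_toroidal[OF p] by (auto simp: toroidal_box_def)
  have "h (toroidal t \<theta> \<phi>) = 0" if t: "t \<in> {0<..<pi/2}" for t
  proof -
    have "?f (t, \<theta>, \<phi>) = 0" by (rule bspec[OF 0]) (use pt t in \<open>auto simp: cbox_Pair_eq\<close>)
    moreover have "cos t > 0" "sin t > 0" using t by (auto intro: cos_gt_zero sin_gt_zero)
    ultimately show ?thesis by simp
  qed
  moreover have "closure {0<..<pi/2} = {0..pi/2}" by (simp add: closure_greaterThanLessThan)
  moreover have "continuous_on X (\<lambda>t. h (toroidal t \<theta> \<phi>))" for X
    by (intro continuous_intros continuous_on_compose_toroidal h)
  ultimately have "h (toroidal \<xi> \<theta> \<phi>) = 0"
    using continuous_constant_on_closure[of "{0<..<pi/2}" "\<lambda>t. h (toroidal t \<theta> \<phi>)" 0 \<xi>] pt by simp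
  then show ?thesis by (simp add: pt)
qed

theorem modes_complete:
  assumes h: "continuous_on S3 h" and orth: "\<And>k l m. mode_exists k l m \<Longrightarrow> inner_S3 h (\<Psi> k l m) = 0"
    and p: "p \<in> S3"
  shows "h p = 0"
proof -
  note torus = inner_S3_linear h continuous_torus_fn orthogonal_torus_fn[OF h orth]
  have trig: "continuous_on S3 f \<and> inner_S3 h f = 0" if "trig_polynomial f" for f
    using that
  proof induction
    case (add f g r)
    then show ?case by (simp add: inner_S3_linear h)
  next
    case (Re a b c e)
    have "inner_S3 h (\<lambda>p. Re (complex_monomial a b c e p)) = 0"
      by (rule trans[OF inner_S3_cong[OF complex_monomial_torus_fn(1)]], assumption) (simp add: torus)
    then show ?case unfolding complex_monomial_def Complex_eq by (auto intro!: continuous_intros)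
  next
    case (Im a b c e)
    have "inner_S3 h (\<lambda>p. Im (complex_monomial a b c e p)) = 0"
      by (rule trans[OF inner_S3_cong[OF complex_monomial_torus_fn(2)]], assumption) (simp add: torus)
    then show ?case unfolding complex_monomial_def Complex_eq by (auto intro!: continuous_intros)
  qed
  have "compact S3" by simp
  from compact_continuous_image[OF h this] have "bounded (h ` S3)" by (rule compact_imp_bounded)
  then obtain M where M: "M > 0" "\<And>p. p \<in> S3 \<Longrightarrow> \<bar>h p\<bar> \<le> M"
    unfolding bounded_pos by auto
  define V where "V = M * measure lborel (cbox (0, 0, 0) (pi/2, 2*pi, 2*pi) :: (real \<times> real \<times> real) set)"
  have "V \<ge> 0" using M by (simp add: V_def)
  have small: "\<bar>inner_S3 h h\<bar> \<le> e * V" if "e > 0" for e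
  proof -
    obtain g where g: "real_polynomial_function g" "\<And>x. x \<in> S3 \<Longrightarrow> \<bar>h x - g x\<bar> < e"
      using Stone_Weierstrass_real_polynomial_function[OF \<open>compact S3\<close> h \<open>e > 0\<close>] by blast
    have tg: "continuous_on S3 g" "inner_S3 h g = 0"
      using trig[OF real_polynomial_imp_trig[OF g(1)]] by auto
    \<comment> \<open>As \<open>h\<close> is orthogonal to the approximating polynomial
      \<open>g\<close>, its square norm is its inner product with the uniformly small
      \<open>h - g\<close>.\<close>
    have "integral_S3 (\<lambda>p. h p * (h p - g p)) = integral_S3 (\<lambda>p. h p * h p + (- 1) * (h p * g p))"
      by (simp add: algebra_simps)
    also have "\<dots> = integral_S3 (\<lambda>p. h p * h p) + integral_S3 (\<lambda>p. (- 1) * (h p * g p))"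
      by (intro integral_S3_add continuous_intros h tg)
    also have "\<dots> = inner_S3 h h"
      using tg integral_S3_cmult[OF continuous_on_mult[OF h tg(1)], of "- 1"] by (simp add: inner_S3_def)
    finally have "inner_S3 h h = integral_S3 (\<lambda>p. h p * (h p - g p))" by simp
    also have "\<bar>\<dots>\<bar> \<le> (M * e) * measure lborel (cbox (0, 0, 0) (pi/2, 2*pi, 2*pi) :: (real \<times> real \<times> real) set)"
    proof (rule integral_S3_bound)
      show "continuous_on S3 (\<lambda>p. h p * (h p - g p))" by (intro continuous_intros h tg)
      show "\<bar>h p * (h p - g p)\<bar> \<le> M * e" if "p \<in> S3" for p
        unfolding abs_mult using M(2)[OF that] g(2)[OF that] M(1) by (intro mult_mono) auto
    qed (use M that in simp)
    finally show ?thesis by (simp add: V_def mult_ac)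
  qed
  have "\<bar>inner_S3 h h\<bar> \<le> 0"
  proof (rule field_le_epsilon)
    fix e :: real assume e: "e > 0"
    \<comment> \<open>Dividing by \<open>V + 1\<close> keeps the denominator positive, as only
      \<open>V \<ge> 0\<close> is at hand.\<close>
    have "\<bar>inner_S3 h h\<bar> \<le> e / (V + 1) * V" using e \<open>V \<ge> 0\<close> by (intro small) auto
    also have "\<dots> \<le> e" using e \<open>V \<ge> 0\<close> by (simp add: field_simps)
    finally show "\<bar>inner_S3 h h\<bar> \<le> 0 + e" by simp
  qed
  then show ?thesis using inner_S3_self_eq_0[OF h _ p] by simp
qed


section \<open>Eigenfunctions and the action of the binary dihedral group\<close>

text \<open>Twice differentiable data suffice for Green's identity and pass to linear combinations,
  so an eigenfunction minus its projection remains in the class.\<close>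

definition eigen_S3 :: "nat \<Rightarrow> (real^4 \<Rightarrow> real) \<Rightarrow> bool" where
  "eigen_S3 k f \<longleftrightarrow>
     (\<exists>T D. C2_S3 f T D \<and> (\<forall>p\<in>S3. trace (matrix (D p)) = - (real k * (real k + 2)) * f p))"

lemma eigen_S3_add:
  assumes "eigen_S3 k f" "eigen_S3 k g"
  shows "eigen_S3 k (\<lambda>p. f p + g p)"
proof -
  from assms obtain T D T' D' where
    f: "C2_S3 f T D" "\<And>p. p \<in> S3 \<Longrightarrow> trace (matrix (D p)) = - (real k * (real k + 2)) * f p" and
    g: "C2_S3 g T' D'" "\<And>p. p \<in> S3 \<Longrightarrow> trace (matrix (D' p)) = - (real k * (real k + 2)) * g p"
    unfolding eigen_S3_def by blast
  have "trace (matrix (\<lambda>h. D p h + D' p h)) = trace (matrix (D p)) + trace (matrix (D' p))" for p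
    by (simp add: trace_matrix sum.distrib)
  then have "\<forall>p\<in>S3. trace (matrix (\<lambda>h. D p h + D' p h)) = - (real k * (real k + 2)) * (f p + g p)"
    by (simp add: f(2) g(2) distrib_left)
  with C2_S3_add[OF f(1) g(1)] show ?thesis unfolding eigen_S3_def by blast
qed

lemma eigen_S3_cmult:
  assumes "eigen_S3 k f"
  shows "eigen_S3 k (\<lambda>p. c * f p)"
proof -
  from assms obtain T D where
    f: "C2_S3 f T D" "\<And>p. p \<in> S3 \<Longrightarrow> trace (matrix (D p)) = - (real k * (real k + 2)) * f p"
    unfolding eigen_S3_def by blast
  have "trace (matrix (\<lambda>h. c *\<^sub>R D p h)) = c * trace (matrix (D p))" for p
    by (simp add: trace_matrix sum_distrib_left)
  then have "\<forall>p\<in>S3. trace (matrix (\<lambda>h. c *\<^sub>R D p h)) = - (real k * (real k + 2)) * (c * f p)"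
    by (simp add: f(2))
  with C2_S3_cmult[OF f(1)] show ?thesis unfolding eigen_S3_def by blast
qed

lemma eigen_S3_mode:
  assumes "mode_exists k l m"
  shows "eigen_S3 k (\<Psi> k l m)"
  unfolding eigen_S3_def
  using C2_S3_mode[of k l m] mode_laplacian[OF assms] by (intro exI conjI) (auto simp: laplacian_eq_trace)

lemma eigen_S3_continuous: "eigen_S3 k f \<Longrightarrow> continuous_on S3 f"
  unfolding eigen_S3_def using C2_S3_continuous by blast

lemma eigen_S3_laplacian: "eigen_S3 k f \<Longrightarrow> p \<in> S3 \<Longrightarrow> laplacian_S3 f p = - (real k * (real k + 2)) * f p"
  unfolding eigen_S3_def using C2_S3_laplacian by metis

lemma eigen_S3_orthogonal:
  assumes "eigen_S3 k f" "eigen_S3 k' g" "k \<noteq> k'"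
  shows "inner_S3 f g = 0"
proof -
  from assms obtain T D T' D' where
    f: "C2_S3 f T D" "\<And>p. p \<in> S3 \<Longrightarrow> trace (matrix (D p)) = - (real k * (real k + 2)) * f p" and
    g: "C2_S3 g T' D'" "\<And>p. p \<in> S3 \<Longrightarrow> trace (matrix (D' p)) = - (real k' * (real k' + 2)) * g p"
    unfolding eigen_S3_def by blast
  \<comment> \<open>\<open>k (k + 2)\<close> is injective on natural numbers: the difference of two
    values has the factors \<open>k - k'\<close> and \<open>k + k' + 2\<close>, and the latter is
    positive.\<close>
  have "- (real k * (real k + 2)) \<noteq> - (real k' * (real k' + 2))"
  proof
    assume "- (real k * (real k + 2)) = - (real k' * (real k' + 2))"
    then have "(real k - real k') * (real k + real k' + 2) = 0" by (simp add: algebra_simps)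
    then show False using assms(3) by (simp add: add_eq_0_iff)
  qed
  with f g show ?thesis by (rule eigenfunctions_orthogonal)
qed

text \<open>Eigenfunctions that agree with a polynomial on the sphere. The polynomial supplies
  smoothness, so invariance is all that is missing for membership in the eigenspace.\<close>

definition mode_span :: "nat \<Rightarrow> (real^4 \<Rightarrow> real) \<Rightarrow> bool" where
  "mode_span k f \<longleftrightarrow> eigen_S3 k f \<and> (\<exists>F. real_polynomial_function F \<and> (\<forall>p\<in>S3. f p = F p))"

lemma mode_span_mode: "mode_exists k l m \<Longrightarrow> mode_span k (\<Psi> k l m)"
  by (simp only: mode_span_def eigen_S3_mode mode_polynomial simp_thms)

lemma mode_span_add:
  assumes "mode_span k f" "mode_span k g"
  shows "mode_span k (\<lambda>p. f p + g p)"
proof -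
  obtain F G where F: "real_polynomial_function F" "\<And>p. p \<in> S3 \<Longrightarrow> f p = F p"
    and G: "real_polynomial_function G" "\<And>p. p \<in> S3 \<Longrightarrow> g p = G p"
    using assms unfolding mode_span_def by metis
  have "\<exists>H. real_polynomial_function H \<and> (\<forall>p\<in>S3. f p + g p = H p)"
    by (intro exI[of _ "\<lambda>p. F p + G p"] conjI real_polynomial_function.intros(3) F(1) G(1)) (simp add: F(2) G(2))
  then show ?thesis
    using assms eigen_S3_add unfolding mode_span_def by simp
qed

lemma mode_span_cmult:
  assumes "mode_span k f"
  shows "mode_span k (\<lambda>p. c * f p)"
proof -
  obtain F where F: "real_polynomial_function F" "\<And>p. p \<in> S3 \<Longrightarrow> f p = F p"
    using assms unfolding mode_span_def by metis
  have "\<exists>H. real_polynomial_function H \<and> (\<forall>p\<in>S3. c * f p = H p)"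
    by (intro exI[of _ "\<lambda>p. c * F p"] conjI real_polynomial_function.intros(2,4) F(1)) (simp add: F(2))
  then show ?thesis
    using assms eigen_S3_cmult unfolding mode_span_def by simp
qed

section \<open>Reduction of invariance to the two generators\<close>

definition dihedral_invariant :: "nat \<Rightarrow> (real^4 \<Rightarrow> real) \<Rightarrow> bool" where
  "dihedral_invariant n f \<longleftrightarrow> (\<forall>p\<in>S3. f (screw n p) = f p \<and> f (flip p) = f p)"

text \<open>Membership in \<open>Bij S\<close> is carried along because the preimage in the inverse
  case and the intermediate point of a composition must lie in \<open>S\<close>, where invariance is
  known.\<close>

lemma generate_BijGroup_invariant:
  assumes H: "\<And>g. g \<in> H \<Longrightarrow> g \<in> Bij S \<and> (\<forall>p\<in>S. f (g p) = f p)"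
    and g: "g \<in> generate (BijGroup S) H"
  shows "g \<in> Bij S \<and> (\<forall>p\<in>S. f (g p) = f p)"
  using g
proof induction
  case one
  have "\<one>\<^bsub>BijGroup S\<^esub> = (\<lambda>x\<in>S. x)" by (simp add: BijGroup_def)
  then show ?case by (simp only: id_Bij) simp
next
  case (incl g)
  then show ?case by (rule H)
next
  case (inv g)
  then have g: "g \<in> Bij S" "\<And>p. p \<in> S \<Longrightarrow> f (g p) = f p" using H by auto
  then have bij: "bij_betw g S S" by (simp add: Bij_def)
  have "f (inv_into S g p) = f p" if p: "p \<in> S" for p
  proof -
    have "inv_into S g p \<in> S" "g (inv_into S g p) = p"
      using bij p by (auto simp: bij_betw_def inv_into_into f_inv_into_f)
    then show ?thesis using g(2)[of "inv_into S g p"] by simp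
  qed
  then have "\<forall>p\<in>S. f ((\<lambda>x\<in>S. inv_into S g x) p) = f p" by simp
  with restrict_inv_into_Bij[OF g(1)] show ?case
    unfolding inv_BijGroup[OF g(1)] by (rule conjI)
next
  case (eng g g')
  then have "g' p \<in> S" if "p \<in> S" for p using that Bij_imp_funcset by fastforce
  with eng show ?case by (simp add: BijGroup_def compose_Bij compose_eq)
qed

lemma dihedral_invariant_iff:
  "dihedral_invariant n f \<longleftrightarrow> (\<forall>g\<in>binary_dihedral n. \<forall>p\<in>S3. f (g p) = f p)"
proof
  assume f: "dihedral_invariant n f"
  have "g \<in> Bij S3 \<and> (\<forall>p\<in>S3. f (g p) = f p)" if "g \<in> {restrict (screw n) S3, restrict flip S3}" for g
    using that f generators_in_BijGroup(1)[of n] generators_in_BijGroup(2) by (auto simp: dihedral_invariant_def BijGroup_def)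
  from generate_BijGroup_invariant[OF this]
  show "\<forall>g\<in>binary_dihedral n. \<forall>p\<in>S3. f (g p) = f p"
    unfolding binary_dihedral_def by blast
next
  assume f: "\<forall>g\<in>binary_dihedral n. \<forall>p\<in>S3. f (g p) = f p"
  have "restrict (screw n) S3 \<in> binary_dihedral n" "restrict flip S3 \<in> binary_dihedral n"
    unfolding binary_dihedral_def by (auto intro: generate.incl)
  from bspec[OF f this(1)] bspec[OF f this(2)] show "dihedral_invariant n f"
    unfolding dihedral_invariant_def by auto
qed

lemma prism_eigenspaceI:
  "mode_span k f \<Longrightarrow> dihedral_invariant n f \<Longrightarrow> f \<in> prism_eigenspace n k"
  unfolding prism_eigenspace_def dihedral_invariant_iff[symmetric] mode_span_def
  using smooth_on_S3_polynomial eigen_S3_laplacian by blast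

lemma prism_eigenspaceD:
  assumes "f \<in> prism_eigenspace n k"
  shows "eigen_S3 k f" "dihedral_invariant n f"
proof -
  show "dihedral_invariant n f"
    using assms unfolding prism_eigenspace_def dihedral_invariant_iff by blast
  have f: "smooth_on_S3 f" "\<And>p. p \<in> S3 \<Longrightarrow> laplacian_S3 f p = - (real k * (real k + 2)) * f p"
    using assms unfolding prism_eigenspace_def by auto
  note C2 = smooth_imp_C2_S3[OF f(1)]
  have "\<forall>p\<in>S3. trace (matrix (hessian_S3 f p)) = - (real k * (real k + 2)) * f p"
    using f(2) by (simp add: laplacian_eq_trace)
  with C2 show "eigen_S3 k f"
    unfolding eigen_S3_def by (intro exI conjI)
qed

text \<open>The four modes share radial part and norm, so the addition theorems merge the two angles
  into \<open>l \<theta> - m \<phi>\<close> or \<open>l \<theta> + m \<phi>\<close>.\<close>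

lemma mode_combinations_toroidal:
  fixes k :: nat and \<xi> \<theta> \<phi> :: real
  assumes "0 < l" "0 < m" and \<xi>: "\<xi> \<in> {0..pi/2}"
  defines "r \<equiv> mode_radial k l m \<xi> / mode_norm k l m" and "p \<equiv> toroidal \<xi> \<theta> \<phi>"
  shows "\<Psi> k l m p + \<Psi> k (-l) (-m) p = r * cos (of_int l * \<theta> - of_int m * \<phi>)" (is ?A)
    "\<Psi> k (-l) m p - \<Psi> k l (-m) p = r * sin (of_int l * \<theta> - of_int m * \<phi>)" (is ?B)
    "\<Psi> k l m p - \<Psi> k (-l) (-m) p = r * cos (of_int l * \<theta> + of_int m * \<phi>)" (is ?C)
    "\<Psi> k (-l) m p + \<Psi> k l (-m) p = r * sin (of_int l * \<theta> + of_int m * \<phi>)" (is ?D)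
proof -
  have ang: "mode_angular l t = cos (of_int l * t)" "mode_angular (-l) t = sin (of_int l * t)"
    "mode_angular m t = cos (of_int m * t)" "mode_angular (-m) t = sin (of_int m * t)" for t
    using assms(1,2) by (simp_all add: mode_angular_def)
  show ?A ?B ?C ?D
    unfolding p_def mode_toroidal[OF \<xi>] mode_raw_def ang mode_radial_sym mode_norm_sym(1,2) r_def
      cos_diff sin_diff cos_add sin_add
    by (simp_all add: algebra_simps add_divide_distrib diff_divide_distrib)
qed

lemma mode_screw:
  fixes n :: nat
  assumes lm: "0 < l" "0 < m" and p: "p \<in> S3"
  defines "a \<equiv> of_int (l - m) * (pi / real n)" and "b \<equiv> of_int (l + m) * (pi / real n)" and "q \<equiv> screw n p"
  shows "\<Psi> k l m q + \<Psi> k (-l) (-m) q =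
      cos a * (\<Psi> k l m p + \<Psi> k (-l) (-m) p) - sin a * (\<Psi> k (-l) m p - \<Psi> k l (-m) p)" (is ?A)
    "\<Psi> k (-l) m q - \<Psi> k l (-m) q =
      sin a * (\<Psi> k l m p + \<Psi> k (-l) (-m) p) + cos a * (\<Psi> k (-l) m p - \<Psi> k l (-m) p)" (is ?B)
    "\<Psi> k l m q - \<Psi> k (-l) (-m) q =
      cos b * (\<Psi> k l m p - \<Psi> k (-l) (-m) p) - sin b * (\<Psi> k (-l) m p + \<Psi> k l (-m) p)" (is ?C)
    "\<Psi> k (-l) m q + \<Psi> k l (-m) q =
      sin b * (\<Psi> k l m p - \<Psi> k (-l) (-m) p) + cos b * (\<Psi> k (-l) m p + \<Psi> k l (-m) p)" (is ?D)
proof -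
  obtain \<xi> \<theta> \<phi> where pt: "p = toroidal \<xi> \<theta> \<phi>" "\<xi> \<in> {0..pi/2}" using S3_toroidalE[OF p] .
  define c where "c = pi / real n"
  have q: "q = toroidal \<xi> (\<theta> + c) (\<phi> + c)"
    unfolding q_def pt(1) screw_toroidal[OF pt(2)] by (simp add: c_def)
  have ang: "of_int l * (\<theta> + c) - of_int m * (\<phi> + c) = (of_int l * \<theta> - of_int m * \<phi>) + a"
    "of_int l * (\<theta> + c) + of_int m * (\<phi> + c) = (of_int l * \<theta> + of_int m * \<phi>) + b"
    by (simp_all add: a_def b_def c_def algebra_simps)
  show ?A ?B ?C ?D
    unfolding q pt(1) mode_combinations_toroidal[OF lm pt(2)] ang cos_add[of _ a] sin_add[of _ a] cos_add[of _ b] sin_add[of _ b]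
    by (simp_all add: algebra_simps)
qed

text \<open>If one index is 0 only one angle occurs, and the cosine and the sine mode of the other
  index already form a rotated pair.\<close>

lemma mode_screw_axis:
  fixes n :: nat
  assumes l: "0 < l" and p: "p \<in> S3"
  defines "a \<equiv> of_int l * (pi / real n)" and "q \<equiv> screw n p"
  shows "\<Psi> k l 0 q = cos a * \<Psi> k l 0 p - sin a * \<Psi> k (-l) 0 p" (is ?A)
    "\<Psi> k (-l) 0 q = sin a * \<Psi> k l 0 p + cos a * \<Psi> k (-l) 0 p" (is ?B)
    "\<Psi> k 0 l q = cos a * \<Psi> k 0 l p - sin a * \<Psi> k 0 (-l) p" (is ?C)
    "\<Psi> k 0 (-l) q = sin a * \<Psi> k 0 l p + cos a * \<Psi> k 0 (-l) p" (is ?D)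
proof -
  obtain \<xi> \<theta> \<phi> where pt: "p = toroidal \<xi> \<theta> \<phi>" "\<xi> \<in> {0..pi/2}" using S3_toroidalE[OF p] .
  define c where "c = pi / real n"
  have q: "q = toroidal \<xi> (\<theta> + c) (\<phi> + c)"
    unfolding q_def pt(1) screw_toroidal[OF pt(2)] by (simp add: c_def)
  have ang: "mode_angular l t = cos (of_int l * t)" "mode_angular (-l) t = sin (of_int l * t)"
    "mode_angular 0 t = 1" for t
    using l by (simp_all add: mode_angular_def)
  have add: "of_int l * (t + c) = of_int l * t + a" for t by (simp add: a_def c_def algebra_simps)
  show ?A ?B ?C ?D
    unfolding q pt(1) mode_toroidal[OF pt(2)] mode_raw_def ang mode_radial_sym mode_norm_sym(1,2) add cos_add sin_add
    by (simp_all add: algebra_simps add_divide_distrib diff_divide_distrib)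
qed

lemma mode_screw_zero:
  assumes "p \<in> S3"
  shows "\<Psi> k 0 0 (screw n p) = \<Psi> k 0 0 p"
proof -
  obtain \<xi> \<theta> \<phi> where pt: "p = toroidal \<xi> \<theta> \<phi>" "\<xi> \<in> {0..pi/2}" using S3_toroidalE[OF assms] .
  show ?thesis
    unfolding pt(1) screw_toroidal[OF pt(2)] mode_toroidal[OF pt(2)] by (simp add: mode_raw_def mode_angular_def)
qed

lemma screw_angle:
  fixes n :: nat
  assumes "n \<ge> 1"
  shows "cos (of_int j * (pi / real n)) = 1 \<longleftrightarrow> [j = 0] (mod 2 * int n)"
    "[j = 0] (mod 2 * int n) \<Longrightarrow> sin (of_int j * (pi / real n)) = 0"
proof -
  have n: "real n > 0" using assms by simp
  have "cos (of_int j * (pi / real n)) = 1 \<longleftrightarrow> (\<exists>i::int. of_int j * (pi / real n) = of_int i * 2 * pi)"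
    by (rule cos_one_2pi_int)
  also have "\<dots> \<longleftrightarrow> (\<exists>i. j = i * (2 * int n))"
  proof -
    have "of_int j * (pi / real n) = of_int i * 2 * pi \<longleftrightarrow> j = i * (2 * int n)" for i
    proof -
      have "of_int j * (pi / real n) = of_int i * 2 * pi \<longleftrightarrow> real_of_int j = real_of_int (i * (2 * int n))"
        using n by (simp add: field_simps)
      then show ?thesis by (simp only: of_int_eq_iff)
    qed
    then show ?thesis by simp
  qed
  also have "\<dots> \<longleftrightarrow> [j = 0] (mod 2 * int n)"
    by (auto simp: cong_0_iff dvd_def mult.commute)
  finally show cos: "cos (of_int j * (pi / real n)) = 1 \<longleftrightarrow> [j = 0] (mod 2 * int n)" .
  show "sin (of_int j * (pi / real n)) = 0" if "[j = 0] (mod 2 * int n)"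
    using cos that by (auto intro: cos_one_sin_zero)
qed

section \<open>Values of the sign\<close>

lemma mode_sign_pm: "\<sigma> k l m = 1 \<or> \<sigma> k l m = - 1"
  by (simp add: mode_sign_def)

lemma mode_sign_eq: "\<sigma> k l m > 0 \<Longrightarrow> \<sigma> k l m = 1" "\<sigma> k l m < 0 \<Longrightarrow> \<sigma> k l m = - 1"
  using mode_sign_pm[of k l m] by auto

lemma mode_sign_neg:
  assumes "0 < l" "0 < m"
  shows "\<sigma> k (-l) (-m) = \<sigma> k l m" "\<sigma> k (-l) m = - \<sigma> k l m" "\<sigma> k l (-m) = - \<sigma> k l m"
  using assms by (auto simp: mode_sign_def mode_degree_sym)

text \<open>\<open>\<sigma>\<close> contains the parity of its second index only, hence the parity
  hypothesis.\<close>

lemma mode_sign_swap: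
  assumes "0 < l" "0 < m" "even l \<longleftrightarrow> even m"
  shows "\<sigma> k m l = \<sigma> k l m"
  using assms by (auto simp: mode_sign_def mode_degree_sym(3)[of k m l])

lemma mode_sign_axis:
  assumes "0 < l"
  shows "\<sigma> k l 0 = (if even (mode_degree k l 0) then 1 else - 1)"
    "\<sigma> k (-l) 0 = (if even (mode_degree k l 0) then - 1 else 1)"
    "even l \<Longrightarrow> \<sigma> k 0 l = (if even (mode_degree k l 0) then 1 else - 1)"
    "even l \<Longrightarrow> \<sigma> k 0 (-l) = (if even (mode_degree k l 0) then - 1 else 1)"
  using assms by (auto simp: mode_sign_def mode_degree_sym(1,2) mode_degree_sym(3)[of k 0 l])

lemma double_cong_4:
  "[2 * d = 0] (mod 4) \<longleftrightarrow> even d" "[2 * d = 2] (mod 4) \<longleftrightarrow> odd d" for d :: nat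
  unfolding cong_def by presburger+

lemma mode_sign_zero:
  assumes "mode_exists k 0 0"
  shows "\<sigma> k 0 0 = (if [k = 0] (mod 4) then 1 else - 1)"
proof -
  have "k = 2 * mode_degree k 0 0" using mode_degree_eq[OF assms] by simp
  then have "even (mode_degree k 0 0) \<longleftrightarrow> [k = 0] (mod 4)"
    using double_cong_4(1)[of "mode_degree k 0 0"] by (simp only:)
  then show ?thesis by (simp add: mode_sign_def)
qed

text \<open>Here \<open>k = 2 (l + d)\<close>, so the parities of \<open>d\<close> and
  \<open>l\<close> in \<open>\<sigma>\<close> combine to the class of \<open>k\<close> modulo
  4.\<close>

lemma mode_sign_diag:
  assumes "0 < l" "mode_exists k l l"
  shows "\<sigma> k l l = (if [k = 0] (mod 4) then 1 else - 1)" "[k = 2] (mod 4) \<longleftrightarrow> \<not> [k = 0] (mod 4)"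
proof -
  define d a where "d = mode_degree k l l" and "a = nat l"
  have k: "k = 2 * (a + d)" using mode_degree_eq[OF assms(2)] assms(1) by (simp add: d_def a_def)
  have e: "even l \<longleftrightarrow> even a" using assms(1) by (simp add: a_def even_nat_iff)
  have 4: "[k = 0] (mod 4) \<longleftrightarrow> even (a + d)" "[k = 2] (mod 4) \<longleftrightarrow> odd (a + d)"
    unfolding k by (rule double_cong_4)+
  show "\<sigma> k l l = (if [k = 0] (mod 4) then 1 else - 1)"
    unfolding 4(1) using assms(1) e by (auto simp: mode_sign_def d_def)
  show "[k = 2] (mod 4) \<longleftrightarrow> \<not> [k = 0] (mod 4)" unfolding 4 by simp
qed


section \<open>The listed functions\<close>

text \<open>
  All functions of the list except the first have one of three shapes; the indices \<open>l\<close>, \<open>m\<close> are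
  signed here, and the booleans are the signs of the combination.
\<close>

datatype mode_index = Zero | Axis int bool | Diag int int bool | Quad int int bool bool

definition sgn_of :: "bool \<Rightarrow> real" where
  "sgn_of b = (if b then 1 else - 1)"

fun index_terms :: "mode_index \<Rightarrow> (real \<times> int \<times> int) list" where
  "index_terms Zero = [(1, 0, 0)]"
| "index_terms (Axis l d) = [(sqrt (1/2), l, 0), (sqrt (1/2) * sgn_of d, 0, l)]"
| "index_terms (Diag l m e) = [(sqrt (1/2), l, m), (sqrt (1/2) * sgn_of e, -l, -m)]"
| "index_terms (Quad l m e d) = [(1/2, l, m), (1/2 * sgn_of e, -l, -m),
     (1/2 * sgn_of d, m, l), (1/2 * (sgn_of d * sgn_of e), -m, -l)]"

text \<open>Only shape, existence and the choice of order are recorded, so the valid indices form a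
  finite family that covers all listed functions; orthonormality is checked on this larger
  family.\<close>

fun valid_index :: "nat \<Rightarrow> (int \<times> int) set \<Rightarrow> mode_index \<Rightarrow> bool" where
  "valid_index k R Zero \<longleftrightarrow> mode_exists k 0 0"
| "valid_index k R (Axis l d) \<longleftrightarrow> l \<noteq> 0 \<and> mode_exists k l 0"
| "valid_index k R (Diag l m e) \<longleftrightarrow> 0 < m \<and> \<bar>l\<bar> = m \<and> mode_exists k l m"
| "valid_index k R (Quad l m e d) \<longleftrightarrow> (l, \<bar>m\<bar>) \<in> R \<and> mode_exists k l m"

definition mode_comb :: "nat \<Rightarrow> (real \<times> int \<times> int) list \<Rightarrow> real^4 \<Rightarrow> real" where
  "mode_comb k xs p = (\<Sum>(c, l, m)\<leftarrow>xs. c * \<Psi> k l m p)"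

lemma mode_comb_simps:
  "mode_comb k [] = (\<lambda>p. 0)"
  "mode_comb k ((c, l, m) # xs) = (\<lambda>p. c * \<Psi> k l m p + mode_comb k xs p)"
  by (simp_all add: mode_comb_def fun_eq_iff)

lemma continuous_mode_comb: "continuous_on S3 (mode_comb k xs)"
  unfolding mode_comb_def[abs_def]
proof (induction xs)
  case (Cons x xs)
  obtain c l m where "x = (c, l, m)" by (cases x)
  with Cons show ?case by (auto intro!: continuous_intros mode_continuous)
qed simp

lemma inner_mode_comb:
  assumes "continuous_on S3 f"
  shows "inner_S3 f (mode_comb k xs) = (\<Sum>(c, l, m)\<leftarrow>xs. c * inner_S3 f (\<Psi> k l m))"
proof (induction xs)
  case Nil
  then show ?case by (simp add: mode_comb_simps inner_S3_zero)
next
  case (Cons x xs)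
  obtain c l m where "x = (c, l, m)" by (cases x)
  with Cons show ?case
    by (simp add: mode_comb_simps inner_S3_linear assms mode_continuous continuous_mode_comb)
qed

lemma inner_mode_combs:
  assumes "\<And>c l m. (c, l, m) \<in> set ys \<Longrightarrow> mode_exists k l m"
  shows "inner_S3 (mode_comb k xs) (mode_comb k ys)
     = (\<Sum>(c', l', m')\<leftarrow>ys. c' * (\<Sum>(c, l, m)\<leftarrow>xs. c * (if l' = l \<and> m' = m then 1 else 0)))"
proof -
  have "inner_S3 (mode_comb k xs) (\<Psi> k l' m') = (\<Sum>(c, l, m)\<leftarrow>xs. c * (if l' = l \<and> m' = m then 1 else 0))"
    if "mode_exists k l' m'" for l' m'
    by (subst inner_S3_commute) (simp add: inner_mode_comb[OF mode_continuous] mode_orthonormal[OF that])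
  then show ?thesis
    unfolding inner_mode_comb[OF continuous_mode_comb] using assms
    by (intro arg_cong[where f = sum_list] map_cong) auto
qed

lemma index_terms_exist:
  "valid_index k R i \<Longrightarrow> (c, l, m) \<in> set (index_terms i) \<Longrightarrow> mode_exists k l m"
  by (cases i) (auto simp: mode_exists_def cong_iff_dvd_diff)

lemma pair_choiceD:
  assumes "pair_choice R" "(l, m) \<in> R"
  shows "0 < l" "0 < m" "l \<noteq> m" "(m, l) \<notin> R"
  using assms unfolding pair_choice_def by blast+

lemma sum_list_map_eq_0: "(\<And>x. x \<in> set xs \<Longrightarrow> f x = 0) \<Longrightarrow> (\<Sum>x\<leftarrow>xs. f x) = (0::real)"
  by (induction xs) auto

text \<open>An invariant shared by all modes of one index: indices with different keys have no mode
  in common.\<close>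

fun index_key :: "mode_index \<Rightarrow> int set" where
  "index_key Zero = {0}"
| "index_key (Axis l d) = {\<bar>l\<bar>, 0}"
| "index_key (Diag l m e) = {\<bar>l\<bar>, \<bar>m\<bar>}"
| "index_key (Quad l m e d) = {\<bar>l\<bar>, \<bar>m\<bar>}"

lemma index_terms_key: "(c, l, m) \<in> set (index_terms i) \<Longrightarrow> {\<bar>l\<bar>, \<bar>m\<bar>} = index_key i"
  by (cases i) auto

text \<open>If the keys differ, no mode occurs in both functions. If they agree, the shapes agree as
  well and a finite comparison of coefficients remains.\<close>

lemma index_orthonormal:
  assumes R: "pair_choice R" and ij: "valid_index k R i" "valid_index k R j"
  shows "inner_S3 (mode_comb k (index_terms i)) (mode_comb k (index_terms j)) = (if i = j then 1 else 0)"
proof -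
  have inner: "inner_S3 (mode_comb k (index_terms i)) (mode_comb k (index_terms j))
     = (\<Sum>(c', l', m')\<leftarrow>index_terms j. c' * (\<Sum>(c, l, m)\<leftarrow>index_terms i. c * (if l' = l \<and> m' = m then 1 else 0)))"
    by (rule inner_mode_combs) (rule index_terms_exist[OF ij(2)])
  have half: "sqrt (1/2) * (sqrt (1/2) * x) = x / 2" "sqrt (1/2) * sqrt (1/2) = 1 / 2" for x
    by (simp_all add: mult.assoc[symmetric])
  have sg: "sgn_of True = 1" "sgn_of False = - 1" by (simp_all add: sgn_of_def)
  have Rd: "0 < l \<and> 0 < m \<and> l \<noteq> m" if "(l, m) \<in> R" for l m
    using pair_choiceD[OF R that] by blast
  have quad: "0 < l \<and> m \<noteq> 0 \<and> l \<noteq> \<bar>m\<bar> \<and> (l, \<bar>m\<bar>) \<in> R \<and> (\<bar>m\<bar>, l) \<notin> R" if "valid_index k R (Quad l m e d)" for l m e d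
    using that pair_choiceD[OF R, of l "\<bar>m\<bar>"] by auto
  show ?thesis
  proof (cases "index_key i = index_key j")
    case False
    have ne: "\<not> (l' = l \<and> m' = m)"
      if "(c, l, m) \<in> set (index_terms i)" "(c', l', m') \<in> set (index_terms j)" for c l m c' l' m'
      using False index_terms_key[OF that(1)] index_terms_key[OF that(2)] by auto
    have "inner_S3 (mode_comb k (index_terms i)) (mode_comb k (index_terms j)) = 0"
      unfolding inner
    proof (rule sum_list_map_eq_0, clarify)
      fix c' l' m' assume y: "(c', l', m') \<in> set (index_terms j)"
      have "(\<Sum>(c, l, m)\<leftarrow>index_terms i. c * (if l' = l \<and> m' = m then 1 else 0)) = (0::real)"
      proof (rule sum_list_map_eq_0, clarify)
        fix c l m assume "(c, l, m) \<in> set (index_terms i)"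
        from ne[OF this y] show "c * (if l' = l \<and> m' = m then 1 else 0) = (0::real)" by (simp only: if_False mult_zero_right)
      qed
      then show "c' * (\<Sum>(c, l, m)\<leftarrow>index_terms i. c * (if l' = l \<and> m' = m then 1 else 0)) = (0::real)"
        by (simp only: mult_zero_right)
    qed
    with False show ?thesis by auto
  next
    case True
    show ?thesis
    proof (cases i)
      case i: Zero
      with True ij have j: "j = Zero" by (cases j) (auto dest: Rd)
      show ?thesis unfolding inner unfolding i j by simp
    next
      case i: (Axis l d)
      with True ij obtain l' d' where j: "j = Axis l' d'" and l: "\<bar>l'\<bar> = \<bar>l\<bar>"
        by (cases j) (auto simp: doubleton_eq_iff dest: Rd)
      have "l \<noteq> 0" using ij(1) by (simp add: i)
      with l[unfolded abs_eq_iff] show ?thesis unfolding inner unfolding i j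
        by (cases d; cases d') (auto simp: sg half)
    next
      case i: (Diag l m e)
      with True ij obtain l' m' e' where j: "j = Diag l' m' e'" and m: "m' = m" "\<bar>l'\<bar> = \<bar>l\<bar>"
        by (cases j) (auto simp: doubleton_eq_iff dest: Rd)
      have "0 < m" "l \<noteq> 0" using ij(1) by (auto simp: i)
      with m[unfolded abs_eq_iff] show ?thesis unfolding inner unfolding i j
        by (cases e; cases e') (auto simp: sg half)
    next
      case i: (Quad l m e d)
      note lm = quad[OF ij(1)[unfolded i]]
      obtain l' m' e' d' where j: "j = Quad l' m' e' d'"
        using True ij lm by (cases j) (auto simp: i doubleton_eq_iff)
      note lm' = quad[OF ij(2)[unfolded j]]
      \<comment> \<open>\<open>R\<close> contains only one order of each pair, so two indices cannot
        carry the same key in opposite orders.\<close>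
      have "l' = l" "\<bar>m'\<bar> = \<bar>m\<bar>"
        using True lm lm' by (auto simp: i j doubleton_eq_iff)
      note this[unfolded abs_eq_iff]
      moreover have "l \<noteq> m" "l \<noteq> - m" "m \<noteq> 0" "l \<noteq> 0" using lm by auto
      ultimately show ?thesis unfolding inner unfolding i j
        by (cases e; cases e'; cases d; cases d') (auto simp: sg)
    qed
  qed
qed

lemma finite_valid_index: "finite {i. valid_index k R i}"
proof -
  let ?I = "{- int k..int k}"
  let ?S = "{Zero} \<union> (\<Union>l\<in>?I. \<Union>d. {Axis l d}) \<union> (\<Union>l\<in>?I. \<Union>m\<in>?I. \<Union>e. {Diag l m e})
      \<union> (\<Union>l\<in>?I. \<Union>m\<in>?I. \<Union>e. \<Union>d. {Quad l m e d})"
  have *: "i \<in> ?S" if "valid_index k R i" for i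
    using that by (cases i) (auto simp: mode_exists_def)
  have "{i. valid_index k R i} \<subseteq> ?S" by (rule subsetI, rule *, erule CollectD)
  then show ?thesis by (rule finite_subset) simp
qed

lemmas index_expand = mode_comb_simps sgn_of_def mode_exists_sym(1,2) algebra_simps

text \<open>A negative index gives the functions whose terms have exactly one sine factor; the
  booleans are signs relative to the first term.\<close>

lemma prism_modes_index:
  assumes R: "pair_choice R" and b: "b \<in> prism_modes n k R"
  shows "\<exists>i. valid_index k R i \<and> b = mode_comb k (index_terms i)"
  using b
proof cases
  case m1
  then show ?thesis by (intro exI[of _ Zero]) (auto simp: mode_comb_simps)
next
  case (m2a l)
  then show ?thesis by (intro exI[of _ "Axis l True"]) (auto simp: index_expand)
next
  case (m2b l)
  then show ?thesis by (intro exI[of _ "Axis (-l) False"]) (auto simp: index_expand)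
next
  case (m3a l)
  then show ?thesis by (intro exI[of _ "Axis l False"]) (auto simp: index_expand)
next
  case (m3b l)
  then show ?thesis by (intro exI[of _ "Axis (-l) True"]) (auto simp: index_expand)
next
  case (m4a l)
  then show ?thesis by (intro exI[of _ "Diag l l True"]) (auto simp: index_expand)
next
  case (m4b l)
  then show ?thesis by (intro exI[of _ "Diag (-l) l False"]) (auto simp: index_expand)
next
  case (m5 l)
  then show ?thesis by (intro exI[of _ "Diag l l False"]) (auto simp: index_expand)
next
  case (m6 l)
  then show ?thesis by (intro exI[of _ "Diag (-l) l True"]) (auto simp: index_expand)
next
  case (m7a l m)
  with pair_choiceD[OF R, of l m] show ?thesis by (intro exI[of _ "Quad l m True True"]) (auto simp: index_expand)
next
  case (m7b l m)
  with pair_choiceD[OF R, of l m] show ?thesis by (intro exI[of _ "Quad l (-m) False False"]) (auto simp: index_expand)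
next
  case (m8a l m)
  with pair_choiceD[OF R, of l m] show ?thesis by (intro exI[of _ "Quad l m True False"]) (auto simp: index_expand)
next
  case (m8b l m)
  with pair_choiceD[OF R, of l m] show ?thesis by (intro exI[of _ "Quad l (-m) False True"]) (auto simp: index_expand)
next
  case (m9a l m)
  with pair_choiceD[OF R, of l m] show ?thesis by (intro exI[of _ "Quad l m False True"]) (auto simp: index_expand)
next
  case (m9b l m)
  with pair_choiceD[OF R, of l m] show ?thesis by (intro exI[of _ "Quad l (-m) True False"]) (auto simp: index_expand)
next
  case (m10a l m)
  with pair_choiceD[OF R, of l m] show ?thesis by (intro exI[of _ "Quad l m False False"]) (auto simp: index_expand)
next
  case (m10b l m)
  with pair_choiceD[OF R, of l m] show ?thesis by (intro exI[of _ "Quad l (-m) True True"]) (auto simp: index_expand)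
qed

text \<open>One existing mode is assumed so that the empty combination is covered, as 0 times that
  mode.\<close>

lemma mode_span_comb:
  assumes "mode_exists k l0 m0" "\<And>c l m. (c, l, m) \<in> set xs \<Longrightarrow> mode_exists k l m"
  shows "mode_span k (mode_comb k xs)"
  using assms(2)
proof (induction xs)
  case Nil
  show ?case using mode_span_cmult[OF mode_span_mode[OF assms(1)], of 0] by (simp add: mode_comb_simps)
next
  case (Cons x xs)
  obtain c l m where x: "x = (c, l, m)" by (cases x)
  have "mode_span k (\<lambda>p. c * \<Psi> k l m p)"
    using Cons.prems x by (intro mode_span_cmult mode_span_mode) auto
  moreover have "mode_span k (mode_comb k xs)" using Cons by auto
  ultimately show ?case unfolding x mode_comb_simps by (rule mode_span_add)
qed

text \<open>The modulus is even. Equal parity is what makes \<open>\<sigma>\<close> symmetric in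
  \<open>l\<close> and \<open>m\<close> for the listed pairs.\<close>

lemma even_of_cong:
  "[l = m] (mod 2 * int n) \<Longrightarrow> even l \<longleftrightarrow> even m" "[l = - m] (mod 2 * int n) \<Longrightarrow> even l \<longleftrightarrow> even m"
proof -
  have *: "even a" if "[a = 0] (mod 2 * int n)" for a
    using that by (auto simp: cong_0_iff dest: dvd_mult_left)
  show "even l \<longleftrightarrow> even m" if "[l = m] (mod 2 * int n)"
    using *[of "l - m"] that by (simp add: cong_diff_iff_cong_0)
  show "even l \<longleftrightarrow> even m" if "[l = - m] (mod 2 * int n)"
    using *[of "l + m"] that cong_diff_iff_cong_0[of l "- m" "2 * int n"] by simp
qed

lemma prism_modes_invariant:
  assumes n: "n \<ge> 1" and R: "pair_choice R" and b: "b \<in> prism_modes n k R"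
  shows "dihedral_invariant n b"
proof -
  note angle = screw_angle[OF n]
  have cs: "cos (of_int j * (pi / real n)) = 1" "sin (of_int j * (pi / real n)) = 0" if "[j = 0] (mod 2 * int n)" for j
    using angle[of j] that by auto
  have diff: "[l - m = 0] (mod 2 * int n)" if "[l = m] (mod 2 * int n)" for l m
    using that by (simp add: cong_diff_iff_cong_0)
  have sum: "[l + m = 0] (mod 2 * int n)" if "[l = - m] (mod 2 * int n)" for l m
    using that cong_diff_iff_cong_0[of l "- m" "2 * int n"] by simp
  show ?thesis
    unfolding dihedral_invariant_def
  proof (intro ballI conjI)
    fix p assume p: "p \<in> S3"
    \<comment> \<open>The rotation angle \<open>(l - m) * pi / n\<close> is a multiple of
      \<open>2 * pi\<close>, so the screw fixes each bracket of the listed function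
      separately.\<close>
    have screw_diff: "\<Psi> k l m (screw n p) + \<Psi> k (-l) (-m) (screw n p) = \<Psi> k l m p + \<Psi> k (-l) (-m) p"
      "\<Psi> k l (-m) (screw n p) - \<Psi> k (-l) m (screw n p) = \<Psi> k l (-m) p - \<Psi> k (-l) m p"
      "\<Psi> k m l (screw n p) + \<Psi> k (-m) (-l) (screw n p) = \<Psi> k m l p + \<Psi> k (-m) (-l) p"
      "\<Psi> k (-m) l (screw n p) - \<Psi> k m (-l) (screw n p) = \<Psi> k (-m) l p - \<Psi> k m (-l) p"
      if "(l, m) \<in> R" "[l = m] (mod 2 * int n)" for l m
      using pair_choiceD[OF R that(1)] mode_screw(1,2)[OF _ _ p, of l m k n] mode_screw(1,2)[OF _ _ p, of m l k n]
        cs[OF diff[OF that(2)]] cs[OF diff[OF cong_sym[OF that(2)]]] by simp_all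
    have screw_sum: "\<Psi> k l m (screw n p) - \<Psi> k (-l) (-m) (screw n p) = \<Psi> k l m p - \<Psi> k (-l) (-m) p"
      "\<Psi> k l (-m) (screw n p) + \<Psi> k (-l) m (screw n p) = \<Psi> k l (-m) p + \<Psi> k (-l) m p"
      "\<Psi> k m l (screw n p) - \<Psi> k (-m) (-l) (screw n p) = \<Psi> k m l p - \<Psi> k (-m) (-l) p"
      "\<Psi> k (-m) l (screw n p) + \<Psi> k m (-l) (screw n p) = \<Psi> k (-m) l p + \<Psi> k m (-l) p"
      if "(l, m) \<in> R" "[l = - m] (mod 2 * int n)" for l m
      using pair_choiceD[OF R that(1)] mode_screw(3,4)[OF _ _ p, of l m k n] mode_screw(3,4)[OF _ _ p, of m l k n]
        cs[OF sum[OF that(2)]] by (simp_all add: add.commute)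
    show "b (screw n p) = b p"
      using b
    proof cases
      case m1 then show ?thesis using mode_screw_zero[OF p] by simp
    next
      case (m2a l) then show ?thesis using mode_screw_axis[OF _ p, of l k n] cs[of l] by simp
    next
      case (m2b l) then show ?thesis using mode_screw_axis[OF _ p, of l k n] cs[of l] by simp
    next
      case (m3a l) then show ?thesis using mode_screw_axis[OF _ p, of l k n] cs[of l] by simp
    next
      case (m3b l) then show ?thesis using mode_screw_axis[OF _ p, of l k n] cs[of l] by simp
    next
      case (m4a l) then show ?thesis using mode_screw[OF _ _ p, of l l k n] by simp
    next
      case (m4b l) then show ?thesis using mode_screw[OF _ _ p, of l l k n] by simp
    next
      case (m5 l) then show ?thesis using mode_screw[OF _ _ p, of l l k n] cs[of "l + l"] by simp
    next
      case (m6 l) then show ?thesis using mode_screw[OF _ _ p, of l l k n] cs[of "l + l"] by simp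
    next
      case (m7a l m) from screw_diff[OF m7a(2,4)] show ?thesis by (simp add: m7a(1))
    next
      case (m7b l m) from screw_diff[OF m7b(2,4)] show ?thesis by (simp add: m7b(1))
    next
      case (m8a l m) from screw_diff[OF m8a(2,4)] show ?thesis by (simp add: m8a(1))
    next
      case (m8b l m) from screw_diff[OF m8b(2,4)] show ?thesis by (simp add: m8b(1))
    next
      case (m9a l m) from screw_sum[OF m9a(2,4)] show ?thesis by (simp add: m9a(1))
    next
      case (m9b l m) from screw_sum[OF m9b(2,4)] show ?thesis by (simp add: m9b(1))
    next
      case (m10a l m) from screw_sum[OF m10a(2,4)] show ?thesis by (simp add: m10a(1))
    next
      case (m10b l m) from screw_sum[OF m10b(2,4)] show ?thesis by (simp add: m10b(1))
    qed
    \<comment> \<open>All eight modes of a pair carry the sign \<open>\<sigma> k l m\<close>, with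
      an extra minus for mixed signs of the indices. The flip therefore exchanges the two brackets
      with just the sign that joins them in the list.\<close>
    have quad: "\<sigma> k (-l) (-m) = \<sigma> k l m" "\<sigma> k (-l) m = - \<sigma> k l m" "\<sigma> k l (-m) = - \<sigma> k l m"
      "\<sigma> k m l = \<sigma> k l m" "\<sigma> k (-m) (-l) = \<sigma> k l m" "\<sigma> k (-m) l = - \<sigma> k l m" "\<sigma> k m (-l) = - \<sigma> k l m"
      if "(l, m) \<in> R" "even l \<longleftrightarrow> even m" for l m
      using pair_choiceD[OF R that(1)] that(2) by (simp_all add: mode_sign_neg mode_sign_swap[of l m k])
    note even = even_of_cong[where n = n]
    note flip = mode_flip[OF p]
    show "b (flip p) = b p"
      using b
    proof cases
      case m1 then show ?thesis using mode_sign_zero[of k] by (simp add: flip)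
    next
      case (m2a l) then show ?thesis using mode_sign_axis[of l k] even(1)[of l 0] by (simp add: flip)
    next
      case (m2b l) then show ?thesis using mode_sign_axis[of l k] even(1)[of l 0] by (simp add: flip)
    next
      case (m3a l) then show ?thesis using mode_sign_axis[of l k] even(1)[of l 0] by (simp add: flip)
    next
      case (m3b l) then show ?thesis using mode_sign_axis[of l k] even(1)[of l 0] by (simp add: flip)
    next
      case (m4a l) then show ?thesis using mode_sign_diag[of l k] mode_sign_neg[of l l k] by (simp add: flip)
    next
      case (m4b l) then show ?thesis using mode_sign_diag[of l k] mode_sign_neg[of l l k] by (simp add: flip)
    next
      case (m5 l) then show ?thesis using mode_sign_diag[of l k] mode_sign_neg[of l l k] by (simp add: flip)
    next
      case (m6 l) then show ?thesis using mode_sign_diag[of l k] mode_sign_neg[of l l k] by (simp add: flip)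
    next
      case (m7a l m) with quad[OF m7a(2) even(1)[OF m7a(4)]] mode_sign_eq(1)[OF m7a(5)]
        show ?thesis by (simp add: flip)
    next
      case (m7b l m) with quad[OF m7b(2) even(1)[OF m7b(4)]] mode_sign_eq(1)[OF m7b(5)]
        show ?thesis by (simp add: flip)
    next
      case (m8a l m) with quad[OF m8a(2) even(1)[OF m8a(4)]] mode_sign_eq(2)[OF m8a(5)]
        show ?thesis by (simp add: flip)
    next
      case (m8b l m) with quad[OF m8b(2) even(1)[OF m8b(4)]] mode_sign_eq(2)[OF m8b(5)]
        show ?thesis by (simp add: flip)
    next
      case (m9a l m) with quad[OF m9a(2) even(2)[OF m9a(4)]] mode_sign_eq(1)[OF m9a(5)]
        show ?thesis by (simp add: flip)
    next
      case (m9b l m) with quad[OF m9b(2) even(2)[OF m9b(4)]] mode_sign_eq(1)[OF m9b(5)]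
        show ?thesis by (simp add: flip)
    next
      case (m10a l m) with quad[OF m10a(2) even(2)[OF m10a(4)]] mode_sign_eq(2)[OF m10a(5)]
        show ?thesis by (simp add: flip)
    next
      case (m10b l m) with quad[OF m10b(2) even(2)[OF m10b(4)]] mode_sign_eq(2)[OF m10b(5)]
        show ?thesis by (simp add: flip)
    qed
  qed
qed


section \<open>Vanishing of coefficients\<close>

text \<open>\<open>h\<close> stands for what remains of an invariant eigenfunction after subtraction
  of its projection onto the list; the aim is \<open>h = 0\<close> on the sphere.\<close>

locale orthogonal_eigenfunction =
  fixes n k :: nat and R :: "(int \<times> int) set" and h :: "real^4 \<Rightarrow> real"
  assumes n: "n \<ge> 1" and R: "pair_choice R"
    and eigen: "eigen_S3 k h" and invariant: "dihedral_invariant n h"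
    and orthogonal: "\<And>b. b \<in> prism_modes n k R \<Longrightarrow> inner_S3 h b = 0"
begin

abbreviation c :: "int \<Rightarrow> int \<Rightarrow> real" where
  "c l m \<equiv> inner_S3 h (\<Psi> k l m)"

lemma h [simp]: "continuous_on S3 h"
  by (rule eigen_S3_continuous[OF eigen])

text \<open>The change of variables \<open>p \<mapsto> flip p\<close> in the integral leaves
  \<open>h\<close> alone and gives the mode its sign.\<close>

lemma coefficient_flip: "c l m = \<sigma> k l m * c m l"
proof -
  have "c l m = integral_S3 (\<lambda>p. h (flip p) * \<Psi> k l m (flip p))"
    unfolding inner_S3_def
    by (rule integral_S3_flip[symmetric]) (intro continuous_intros h mode_continuous)
  also have "\<dots> = integral_S3 (\<lambda>p. h p * (\<sigma> k l m * \<Psi> k m l p))"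
    using invariant by (intro integral_S3_cong) (simp only: mode_flip dihedral_invariant_def)
  also have "\<dots> = inner_S3 h (\<lambda>p. \<sigma> k l m * \<Psi> k m l p)"
    by (simp add: inner_S3_def)
  finally show ?thesis
    by (simp only: inner_S3_cmult[OF h mode_continuous])
qed

text \<open>The pair of coefficients is fixed by a rotation through \<open>a\<close>, and a rotation
  other than the identity fixes only 0.\<close>

lemma rotation_vanish:
  assumes F: "continuous_on S3 F" "continuous_on S3 G"
    and rot: "\<And>p. p \<in> S3 \<Longrightarrow> F (screw n p) = cos a * F p - sin a * G p"
      "\<And>p. p \<in> S3 \<Longrightarrow> G (screw n p) = sin a * F p + cos a * G p"
    and a: "cos a \<noteq> 1"
  shows "inner_S3 h F = 0" "inner_S3 h G = 0"
proof -
  have screw: "inner_S3 h X = inner_S3 h Y"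
    if "continuous_on S3 X" "\<And>p. p \<in> S3 \<Longrightarrow> X (screw n p) = Y p" for X Y
  proof -
    have "inner_S3 h X = integral_S3 (\<lambda>p. h (screw n p) * X (screw n p))"
      unfolding inner_S3_def
      by (rule integral_S3_screw[OF _ n, symmetric]) (intro continuous_intros h that)
    also have "\<dots> = inner_S3 h Y"
      unfolding inner_S3_def using invariant
      by (intro integral_S3_cong) (simp only: that(2) dihedral_invariant_def)
    finally show ?thesis .
  qed
  define x y where "x = inner_S3 h F" and "y = inner_S3 h G"
  have x: "x = cos a * x - sin a * y"
    using screw[OF F(1) rot(1)] by (simp add: inner_S3_linear F x_def y_def)
  have y: "y = sin a * x + cos a * y"
    using screw[OF F(2) rot(2)] by (simp add: inner_S3_linear F x_def y_def)
  have sq: "sin a * sin a = 1 - cos a * cos a"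
    using sin_cos_squares(1)[of a] by simp
  have x': "(1 - cos a) * x = - sin a * y" and y': "(1 - cos a) * y = sin a * x"
    using x y by (simp_all add: algebra_simps)
  \<comment> \<open>Multiplying the first equation by \<open>1 - cos a\<close> and substituting the
    second eliminates \<open>y\<close>; it leaves \<open>2 * (1 - cos a) * x = 0\<close> without a
    case distinction on \<open>sin a\<close>.\<close>
  have "(1 - cos a) * ((1 - cos a) * x) = - sin a * ((1 - cos a) * y)"
    unfolding x' by (simp only: ac_simps)
  then have "(1 - cos a) * ((1 - cos a) * x) + sin a * sin a * x = 0"
    unfolding y' by simp
  moreover have "(1 - cos a) * ((1 - cos a) * x) + (1 - cos a * cos a) * x = 2 * (1 - cos a) * x"
    by (simp add: algebra_simps)
  ultimately have "2 * (1 - cos a) * x = 0" by (simp only: sq)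
  then have "x = 0" using a by simp
  with y' a have "y = 0" by simp
  with \<open>x = 0\<close> show "inner_S3 h F = 0" "inner_S3 h G = 0" by (simp_all add: x_def y_def)
qed

lemma screw_diff:
  assumes "0 < l" "0 < m" "\<not> [l = m] (mod 2 * int n)"
  shows "c l m + c (-l) (-m) = 0" "c (-l) m - c l (-m) = 0"
proof -
  have "cos (of_int (l - m) * (pi / real n)) \<noteq> 1"
    unfolding screw_angle(1)[OF n] using assms(3) by (simp add: cong_diff_iff_cong_0)
  from rotation_vanish[where F = "\<lambda>p. \<Psi> k l m p + \<Psi> k (-l) (-m) p" and G = "\<lambda>p. \<Psi> k (-l) m p - \<Psi> k l (-m) p",
      OF _ _ mode_screw(1,2)[OF assms(1,2)] this]
  show "c l m + c (-l) (-m) = 0" "c (-l) m - c l (-m) = 0"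
    by (simp_all add: inner_S3_linear mode_continuous)
qed

lemma screw_sum:
  assumes "0 < l" "0 < m" "\<not> [l = - m] (mod 2 * int n)"
  shows "c l m - c (-l) (-m) = 0" "c (-l) m + c l (-m) = 0"
proof -
  have "cos (of_int (l + m) * (pi / real n)) \<noteq> 1"
    unfolding screw_angle(1)[OF n] using assms(3) cong_diff_iff_cong_0[of l "- m" "2 * int n"] by simp
  from rotation_vanish[where F = "\<lambda>p. \<Psi> k l m p - \<Psi> k (-l) (-m) p" and G = "\<lambda>p. \<Psi> k (-l) m p + \<Psi> k l (-m) p",
      OF _ _ mode_screw(3,4)[OF assms(1,2)] this]
  show "c l m - c (-l) (-m) = 0" "c (-l) m + c l (-m) = 0"
    by (simp_all add: inner_S3_linear mode_continuous)
qed

lemma coefficient_zero_zero: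
  assumes ex: "mode_exists k 0 0"
  shows "c 0 0 = 0"
proof (cases "[k = 0] (mod 4)")
  case True
  with ex show ?thesis by (intro orthogonal prism_modes.m1)
next
  case False
  with coefficient_flip[of 0 0] mode_sign_zero[OF ex] show ?thesis by simp
qed

lemma coefficient_axis:
  assumes l: "0 < l" and ex: "mode_exists k l 0"
  shows "c l 0 = 0" "c (-l) 0 = 0" "c 0 l = 0" "c 0 (-l) = 0"
proof -
  have *: "c l 0 = 0 \<and> c (-l) 0 = 0"
  proof (cases "[l = 0] (mod 2 * int n)")
    case False
    then have "cos (of_int l * (pi / real n)) \<noteq> 1" unfolding screw_angle(1)[OF n] .
    from rotation_vanish[where F = "\<Psi> k l 0" and G = "\<Psi> k (-l) 0", OF _ _ mode_screw_axis(1,2)[OF l] this] show ?thesis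
      by (simp add: mode_continuous)
  next
    case True
    note sign = mode_sign_axis(1,2)[OF l, of k]
    show ?thesis
    proof (cases "even (mode_degree k l 0)")
      case even: True
      \<comment> \<open>The flip ties \<open>c l 0\<close> to \<open>c 0 l\<close> by one sign and
        the listed function demands the opposite sign, so both vanish; likewise for
        \<open>- l\<close>.\<close>
      note perp = prism_modes.m2a[OF l ex True even, THEN orthogonal]
        prism_modes.m2b[OF l ex True even, THEN orthogonal]
      show ?thesis
        using perp coefficient_flip[of l 0] coefficient_flip[of "-l" 0] even
        by (simp add: inner_S3_linear mode_continuous sign)
    next
      case odd: False
      note perp = prism_modes.m3a[OF l ex True odd, THEN orthogonal]
        prism_modes.m3b[OF l ex True odd, THEN orthogonal]
      show ?thesis
        using perp coefficient_flip[of l 0] coefficient_flip[of "-l" 0] odd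
        by (simp add: inner_S3_linear mode_continuous sign)
    qed
  qed
  then show "c l 0 = 0" "c (-l) 0 = 0" by auto
  with coefficient_flip[of 0 l] coefficient_flip[of 0 "-l"] show "c 0 l = 0" "c 0 (-l) = 0" by auto
qed

text \<open>The angle \<open>l (\<theta> - \<phi>)\<close> is untouched by the screw, so the class
  of \<open>k\<close> modulo 4 alone decides on its coefficients. The angle
  \<open>l (\<theta> + \<phi>)\<close> moves, and \<open>2 l\<close> modulo \<open>2 n\<close>
  enters as well.\<close>

lemma coefficient_diag:
  assumes l: "0 < l" and ex: "mode_exists k l l"
  shows "c l l = 0" "c (-l) (-l) = 0" "c (-l) l = 0" "c l (-l) = 0"
proof -
  note sign = mode_sign_diag[OF l ex] mode_sign_neg[OF l l, of k]
  note flip = coefficient_flip[of l l] coefficient_flip[of "-l" "-l"] coefficient_flip[of "-l" l]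
  have a: "c l l + c (-l) (-l) = 0 \<and> c (-l) l - c l (-l) = 0"
  proof (cases "[k = 0] (mod 4)")
    case True
    from prism_modes.m4a[OF l ex True, THEN orthogonal] prism_modes.m4b[OF l ex True, THEN orthogonal]
    show ?thesis by (simp add: inner_S3_linear mode_continuous)
  next
    case False
    with flip show ?thesis by (simp add: sign)
  qed
  have b: "c l l - c (-l) (-l) = 0 \<and> c (-l) l + c l (-l) = 0"
  proof (cases "[l = - l] (mod 2 * int n)")
    case False
    from screw_sum[OF l l this] show ?thesis by simp
  next
    case True
    then have l2: "[2 * l = 0] (mod 2 * int n)"
      using cong_diff_iff_cong_0[of l "- l" "2 * int n"] by simp
    show ?thesis
    proof (cases "[k = 0] (mod 4)")
      case True
      from prism_modes.m5[OF l ex l2 True, THEN orthogonal] flip True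
      show ?thesis by (simp add: inner_S3_linear mode_continuous sign)
    next
      case False
      then have "[k = 2] (mod 4)" by (simp add: sign)
      from prism_modes.m6[OF l ex l2 this, THEN orthogonal] flip False
      show ?thesis by (simp add: inner_S3_linear mode_continuous sign)
    qed
  qed
  from a b show "c l l = 0" "c (-l) (-l) = 0" "c (-l) l = 0" "c l (-l) = 0" by linarith+
qed

text \<open>The coefficients are recovered from the sums and differences belonging to the two
  angles. Each of these vanishes by rotation or, when the congruence holds, because the flip turns
  the inner product with a listed function into a multiple of it.\<close>

lemma coefficient_pair:
  assumes lm: "(l, m) \<in> R" and ex: "mode_exists k l m"
  shows "c l m = 0" "c (-l) (-m) = 0" "c (-l) m = 0" "c l (-m) = 0"
proof -
  note pos = pair_choiceD(1,2)[OF R lm]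
  note sign = mode_sign_neg[OF pos, of k]
  have flip: "c l m = \<sigma> k l m * c m l" "c (-l) (-m) = \<sigma> k l m * c (-m) (-l)"
    "c (-l) m = - \<sigma> k l m * c m (-l)" "c l (-m) = - \<sigma> k l m * c (-m) l"
    using coefficient_flip[of l m] coefficient_flip[of "-l" "-m"] coefficient_flip[of "-l" m] coefficient_flip[of l "-m"]
    by (simp_all add: sign)
  have a: "c l m + c (-l) (-m) = 0 \<and> c (-l) m - c l (-m) = 0"
  proof (cases "[l = m] (mod 2 * int n)")
    case False
    from screw_diff[OF pos this] show ?thesis by simp
  next
    case True
    show ?thesis
    proof (cases "\<sigma> k l m > 0")
      case pos: True
      then have "\<sigma> k l m = 1" using mode_sign_pm[of k l m] by auto
      with prism_modes.m7a[OF lm ex True pos, THEN orthogonal]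
        prism_modes.m7b[OF lm ex True pos, THEN orthogonal] flip
      show ?thesis by (simp add: inner_S3_linear mode_continuous)
    next
      case False
      then have neg: "\<sigma> k l m < 0" "\<sigma> k l m = - 1" using mode_sign_pm[of k l m] by auto
      with prism_modes.m8a[OF lm ex True neg(1), THEN orthogonal]
        prism_modes.m8b[OF lm ex True neg(1), THEN orthogonal] flip
      show ?thesis by (simp add: inner_S3_linear mode_continuous)
    qed
  qed
  have b: "c l m - c (-l) (-m) = 0 \<and> c (-l) m + c l (-m) = 0"
  proof (cases "[l = - m] (mod 2 * int n)")
    case False
    from screw_sum[OF pos this] show ?thesis by simp
  next
    case True
    show ?thesis
    proof (cases "\<sigma> k l m > 0")
      case pos: True
      then have "\<sigma> k l m = 1" using mode_sign_pm[of k l m] by auto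
      with prism_modes.m9a[OF lm ex True pos, THEN orthogonal]
        prism_modes.m9b[OF lm ex True pos, THEN orthogonal] flip
      show ?thesis by (simp add: inner_S3_linear mode_continuous)
    next
      case False
      then have neg: "\<sigma> k l m < 0" "\<sigma> k l m = - 1" using mode_sign_pm[of k l m] by auto
      with prism_modes.m10a[OF lm ex True neg(1), THEN orthogonal]
        prism_modes.m10b[OF lm ex True neg(1), THEN orthogonal] flip
      show ?thesis by (simp add: inner_S3_linear mode_continuous)
    qed
  qed
  from a b show "c l m = 0" "c (-l) (-m) = 0" "c (-l) m = 0" "c l (-m) = 0" by linarith+
qed

lemma coefficient_vanish:
  assumes ex: "mode_exists k l m"
  shows "c l m = 0"
proof -
  define a b where "a = \<bar>l\<bar>" and "b = \<bar>m\<bar>"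
  have l: "l = a \<or> l = - a" and m: "m = b \<or> m = - b" by (auto simp: a_def b_def)
  have ab: "0 \<le> a" "0 \<le> b" by (simp_all add: a_def b_def)
  have ex': "mode_exists k a b" using ex by (auto simp: a_def b_def abs_if mode_exists_sym(1,2))
  have "c a b = 0 \<and> c (-a) (-b) = 0 \<and> c (-a) b = 0 \<and> c a (-b) = 0"
  proof -
    consider "a = 0" "b = 0" | "0 < a" "b = 0" | "a = 0" "0 < b" | "0 < a" "a = b"
      | "0 < a" "0 < b" "a \<noteq> b" using ab by linarith
    then show ?thesis
    proof cases
      case 1
      with ex' coefficient_zero_zero show ?thesis by simp
    next
      case 2
      with ex' coefficient_axis[of a] show ?thesis by simp
    next
      case 3
      then have "mode_exists k b 0" using ex' mode_exists_sym(3)[of k a b] by simp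
      with 3 coefficient_axis[of b] show ?thesis by simp
    next
      case 4
      with ex' coefficient_diag[of a] show ?thesis by simp
    next
      case 5
      show ?thesis
      proof (cases "(a, b) \<in> R")
        case True
        from coefficient_pair[OF this ex'] show ?thesis by simp
      next
        case False
        \<comment> \<open>The order of the pair that \<open>R\<close> leaves out is reached through
          the flip.\<close>
        with 5 R have "(b, a) \<in> R" unfolding pair_choice_def by blast
        from coefficient_pair[OF this] ex' mode_exists_sym(3)[of k a b]
        have "c b a = 0" "c (-b) (-a) = 0" "c (-b) a = 0" "c b (-a) = 0" by auto
        with coefficient_flip[of a b] coefficient_flip[of "-a" "-b"] coefficient_flip[of "-a" b] coefficient_flip[of a "-b"]
        show ?thesis by simp
      qed
    qed
  qed
  with l m show ?thesis by auto
qed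

lemma vanish: "p \<in> S3 \<Longrightarrow> h p = 0"
proof (rule modes_complete[OF h])
  fix k' l m assume ex: "mode_exists k' l m"
  show "inner_S3 h (\<Psi> k' l m) = 0"
  proof (cases "k' = k")
    case True
    with ex coefficient_vanish show ?thesis by simp
  next
    case False
    with eigen_S3_orthogonal[OF eigen eigen_S3_mode[OF ex]] show ?thesis by simp
  qed
qed

end

section \<open>Subtraction of the projection onto the list\<close>

lemma eigen_S3_subtract_sum:
  assumes "finite A" "eigen_S3 k f" "\<And>b. b \<in> A \<Longrightarrow> eigen_S3 k b"
  shows "eigen_S3 k (\<lambda>p. f p - (\<Sum>b\<in>A. a b * b p))"
  using assms
proof (induction A rule: finite_induct)
  case (insert b A)
  have "eigen_S3 k (\<lambda>p. (f p - (\<Sum>b\<in>A. a b * b p)) + - a b * b p)"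
    using insert by (intro eigen_S3_add eigen_S3_cmult) auto
  then show ?case using insert.hyps by (simp add: algebra_simps)
qed simp

lemma inner_S3_subtract_sum:
  assumes "finite A" "continuous_on S3 g" "continuous_on S3 f" "\<And>b. b \<in> A \<Longrightarrow> continuous_on S3 b"
  shows "inner_S3 g (\<lambda>p. f p - (\<Sum>b\<in>A. a b * b p)) = inner_S3 g f - (\<Sum>b\<in>A. a b * inner_S3 g b)"
  using assms
proof (induction A rule: finite_induct)
  case (insert b A)
  have "continuous_on S3 (\<lambda>p. f p - (\<Sum>b\<in>A. a b * b p))"
    using insert by (intro continuous_intros) auto
  with insert have "inner_S3 g (\<lambda>p. (f p - (\<Sum>b\<in>A. a b * b p)) - a b * b p)
      = (inner_S3 g f - (\<Sum>b\<in>A. a b * inner_S3 g b)) - a b * inner_S3 g b"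
    by (subst inner_S3_diff) (auto simp: inner_S3_cmult continuous_on_mult_left)
  then show ?case using insert.hyps by (simp add: algebra_simps)
qed simp

theorem theorem3:
  fixes n k :: nat and R :: "(int \<times> int) set"
  assumes "n \<ge> 1"
    and "pair_choice R"
  shows "is_orthonormal_basis_S3 (prism_modes n k R) (prism_eigenspace n k)"
proof -
  let ?B = "prism_modes n k R" and ?f = "\<lambda>i. mode_comb k (index_terms i)"
  have index: "\<exists>i. valid_index k R i \<and> b = ?f i" if "b \<in> ?B" for b
    using prism_modes_index[OF assms(2) that] .
  have "?B \<subseteq> ?f ` {i. valid_index k R i}" using index by blast
  then have fin: "finite ?B" by (rule finite_subset) (intro finite_imageI finite_valid_index)
  have span: "mode_span k b" if b: "b \<in> ?B" for b
  proof -
    obtain i where i: "valid_index k R i" "b = ?f i" using index[OF b] by blast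
    have "hd (index_terms i) \<in> set (index_terms i)" by (cases i) simp_all
    then obtain c l m where "(c, l, m) \<in> set (index_terms i)" by (metis prod_cases3)
    then show ?thesis
      unfolding i(2) by (intro mode_span_comb[OF index_terms_exist[OF i(1)]] index_terms_exist[OF i(1)])
  qed
  then have eig: "eigen_S3 k b" if "b \<in> ?B" for b using that by (simp add: mode_span_def)
  have orthonormal: "inner_S3 f g = (if f = g then 1 else 0)" if fg: "f \<in> ?B" "g \<in> ?B" for f g
  proof -
    obtain i j where i: "valid_index k R i" "f = ?f i" and j: "valid_index k R j" "g = ?f j"
      using index[OF fg(1)] index[OF fg(2)] by (elim exE conjE)
    \<comment> \<open>The claim compares functions, not indices: distinct functions have distinct
      indices, and equal functions give the value \<open>inner_S3 f f = 1\<close>.\<close>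
    have "inner_S3 f g = (if i = j then 1 else 0)" "inner_S3 f f = 1"
      using index_orthonormal[OF assms(2) i(1) j(1)] index_orthonormal[OF assms(2) i(1) i(1)] i(2) j(2) by simp_all
    then show ?thesis using i(2) j(2) by auto
  qed
  have complete: "\<exists>c. \<forall>p\<in>S3. f p = (\<Sum>b\<in>?B. c b * b p)" if f: "f \<in> prism_eigenspace n k" for f
  proof -
    \<comment> \<open>The coefficients are inner products, so orthonormality of the list makes
      \<open>h\<close> orthogonal to it, while \<open>h\<close> inherits eigenvalue and
      invariance.\<close>
    define h where "h p = f p - (\<Sum>b\<in>?B. inner_S3 f b * b p)" for p
    note f = prism_eigenspaceD[OF f]
    have "orthogonal_eigenfunction n k R h"
    proof
      show "eigen_S3 k h"
        unfolding h_def by (intro eigen_S3_subtract_sum fin f(1) eig)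
      show "dihedral_invariant n h"
        using f(2) prism_modes_invariant[OF assms]
        unfolding dihedral_invariant_def h_def by (auto intro!: sum.cong)
      show "inner_S3 h b = 0" if b: "b \<in> ?B" for b
      proof -
        have "inner_S3 b h = inner_S3 b f - (\<Sum>b'\<in>?B. inner_S3 f b' * inner_S3 b b')"
          unfolding h_def
          by (intro inner_S3_subtract_sum fin eigen_S3_continuous[OF eig] b eigen_S3_continuous[OF f(1)])
        also have "(\<Sum>b'\<in>?B. inner_S3 f b' * inner_S3 b b') = (\<Sum>b'\<in>?B. if b = b' then inner_S3 f b' else 0)"
          using orthonormal[OF b] by (intro sum.cong) auto
        also have "\<dots> = inner_S3 f b" using fin b by simp
        finally show ?thesis by (simp add: inner_S3_commute[of h] inner_S3_commute[of b f])
      qed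
    qed (use assms in auto)
    then have "\<forall>p\<in>S3. h p = 0" using orthogonal_eigenfunction.vanish by blast
    then show ?thesis unfolding h_def by (intro exI[of _ "inner_S3 f"]) simp
  qed
  show ?thesis
    unfolding is_orthonormal_basis_S3_def
    using fin orthonormal complete prism_eigenspaceI[OF span prism_modes_invariant[OF assms]] by blast
qed

end
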